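(* Let $q$ be a prime power, let $r,n$ be positive integers with $r\ge 3$, let $(f_1(x),\ldots,f_r(x))$ be an $r$-tuple of $q$-polynomials over $\mathbb{F}_{q^n}$ of one of the following types (where $s$ denotes a positive integer), and let $N=\frac{q^n-1}{q-1}$: (1) $r\le n$, $(x,x^{q^s},\ldots,x^{q^{s(r-1)}})$ with $\gcd(s,n)=1$; (2) $r\le n$, $(x^{q^s},\ldots,x^{q^{s(r-1)}},x+\delta x^{q^{sr}})$ with $\gcd(s,n)=1$, $\delta\in\mathbb{F}_{q^n}$ and $\mathrm{N}_{q^n/q}(\delta)\ne(-1)^{nr}$; (3) $n=6$, $r=4$, $(x^q,x^{q^2},x^{q^4},x-\delta^{q^5}x^{q^3})$ with $q>4$ and $\delta\in\mathbb{F}_{q^6}$ such that the linear set $\{\langle(f_1(x),\ldots,f_4(x))\rangle_{\mathbb{F}_{q^6}}:x\in\mathbb{F}_{q^6}^*\}$ is scattered with respect to hyperplanes; (4) $n=6$, $r=4$, $(x^q,x^{q^3},x-x^{q^2},x^{q^4}-\delta x)$ with $q$ odd, $\delta\in\mathbb{F}_{q^6}$, $\delta^2+\delta=1$; (5) $n=6$, $r=4$, $(h^{q^2-1}x^q+h^{q-1}x^{q^2},\,x^{q^3},\,x^q-h^{q-1}x^{q^4},\,x^q-h^{q-1}x^{q^5})$ with $q$ odd, $h\in\mathbb{F}_{q^6}$, $h^{q^3+1}=-1$; (6) $n=7$, $r=3$, $(x,x^{q^s},x^{q^{3s}})$ with $q$ odd, $\gcd(s,7)=1$; (7) $n=7$,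 $r=4$, $(x,x^{q^{2s}},x^{q^{3s}},x^{q^{4s}})$ with $q$ odd, $\gcd(s,7)=1$; (8) $n=8$, $r=3$, $(x,x^{q^s},x^{q^{3s}})$ with $q\equiv1\pmod 3$, $\gcd(s,8)=1$; (9) $n=8$, $r=5$, $(x,x^{q^{2s}},x^{q^{3s}},x^{q^{4s}},x^{q^{5s}})$ with $q\equiv1\pmod 3$, $\gcd(s,8)=1$; (10) $n=8$, $r=6$, $(x^q,x^{q^2},x^{q^3},x^{q^5},x^{q^6},x-\delta x^{q^4})$ with $q$ odd, $\delta\in\mathbb{F}_{q^8}$, $\delta^2=-1$. If $G$ is an $(r\times N)$-matrix over $\mathbb{F}_{q^n}$ whose columns are the vectors of $$\{(f_1(x),\ldots,f_r(x)) : x\in\mathbb{F}_{q^n}^*\},$$ one chosen for each point $\langle(f_1(x),\ldots,f_r(x))\rangle_{\mathbb{F}_{q^n}}$ of $\mathrm{PG}(r-1,q^n)$ that they define, then $G$ is the generator matrix of an $r$-weight linear $[N,r]_{q^n}$-code.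
   Context: $q$-polynomials over $\mathbb{F}_{q^n}$ are polynomials $\sum_i a_ix^{q^i}$ with $a_i\in\mathbb{F}_{q^n}$, considered modulo $x^{q^n}-x$, i.e. as $\mathbb{F}_q$-linear maps $\mathbb{F}_{q^n}\to\mathbb{F}_{q^n}$. $\mathrm{N}_{q^n/q}$ denotes the norm from $\mathbb{F}_{q^n}$ to $\mathbb{F}_q$. For an $n$-dimensional $\mathbb{F}_q$-subspace $U$ of $\mathbb{F}_{q^n}^r$, the $\mathbb{F}_q$-linear set $L_U=\{\langle u\rangle_{\mathbb{F}_{q^n}}:u\in U\setminus\{0\}\}$ of $\mathrm{PG}(r-1,q^n)$ is scattered with respect to hyperplanes if $L_U$ spans $\mathrm{PG}(r-1,q^n)$ and $\dim_{\mathbb{F}_q}(W\cap U)\le r-1$ for every hyperplane $W$ (i.e. $(r-1)$-dimensional $\mathbb{F}_{q^n}$-subspace) of $\mathbb{F}_{q^n}^r$. An $[N,r]_{q^n}$-code is an $r$-dimensional $\mathbb{F}_{q^n}$-subspace of $\mathbb{F}_{q^n}^N$; a generator matrix is an $(r\times N)$-matrix whose rows form a basis of it. An $r$-weight code is a linear code whose nonzero codewords have exactly $r$ distinct Hamming weights. *)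

theory Defs
  imports
    "Jordan_Normal_Form.VS_Connect"
    "HOL-Library.Cardinality"
    "HOL-Number_Theory.Prime_Powers"
    "HOL-Number_Theory.Cong"
begin

text \<open>
  Throughout, the field of order \<open>q^n\<close> is a type \<open>'a :: {field, finite}\<close> with
  \<open>CARD('a) = q ^ n\<close>, and its subfield of order \<open>q\<close> is the set of solutions of \<open>x ^ q = x\<close>.
  A \<open>q\<close>-polynomial, taken modulo \<open>x ^ (q ^ n) - x\<close>, is the same as the map it induces on \<open>'a\<close>, so
  tuples of \<open>q\<close>-polynomials are lists of functions.
\<close>

definition Fq :: "nat \<Rightarrow> 'a::{field,finite} ring" where
  "Fq q = class_ring\<lparr>carrier := {x. x ^ q = x}\<rparr>"

text \<open>The norm to the subfield of order \<open>q\<close>, as the product of the conjugates.\<close>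

definition field_norm :: "nat \<Rightarrow> nat \<Rightarrow> 'a::{field,finite} \<Rightarrow> 'a" where
  "field_norm q n a = (\<Prod>i<n. a ^ (q ^ i))"

definition tuple_vec :: "('a::{field,finite} \<Rightarrow> 'a) list \<Rightarrow> 'a \<Rightarrow> 'a vec" where
  "tuple_vec fs x = vec_of_list (map (\<lambda>f. f x) fs)"


section \<open>Linear sets\<close>

abbreviation vspace :: "nat \<Rightarrow> ('a::{field,finite}, 'a vec) module" where
  "vspace r \<equiv> module_vec TYPE('a) r"

definition proj_point :: "nat \<Rightarrow> 'a::{field,finite} vec \<Rightarrow> 'a vec set" where
  "proj_point r v = LinearCombinations.module.span class_ring (vspace r) {v}"

definition linear_set :: "nat \<Rightarrow> 'a::{field,finite} vec set \<Rightarrow> 'a vec set set" where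
  "linear_set r U = proj_point r ` (U - {0\<^sub>v r})"

definition hyperplane :: "nat \<Rightarrow> 'a::{field,finite} vec set \<Rightarrow> bool" where
  "hyperplane r W \<longleftrightarrow>
     VectorSpace.subspace class_ring W (vspace r) \<and>
     vectorspace.dim class_ring ((vspace r)\<lparr>carrier := W\<rparr>) = r - 1"

text \<open>
  The predicate takes the subspace \<open>U\<close> rather than the point set \<open>linear_set r U\<close>, since its
  conditions refer to \<open>U\<close>. The dimensions of \<open>U\<close> and of \<open>W \<inter> U\<close> are taken over the small field
  \<open>Fq q\<close>, that of a hyperplane over the large one.
\<close>

definition scattered_wrt_hyperplanes ::
  "nat \<Rightarrow> nat \<Rightarrow> nat \<Rightarrow> 'a::{field,finite} vec set \<Rightarrow> bool" where
  "scattered_wrt_hyperplanes q n r U \<longleftrightarrow>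
     VectorSpace.subspace (Fq q) U (vspace r) \<and>
     vectorspace.dim (Fq q) ((vspace r)\<lparr>carrier := U\<rparr>) = n \<and>
     LinearCombinations.module.span class_ring (vspace r) (\<Union>(linear_set r U)) = carrier_vec r \<and>
     (\<forall>W. hyperplane r W \<longrightarrow>
        vectorspace.dim (Fq q) ((vspace r)\<lparr>carrier := W \<inter> U\<rparr>) \<le> r - 1)"


section \<open>The tuples of \<open>q\<close>-polynomials\<close>

inductive special_tuple ::
  "nat \<Rightarrow> nat \<Rightarrow> nat \<Rightarrow> ('a::{field,finite} \<Rightarrow> 'a) list \<Rightarrow> bool"
  for q :: nat where
  type1: "special_tuple q n r (map (\<lambda>i x. x ^ (q ^ (s * i))) [0..<r])"
    if "r \<le> n" "s > 0" "gcd s n = 1"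
| type2: "special_tuple q n r
      (map (\<lambda>i x. x ^ (q ^ (s * i))) [1..<r] @ [\<lambda>x. x + \<delta> * x ^ (q ^ (s * r))])"
    if "r \<le> n" "s > 0" "gcd s n = 1" "field_norm q n \<delta> \<noteq> (-1) ^ (n * r)"
| type3: "special_tuple q 6 4 fs"
    if "fs = [\<lambda>x. x ^ q, \<lambda>x. x ^ (q ^ 2), \<lambda>x. x ^ (q ^ 4), \<lambda>x. x - \<delta> ^ (q ^ 5) * x ^ (q ^ 3)]"
       "q > 4" "scattered_wrt_hyperplanes q 6 4 (range (tuple_vec fs))"
| type4: "special_tuple q 6 4
      [\<lambda>x. x ^ q, \<lambda>x. x ^ (q ^ 3), \<lambda>x. x - x ^ (q ^ 2), \<lambda>x. x ^ (q ^ 4) - \<delta> * x]"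
    if "odd q" "\<delta> ^ 2 + \<delta> = 1"
| type5: "special_tuple q 6 4
      [\<lambda>x. h ^ (q ^ 2 - 1) * x ^ q + h ^ (q - 1) * x ^ (q ^ 2),
       \<lambda>x. x ^ (q ^ 3),
       \<lambda>x. x ^ q - h ^ (q - 1) * x ^ (q ^ 4),
       \<lambda>x. x ^ q - h ^ (q - 1) * x ^ (q ^ 5)]"
    if "odd q" "h ^ (q ^ 3 + 1) = -1"
| type6: "special_tuple q 7 3 [\<lambda>x. x, \<lambda>x. x ^ (q ^ s), \<lambda>x. x ^ (q ^ (3 * s))]"
    if "odd q" "s > 0" "gcd s 7 = 1"
| type7: "special_tuple q 7 4
      [\<lambda>x. x, \<lambda>x. x ^ (q ^ (2 * s)), \<lambda>x. x ^ (q ^ (3 * s)), \<lambda>x. x ^ (q ^ (4 * s))]"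
    if "odd q" "s > 0" "gcd s 7 = 1"
| type8: "special_tuple q 8 3 [\<lambda>x. x, \<lambda>x. x ^ (q ^ s), \<lambda>x. x ^ (q ^ (3 * s))]"
    if "[q = 1] (mod 3)" "s > 0" "gcd s 8 = 1"
| type9: "special_tuple q 8 5
      [\<lambda>x. x, \<lambda>x. x ^ (q ^ (2 * s)), \<lambda>x. x ^ (q ^ (3 * s)), \<lambda>x. x ^ (q ^ (4 * s)),
       \<lambda>x. x ^ (q ^ (5 * s))]"
    if "[q = 1] (mod 3)" "s > 0" "gcd s 8 = 1"
| type10: "special_tuple q 8 6
      [\<lambda>x. x ^ q, \<lambda>x. x ^ (q ^ 2), \<lambda>x. x ^ (q ^ 3), \<lambda>x. x ^ (q ^ 5), \<lambda>x. x ^ (q ^ 6),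
       \<lambda>x. x - \<delta> * x ^ (q ^ 4)]"
    if "odd q" "\<delta> ^ 2 = -1"


section \<open>Linear codes\<close>

definition linear_code :: "nat \<Rightarrow> nat \<Rightarrow> 'a::{field,finite} vec set \<Rightarrow> bool" where
  "linear_code N k C \<longleftrightarrow>
     VectorSpace.subspace class_ring C (vspace N) \<and>
     vectorspace.dim class_ring ((vspace N)\<lparr>carrier := C\<rparr>) = k"

definition generator_matrix :: "nat \<Rightarrow> nat \<Rightarrow> 'a::{field,finite} vec set \<Rightarrow> 'a mat \<Rightarrow> bool" where
  "generator_matrix N k C G \<longleftrightarrow>
     G \<in> carrier_mat k N \<and> distinct (rows G) \<and>
     vectorspace.basis class_ring ((vspace N)\<lparr>carrier := C\<rparr>) (set (rows G))"

definition hamming_weight :: "'a::zero vec \<Rightarrow> nat" where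
  "hamming_weight c = card {i. i < dim_vec c \<and> c $ i \<noteq> 0}"

definition weight_code :: "nat \<Rightarrow> nat \<Rightarrow> 'a::{field,finite} vec set \<Rightarrow> bool" where
  "weight_code N m C \<longleftrightarrow> card (hamming_weight ` (C - {0\<^sub>v N})) = m"

end

theory Submission
  imports Defs "Jordan_Normal_Form.DL_Rank"
begin

text \<open>
  Write \<open>F\<close> for the field with \<open>q ^ n\<close> elements and \<open>K\<close> for its subfield with \<open>q\<close> elements. For a
  vector \<open>a\<close> over \<open>F\<close> of length \<open>r\<close> let \<open>L a x\<close> be the combination of \<open>f\<^sub>1 x, ..., f\<^sub>r x\<close> with
  coefficients \<open>a\<close>; it is \<open>K\<close>-linear in \<open>x\<close>. The codeword belonging to \<open>a\<close> lists the values
  \<open>L a x\<close>, one (up to a scalar) for each point of the linear set.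

  The columns represent \<open>N = (q ^ n - 1) / (q - 1)\<close> different points, which is the number of classes
  of nonzero \<open>x\<close> modulo \<open>K\<close>. As \<open>K\<close>-proportional \<open>x\<close> give the same point, the points correspond
  exactly to these classes, and the codeword of \<open>a\<close> has weight \<open>(q ^ n - q ^ d) / (q - 1)\<close> with
  \<open>d\<close> the dimension of the kernel of \<open>L a\<close> (\<open>weight_zeros\<close>). It remains to see that for \<open>a \<noteq> 0\<close> the
  dimension \<open>d\<close> takes exactly the values \<open>0, ..., r - 1\<close>.

  Given \<open>d < r\<close> for all \<open>a \<noteq> 0\<close>, every value occurs by a counting argument
  (\<open>ex_card_zeros\<close>). Evaluation at \<open>r\<close> independent points is then injective, hence bijective, so the
  \<open>a\<close> for which \<open>L a\<close> vanishes on a given \<open>d\<close>-dimensional space \<open>S\<close> number \<open>q ^ (n * (r - d))\<close>,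
  and those which vanish at some further point are too few to exhaust them.

  The bound \<open>d < r\<close>, called \<open>few_zeros\<close> below, is where the ten types differ; it says that the maps
  \<open>L a\<close> form a maximum rank distance code.
  \<^item> For the two Gabidulin types it is the bound on the zeros of a polynomial in a generator \<open>\<sigma>\<close> of
    the Galois group, together with the norm condition in the case of equality
    (\<open>skew_poly_zeros\<close>).
  \<^item> For \<open>(x, \<sigma> x, \<sigma>\<^sup>3 x)\<close> a trinomial with \<open>q ^ 3\<close> zeros gives a linear recurrence for the
    powers of \<open>\<sigma>\<close> on these zeros. Since \<open>\<sigma>\<close> has order \<open>n\<close>, its coefficients contradict \<open>q\<close> odd if \<open>n = 7\<close>, and \<open>q\<close> congruent to 1 modulo 3 if \<open>n = 8\<close>
    (\<open>trinomial_zeros_7\<close>, \<open>trinomial_zeros_8\<close>).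
  \<^item> The remaining explicit types are treated through their duals: if the orthogonal space of
    coefficient vectors has few zeros, so has the given one (\<open>few_zeros_by_duality\<close>). Up to a
    power of \<open>\<sigma>\<close> the dual is either the space of these trinomials, or spanned by \<open>x\<close> and one
    further map \<open>f\<close>. In the latter case few zeros means that \<open>f x / x = f y / y\<close> only if \<open>y / x\<close> is in \<open>K\<close>, which is proved for the
    three maps that occur (\<open>scattered_binomial_8\<close>, \<open>scattered_trinomial_6\<close>,
    \<open>scattered_quadrinomial_6\<close>).
  \<^item> In the type defined by scatteredness with respect to hyperplanes, the zeros of \<open>L a\<close>
    correspond to the intersection of a subspace with the hyperplane orthogonal to \<open>a\<close>
    (\<open>few_zeros_scattered\<close>).
\<close>

section \<open>Finite fields and a generator of the Galois group\<close>

lemma finite_field_power_card: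
  fixes x :: "'a::{field,finite}"
  shows "x ^ CARD('a) = x"
proof (cases "x = 0")
  case True
  then show ?thesis by (simp add: finite_UNIV_card_ge_0)
next
  case False
  have "(\<Prod>y\<in>UNIV-{0}. x * y) = (\<Prod>y\<in>UNIV-{0}. y)"
    by (rule prod.reindex_bij_witness[of _ "\<lambda>y. y / x" "\<lambda>y. x * y"]) (use False in auto)
  then have "x ^ (CARD('a) - 1) * (\<Prod>y\<in>UNIV-{0}. y) = (\<Prod>y\<in>UNIV-{0}. (y::'a))"
    by (simp add: prod.distrib)
  then have "x ^ (CARD('a) - 1) = 1"
    by simp
  then show ?thesis
    by (metis finite_UNIV_card_ge_0 finite mult.right_neutral power_eq_if not_gr_zero)
qed

text \<open>
  All fibres of an additive map on \<open>S\<close> embed into its kernel by a translation.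
\<close>
lemma card_le_image_times_kernel:
  fixes \<phi> :: "'a::ab_group_add \<Rightarrow> 'b::ab_group_add"
  assumes "finite S" and diff: "\<And>x y. x \<in> S \<Longrightarrow> y \<in> S \<Longrightarrow> x - y \<in> S"
    and hom: "\<And>x y. \<phi> (x - y) = \<phi> x - \<phi> y"
  shows "card S \<le> card (\<phi> ` S) * card {x \<in> S. \<phi> x = 0}"
proof -
  have fibre: "card {x \<in> S. \<phi> x = b} \<le> card {x \<in> S. \<phi> x = 0}" if b: "b \<in> \<phi> ` S" for b
  proof -
    obtain x0 where x0: "x0 \<in> S" "\<phi> x0 = b" using b by blast
    show ?thesis
      by (rule card_inj_on_le[of "\<lambda>x. x - x0"])
        (use x0 diff hom \<open>finite S\<close> in \<open>auto simp: inj_on_def\<close>)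
  qed
  have "card S = (\<Sum>b\<in>\<phi> ` S. card {x \<in> S. \<phi> x = b})"
    using \<open>finite S\<close> sum.image_gen[of S "\<lambda>_. 1::nat" \<phi>] by simp
  also have "\<dots> \<le> (\<Sum>b\<in>\<phi> ` S. card {x \<in> S. \<phi> x = 0})"
    by (intro sum_mono fibre)
  finally show ?thesis by simp
qed

text \<open>
  Since \<open>s\<close> is coprime to \<open>n\<close>, the map \<open>x \<mapsto> x ^ (q ^ s)\<close> generates the Galois group of the field over
  its subfield of order \<open>q\<close>. Its powers \<open>fr i\<close> behave like those of the Frobenius map, and arguing
  with them treats all admissible \<open>s\<close> at once.
\<close>
locale field_generator =
  fixes q n s :: nat and ty :: "'a::{field,finite} itself"
  assumes primepow_q: "primepow q" and n_pos: "n > 0"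
    and card_UNIV: "CARD('a) = q ^ n"
    and coprime_s: "coprime s n"
begin

lemma q_gt_1: "q > 1"
  using primepow_q primepow_gt_Suc_0 by auto

definition fr :: "nat \<Rightarrow> 'a \<Rightarrow> 'a" where
  "fr i x = x ^ (q ^ (s * i))"

definition fixed :: "'a set" where
  "fixed = {x. x ^ q = x}"

lemma q_power_char: "\<exists>k. q = CHAR('a) ^ k"
proof -
  obtain p k where pk: "prime p" "k > 0" "q = p ^ k"
    using primepow_q by (auto simp: primepow_def)
  have "CHAR('a) > 0"
    by (rule finite_imp_CHAR_pos) simp
  then have pr: "prime CHAR('a)"
    by (rule prime_CHAR_semidom)
  have "(\<Sum>x::'a\<in>UNIV. x + 1) = (\<Sum>x\<in>UNIV. x)"
    by (rule sum.reindex_bij_witness[of _ "\<lambda>y. y - 1" "\<lambda>y. y + 1"]) auto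
  then have "of_nat CARD('a) = (0::'a)"
    by (simp add: sum.distrib)
  then have "CHAR('a) dvd q ^ n"
    by (simp add: of_nat_eq_0_iff_char_dvd card_UNIV del: of_nat_power)
  then have "CHAR('a) dvd p"
    using pr pk by (metis prime_dvd_power_nat)
  then have "CHAR('a) = p"
    using pr pk by (simp add: primes_dvd_imp_eq)
  then show ?thesis using pk by auto
qed

lemma prime_CHAR: "prime CHAR('a)"
  by (rule prime_CHAR_semidom, rule finite_imp_CHAR_pos) simp

lemma q_pow_add: "(x + y :: 'a) ^ (q ^ m) = x ^ (q ^ m) + y ^ (q ^ m)"
proof -
  obtain k where "q = CHAR('a) ^ k" using q_power_char by blast
  then have "q ^ m = CHAR('a) ^ (k * m)" by (simp add: power_mult)
  then show ?thesis using freshmans_dream'[OF prime_CHAR] by blast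
qed

lemma q_pow_neg: "(- x :: 'a) ^ (q ^ m) = - (x ^ (q ^ m))"
  using q_pow_add[of x "-x" m] q_gt_1
  by (simp add: power_0_left add_eq_0_iff)

lemma q_pow_mod: "(x::'a) ^ (q ^ (i + n * j)) = x ^ (q ^ i)"
proof (induction j)
  case (Suc j)
  have "x ^ (q ^ (i + n * Suc j)) = (x ^ (q ^ (i + n * j))) ^ (q ^ n)"
    by (simp add: power_add power_mult [symmetric] ac_simps)
  also have "\<dots> = x ^ (q ^ (i + n * j))"
    using finite_field_power_card[of "x ^ (q ^ (i + n * j))"] by (simp add: card_UNIV)
  finally show ?case using Suc by simp
qed simp

lemma fr_add [simp]: "fr i (x + y) = fr i x + fr i y"
  by (simp add: fr_def q_pow_add)

lemma fr_minus [simp]: "fr i (- x) = - fr i x"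
  by (simp add: fr_def q_pow_neg)

lemma fr_diff [simp]: "fr i (x - y) = fr i x - fr i y"
  using fr_add[of i x "-y"] by simp

lemma fr_mult [simp]: "fr i (x * y) = fr i x * fr i y"
  by (simp add: fr_def power_mult_distrib)

lemma fr_power [simp]: "fr i (x ^ k) = fr i x ^ k"
  by (simp add: fr_def mult.commute flip: power_mult)

lemma fr_divide [simp]: "fr i (x / y) = fr i x / fr i y"
  by (simp add: fr_def power_divide)

lemma fr_0 [simp]: "fr i 0 = 0" and fr_1 [simp]: "fr i 1 = 1"
  using q_gt_1 by (simp_all add: fr_def)

lemma fr_eq_0_iff [simp]: "fr i x = 0 \<longleftrightarrow> x = 0"
  using q_gt_1 by (auto simp: fr_def)

lemma fr_sum [simp]: "fr i (sum f A) = (\<Sum>x\<in>A. fr i (f x))"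
  by (induction A rule: infinite_finite_induct) auto

lemma fr_zero_index [simp]: "fr 0 x = x"
  by (simp add: fr_def)

lemma fr_fr [simp]: "fr i (fr j x) = fr (i + j) x"
  by (simp add: fr_def add_mult_distrib2 power_add ac_simps flip: power_mult)

lemma fr_add_n: "fr (i + n) x = fr i x"
  using q_pow_mod[of x "s * i" s] by (simp add: fr_def add_mult_distrib2 mult.commute)

lemma fr_sub_n: "i \<ge> n \<Longrightarrow> fr i x = fr (i - n) x"
  using fr_add_n[of "i - n" x] by simp

lemma fr_mod_n: "fr i x = fr (i mod n) x"
proof (induction i rule: less_induct)
  case (less i)
  show ?case
  proof (cases "i < n")
    case False
    then show ?thesis
      using fr_sub_n[of i x] less[of "i - n"] n_pos by (simp add: le_mod_geq)
  qed simp
qed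

lemma inj_fr: "inj (fr i)"
proof (rule injI)
  fix x y assume "fr i x = fr i y"
  then have "fr i (x - y) = 0" by simp
  then show "x = y" by (simp del: fr_diff)
qed

text \<open>
  Inverting \<open>s\<close> modulo \<open>n\<close> makes \<open>x \<mapsto> x ^ q\<close> a power of the generator.
\<close>
lemma fixed_iff: "x \<in> fixed \<longleftrightarrow> fr 1 x = x"
proof
  assume x: "x \<in> fixed"
  have "x ^ (q ^ k) = x" for k
    by (induction k) (use x in \<open>auto simp: fixed_def power_mult\<close>)
  then show "fr 1 x = x" by (simp add: fr_def)
next
  assume x: "fr 1 x = x"
  have k: "fr k x = x" for k
  proof (induction k)
    case (Suc k)
    then show ?case using x fr_fr[of 1 k x] by simp
  qed simp
  obtain u where u: "[s * u = 1] (mod n)"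
    using cong_solve_coprime_nat[OF coprime_s] by auto
  have red: "x ^ (q ^ k) = x ^ (q ^ (k mod n))" for k
    using q_pow_mod[of x "k mod n" "k div n"] by simp
  have "x ^ (q ^ 1) = x ^ (q ^ (s * u))"
    using red[of 1] red[of "s * u"] u by (simp add: cong_def)
  also have "\<dots> = x" using k[of u] by (simp add: fr_def)
  finally show "x \<in> fixed" by (simp add: fixed_def)
qed

lemma fr_fixed: "c \<in> fixed \<Longrightarrow> fr i c = c"
proof (induction i)
  case (Suc i)
  then show ?case using fr_fr[of 1 i c] fixed_iff by simp
qed simp

lemma fixed_closed:
  "0 \<in> fixed" "1 \<in> fixed" "a \<in> fixed \<Longrightarrow> b \<in> fixed \<Longrightarrow> a + b \<in> fixed"
  "a \<in> fixed \<Longrightarrow> b \<in> fixed \<Longrightarrow> a * b \<in> fixed" "a \<in> fixed \<Longrightarrow> - a \<in> fixed"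
  "a \<in> fixed \<Longrightarrow> b \<in> fixed \<Longrightarrow> a - b \<in> fixed"
  "a \<in> fixed \<Longrightarrow> b \<in> fixed \<Longrightarrow> a / b \<in> fixed"
  by (auto simp: fixed_iff)

text \<open>
  The lower bound holds because \<open>X ^ (q ^ n) - X\<close> splits into linear factors: it is the product of
  \<open>X ^ q - X\<close> with a polynomial \<open>p\<close> of degree \<open>q ^ n - q\<close>, which leaves at least \<open>q\<close> roots for the
  first factor.
\<close>
lemma card_fixed: "card fixed = q"
proof (rule antisym)
  define p :: "'a poly" where "p = Polynomial.monom 1 q - Polynomial.monom 1 1"
  have cp: "coeff p q = 1" using q_gt_1 by (simp add: p_def)
  then have p0: "p \<noteq> 0" by auto
  have "degree p \<le> q" using q_gt_1
    by (auto simp: p_def intro!: degree_diff_le order.trans[OF degree_monom_le])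
  moreover have "fixed = {x. poly p x = 0}"
    by (auto simp: p_def poly_monom fixed_def)
  ultimately show "card fixed \<le> q"
    using card_poly_roots_bound[OF p0] by simp
next
  define N where "N = (\<Sum>i<n. q ^ i)"
  have N: "q ^ n - 1 = (q - 1) * N"
  proof -
    have "int (q ^ n - 1) = int ((q - 1) * N)"
      using power_diff_1_eq[of "int q" n] q_gt_1 by (simp add: N_def of_nat_diff)
    then show ?thesis by (simp only: of_nat_eq_iff)
  qed
  have N0: "N > 0" using N q_gt_1 n_pos
    by (metis Suc_lessI diff_is_0_eq' less_numeral_extra(3) mult_0_right not_gr_zero one_less_power zero_less_diff)
  define p :: "'a poly" where "p = (\<Sum>i<N. Polynomial.monom 1 ((q - 1) * i))"
  have "coeff p 0 = (\<Sum>i<N. if i = 0 then 1 else 0)"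
    using q_gt_1 by (auto simp: p_def coeff_sum intro!: sum.cong)
  also have "\<dots> = 1" using N0 by (simp add: sum.delta)
  finally have p0: "p \<noteq> 0" by auto
  have deg: "degree p \<le> (q - 1) * (N - 1)"
    unfolding p_def
    by (intro degree_sum_le) (auto intro!: order.trans[OF degree_monom_le] mult_left_mono)
  have "UNIV \<subseteq> fixed \<union> {x. poly p x = 0}"
  proof
    fix x :: 'a
    show "x \<in> fixed \<union> {x. poly p x = 0}"
    proof (cases "x = 0")
      case True then show ?thesis using fixed_closed by simp
    next
      case False
      have "x ^ (q ^ n) = x" using finite_field_power_card[of x] card_UNIV by simp
      then have "x ^ (q ^ n - 1) = 1"
        using False q_gt_1 by (simp add: power_diff)
      then have "(x ^ (q - 1)) ^ N - 1 = 0" unfolding N power_mult by simp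
      moreover have "poly p x = (\<Sum>i<N. (x ^ (q - 1)) ^ i)"
        by (simp add: p_def poly_sum poly_monom power_mult)
      ultimately have "(x ^ (q - 1) - 1) * poly p x = 0"
        by (simp add: power_diff_1_eq)
      then have "x ^ (q - 1) = 1 \<or> poly p x = 0" by auto
      then show ?thesis using q_gt_1 power_minus_mult[of q x] by (auto simp: fixed_def)
    qed
  qed
  then have "q ^ n \<le> card fixed + card {x. poly p x = 0}"
    using card_mono[of "fixed \<union> {x. poly p x = 0}" UNIV] card_Un_le[of fixed "{x. poly p x = 0}"]
    by (simp add: card_UNIV)
  also have "\<dots> \<le> card fixed + (q - 1) * (N - 1)"
    using card_poly_roots_bound[OF p0] deg by simp
  finally have "q ^ n \<le> card fixed + (q - 1) * (N - 1)" .
  moreover obtain m where m: "N = Suc m" using N0 by (cases N) auto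
  have "q ^ n \<ge> 1" using q_gt_1 by simp
  then have "q ^ n = (q - 1) * m + q"
    using N q_gt_1 unfolding m by simp
  ultimately show "q \<le> card fixed"
    using m by simp
qed


section \<open>Subspaces over the fixed field\<close>

definition subspace_fixed :: "'a set \<Rightarrow> bool" where
  "subspace_fixed S \<longleftrightarrow> 0 \<in> S \<and> (\<forall>x\<in>S. \<forall>y\<in>S. x + y \<in> S) \<and> (\<forall>c\<in>fixed. \<forall>x\<in>S. c * x \<in> S)"

lemma subspace_fixedD:
  assumes "subspace_fixed S"
  shows "0 \<in> S" "x \<in> S \<Longrightarrow> y \<in> S \<Longrightarrow> x + y \<in> S" "c \<in> fixed \<Longrightarrow> x \<in> S \<Longrightarrow> c * x \<in> S"
    "x \<in> S \<Longrightarrow> y \<in> S \<Longrightarrow> x - y \<in> S"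
proof -
  show "0 \<in> S" "x \<in> S \<Longrightarrow> y \<in> S \<Longrightarrow> x + y \<in> S" "c \<in> fixed \<Longrightarrow> x \<in> S \<Longrightarrow> c * x \<in> S" for x y c
    using assms by (auto simp: subspace_fixed_def)
  from this(2)[of x "-1 * y"] this(3)[of "-1" y] fixed_closed
  show "x \<in> S \<Longrightarrow> y \<in> S \<Longrightarrow> x - y \<in> S" by simp
qed

text \<open>
  Spans of lists with one explicit coefficient per entry: for an independent list the
  representation is unique, so the span of \<open>d\<close> entries has \<open>q ^ d\<close> elements. This makes cardinality a
  substitute for dimension throughout.
\<close>
fun lspan :: "'a list \<Rightarrow> 'a set" where
  "lspan [] = {0}"
| "lspan (x # xs) = {c * x + y |c y. c \<in> fixed \<and> y \<in> lspan xs}"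

fun indep :: "'a list \<Rightarrow> bool" where
  "indep [] = True"
| "indep (x # xs) = (x \<notin> lspan xs \<and> indep xs)"

lemma lspanI: "c \<in> fixed \<Longrightarrow> y \<in> lspan xs \<Longrightarrow> c * x + y \<in> lspan (x # xs)"
  by auto

lemma subspace_lspan: "subspace_fixed (lspan xs)"
proof (induction xs)
  case Nil
  then show ?case by (simp add: subspace_fixed_def)
next
  case (Cons x xs)
  note sub = subspace_fixedD[OF Cons]
  show ?case
    unfolding subspace_fixed_def
  proof (intro conjI ballI)
    show "0 \<in> lspan (x # xs)"
      using lspanI[OF fixed_closed(1) sub(1), of x] by simp
  next
    fix u v assume "u \<in> lspan (x # xs)" "v \<in> lspan (x # xs)"
    then obtain c d y z where "u = c * x + y" "v = d * x + z"
      and cd: "c \<in> fixed" "d \<in> fixed" "y \<in> lspan xs" "z \<in> lspan xs"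
      by auto
    then have "u + v = (c + d) * x + (y + z)" by (simp add: algebra_simps)
    then show "u + v \<in> lspan (x # xs)"
      using lspanI cd sub(2) fixed_closed(3) by metis
  next
    fix e u assume e: "e \<in> fixed" "u \<in> lspan (x # xs)"
    then obtain c y where "u = c * x + y" and cd: "c \<in> fixed" "y \<in> lspan xs"
      by auto
    then have "e * u = (e * c) * x + e * y" by (simp add: algebra_simps)
    then show "e * u \<in> lspan (x # xs)"
      using lspanI cd e sub(3) fixed_closed(4) by metis
  qed
qed

lemma lspan_tail: "lspan xs \<subseteq> lspan (x # xs)"
  using lspanI[OF fixed_closed(1), of _ xs x] by auto

lemma set_subset_lspan: "set xs \<subseteq> lspan xs"
proof (induction xs)
  case (Cons x xs)
  have "x \<in> lspan (x # xs)"
    using lspanI[OF fixed_closed(2) subspace_fixedD(1)[OF subspace_lspan], of x xs] by simp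
  then show ?case using Cons lspan_tail by (metis insert_subset list.simps(15) subset_trans)
qed simp

lemma lspan_subset: "subspace_fixed S \<Longrightarrow> set xs \<subseteq> S \<Longrightarrow> lspan xs \<subseteq> S"
  by (induction xs) (auto simp: subspace_fixed_def)

lemma card_lspan: "indep xs \<Longrightarrow> card (lspan xs) = q ^ length xs"
proof (induction xs)
  case (Cons x xs)
  note sub = subspace_fixedD[OF subspace_lspan[of xs]]
  have "inj_on (\<lambda>(c, y). c * x + y) (fixed \<times> lspan xs)"
  proof (rule inj_onI, clarify)
    fix c y d z assume A: "c \<in> fixed" "y \<in> lspan xs" "d \<in> fixed" "z \<in> lspan xs"
      and eq: "c * x + y = d * x + z"
    have "c = d"
    proof (rule ccontr)
      assume "c \<noteq> d"
      then have "x = (1 / (c - d)) * (z - y)" using eq by (simp add: field_simps)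
      then have "x \<in> lspan xs"
        using A sub fixed_closed by metis
      then show False using Cons.prems by simp
    qed
    then show "c = d \<and> y = z" using eq by simp
  qed
  moreover have "lspan (x # xs) = (\<lambda>(c, y). c * x + y) ` (fixed \<times> lspan xs)"
    by (auto simp: image_iff)
  ultimately have "card (lspan (x # xs)) = card (fixed \<times> lspan xs)"
    by (metis card_image)
  then show ?case using Cons by (simp add: card_cartesian_product card_fixed)
qed simp

lemma indep_extend:
  assumes "subspace_fixed S" "indep xs" "set xs \<subseteq> S"
  obtains ys where "indep (ys @ xs)" "lspan (ys @ xs) = S"
  using assms(2,3)
proof (induction "card (S - lspan xs)" arbitrary: xs thesis rule: less_induct)
  case less
  have sub: "lspan xs \<subseteq> S" using lspan_subset[OF assms(1) less.prems(3)] .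
  show ?case
  proof (cases "lspan xs = S")
    case True
    then show ?thesis using less.prems(1)[of "[]"] less.prems by simp
  next
    case False
    then obtain x where x: "x \<in> S" "x \<notin> lspan xs" using sub by auto
    have "x \<in> lspan (x # xs)" using set_subset_lspan[of "x # xs"] by simp
    then have "card (S - lspan (x # xs)) < card (S - lspan xs)"
      using x lspan_tail[of xs x] by (intro psubset_card_mono) auto
    moreover have "indep (x # xs)" "set (x # xs) \<subseteq> S" using x less.prems by auto
    ultimately obtain ys where "indep (ys @ x # xs)" "lspan (ys @ x # xs) = S"
      using less.hyps[of "x # xs"] by blast
    then show ?thesis using less.prems(1)[of "ys @ [x]"] by simp
  qed
qed

lemma subspace_basis:
  assumes "subspace_fixed S"
  obtains xs where "indep xs" "lspan xs = S"
  using indep_extend[OF assms, of "[]"] by auto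

lemma card_subspace:
  assumes "subspace_fixed S"
  obtains d where "card S = q ^ d"
  using subspace_basis[OF assms] card_lspan by metis

lemma indep_suffix: "indep (ys @ xs) \<Longrightarrow> indep xs"
  by (induction ys) auto

lemma large_subspace_indep:
  assumes "subspace_fixed S" "card S \<ge> q ^ r"
  obtains xs where "indep xs" "set xs \<subseteq> S" "length xs = r"
proof -
  obtain ys where ys: "indep ys" "lspan ys = S" using subspace_basis[OF assms(1)] .
  have "r \<le> length ys"
    using assms(2) card_lspan[OF ys(1)] ys(2) q_gt_1 by (simp add: power_increasing_iff)
  then show thesis
    using that[of "drop (length ys - r) ys"] ys set_subset_lspan[of ys]
      indep_suffix[of "take (length ys - r) ys" "drop (length ys - r) ys"]
      set_drop_subset[of "length ys - r" ys] by auto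
qed

section \<open>Zeros of skew polynomials\<close>

definition fixed_linear :: "('a \<Rightarrow> 'a) \<Rightarrow> bool" where
  "fixed_linear f \<longleftrightarrow> (\<forall>x y. f (x + y) = f x + f y) \<and> (\<forall>c\<in>fixed. \<forall>x. f (c * x) = c * f x)"

lemma fixed_linear_zero: "fixed_linear f \<Longrightarrow> f 0 = 0"
  using fixed_closed(1) by (metis mult_zero_left fixed_linear_def)

lemma subspace_zeros: "fixed_linear f \<Longrightarrow> subspace_fixed {x. f x = 0}"
  by (auto simp: subspace_fixed_def fixed_linear_zero) (auto simp: fixed_linear_def)

lemma fixed_linear_fr: "fixed_linear (fr i)"
  by (simp add: fixed_linear_def fr_fixed)

lemma fixed_linear_scale: "fixed_linear f \<Longrightarrow> fixed_linear (\<lambda>x. a * f x)"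
  by (simp add: fixed_linear_def algebra_simps)

lemma fixed_linear_add: "fixed_linear f \<Longrightarrow> fixed_linear g \<Longrightarrow> fixed_linear (\<lambda>x. f x + g x)"
  by (simp add: fixed_linear_def algebra_simps)

lemma fixed_linear_sum: "(\<And>i. i \<in> A \<Longrightarrow> fixed_linear (f i)) \<Longrightarrow> fixed_linear (\<lambda>x. \<Sum>i\<in>A. f i x)"
  by (simp add: fixed_linear_def sum.distrib sum_distrib_left)

abbreviation Nm :: "'a \<Rightarrow> 'a" where "Nm \<equiv> field_norm q n"

lemma Nm_mult: "Nm (x * y) = Nm x * Nm y"
  by (simp add: field_norm_def power_mult_distrib prod.distrib)

lemma Nm_minus: "Nm (- x) = (- 1) ^ n * Nm x"
proof -
  have "(- x) ^ (q ^ i) = - 1 * x ^ (q ^ i)" for i by (simp add: q_pow_neg)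
  then have "Nm (- x) = (\<Prod>i<n. - 1 * x ^ (q ^ i))" unfolding field_norm_def by presburger
  then show ?thesis unfolding field_norm_def by (simp only: prod.distrib prod_constant card_lessThan)
qed

lemma Nm_q: "Nm (x ^ q) = Nm x"
proof -
  have "Nm (x ^ q) * x = (\<Prod>i<n. x ^ (q ^ Suc i)) * x"
    by (simp add: field_norm_def power_mult [symmetric])
  also have "\<dots> = (\<Prod>i<Suc n. x ^ (q ^ i))"
    by (simp only: prod.lessThan_Suc_shift) (simp add: mult.commute)
  also have "\<dots> = Nm x * x"
    using finite_field_power_card[of x] by (simp add: field_norm_def card_UNIV)
  finally show ?thesis
    by (cases "x = 0") (use q_gt_1 in \<open>auto simp: power_0_left\<close>)
qed

lemma Nm_fr: "Nm (fr i x) = Nm x"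
proof -
  have "Nm (x ^ (q ^ k)) = Nm x" for k
    by (induction k arbitrary: x) (simp_all add: power_mult Nm_q)
  then show ?thesis by (simp add: fr_def)
qed

lemma Nm_eq_0_iff: "Nm x = 0 \<longleftrightarrow> x = 0"
  using n_pos q_gt_1 by (auto simp: field_norm_def)

text \<open>
  The bound on the zeros of a polynomial of degree \<open>k\<close> in the generator \<open>\<sigma> = fr 1\<close>, and the condition
  on its extreme coefficients if the bound is attained. A nonzero zero \<open>x0\<close> is moved to 1 by
  substituting \<open>x0 * x\<close>; then the coefficients sum to zero, so the polynomial factors through
  \<open>\<sigma> - 1\<close>, whose kernel has \<open>q\<close> elements, with a cofactor of degree \<open>k - 1\<close>. The norm of the
  quotient of the extreme coefficients changes by \<open>(-1) ^ n\<close> in each of these steps.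
\<close>
lemma skew_poly_zeros:
  assumes "\<exists>i\<le>k. a i \<noteq> 0"
  shows "card {x. (\<Sum>i\<le>k. a i * fr i x) = 0} \<le> q ^ k"
    and "card {x. (\<Sum>i\<le>k. a i * fr i x) = 0} = q ^ k \<Longrightarrow> Nm (a 0) = (- 1) ^ (n * k) * Nm (a k)"
proof -
  have "card {x. (\<Sum>i\<le>k. a i * fr i x) = 0} \<le> q ^ k \<and>
    (card {x. (\<Sum>i\<le>k. a i * fr i x) = 0} = q ^ k \<longrightarrow> Nm (a 0) = (- 1) ^ (n * k) * Nm (a k))"
    using assms
  proof (induction k arbitrary: a)
    case 0
    then have "{x. (\<Sum>i\<le>0. a i * fr i x) = 0} = {0}" by auto
    then show ?case by simp
  next
    case (Suc k)
    define Z where "Z = {x. (\<Sum>i\<le>Suc k. a i * fr i x) = 0}"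
    have "0 \<in> Z" by (simp add: Z_def)
    show ?case
    proof (cases "Z = {0}")
      case True
      have "1 < q ^ Suc k" using q_gt_1 by (metis one_less_power zero_less_Suc)
      then have "card Z < q ^ Suc k" using True by simp
      then show ?thesis unfolding Z_def [symmetric]
        by (intro conjI impI) (simp_all del: power_Suc)
    next
      case False
      then obtain x0 where x0: "x0 \<in> Z" "x0 \<noteq> 0" using \<open>0 \<in> Z\<close> by auto
      define b where "b i = a i * fr i x0" for i
      \<comment> \<open>coefficients of the cofactor of \<open>\<sigma> - 1\<close>, by summation by parts\<close>
      define c where "c i = - (\<Sum>j\<le>i. b j)" for i
      have cb: "c (Suc k) = 0" using x0(1) by (simp add: c_def b_def Z_def)
      have fact: "(\<Sum>i\<le>m. b i * fr i y) = (\<Sum>i<m. c i * fr i (fr 1 y - y)) - c m * fr m y" for m y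
      proof (induction m)
        case (Suc m)
        have "b (Suc m) = c m - c (Suc m)" by (simp add: c_def)
        then have "(\<Sum>i\<le>Suc m. b i * fr i y) = (\<Sum>i\<le>m. b i * fr i y) + (c m - c (Suc m)) * fr (Suc m) y"
          by simp
        then show ?case unfolding Suc by (simp add: algebra_simps)
      qed (simp add: c_def)
      define Y where "Y = {y. (\<Sum>i\<le>Suc k. b i * fr i y) = 0}"
      define W where "W = {y. (\<Sum>i\<le>k. c i * fr i y) = 0}"
      have Yc: "Y = {y. fr 1 y - y \<in> W}"
        using cb unfolding Y_def W_def fact by (simp add: lessThan_Suc_atMost del: fr_diff)
      have "card Z = card Y"
        by (rule bij_betw_same_card[of "\<lambda>x. x / x0"], rule bij_betw_byWitness[where f' = "\<lambda>y. x0 * y"])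
          (use x0 in \<open>auto simp: Z_def Y_def b_def mult.assoc\<close>)
      moreover have "card Y \<le> card W * q"
      proof -
        have "subspace_fixed Y"
          unfolding Y_def by (intro subspace_zeros fixed_linear_sum fixed_linear_scale fixed_linear_fr)
        note diff = subspace_fixedD(4)[OF this]
        have "card Y \<le> card ((\<lambda>y. fr 1 y - y) ` Y) * card {y \<in> Y. fr 1 y - y = 0}"
          by (rule card_le_image_times_kernel)
            (use diff in auto)
        also have "\<dots> \<le> card W * q"
        proof (rule mult_mono)
          show "card ((\<lambda>y. fr 1 y - y) ` Y) \<le> card W"
            by (rule card_mono) (auto simp: Yc)
          have "{y \<in> Y. fr 1 y - y = 0} \<subseteq> fixed" by (auto simp: fixed_iff)
          then show "card {y \<in> Y. fr 1 y - y = 0} \<le> q"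
            using card_mono[of fixed] card_fixed by simp
        qed auto
        finally show ?thesis .
      qed
      ultimately have ZW: "card Z \<le> card W * q" by simp
      have b0: "b 0 = - c 0" by (simp add: c_def)
      have bS: "b (Suc i) = c i - c (Suc i)" for i by (simp add: c_def)
      have bk: "b (Suc k) = c k" using bS[of k] cb by simp
      have "\<exists>i\<le>k. c i \<noteq> 0"
      proof (rule ccontr)
        assume "\<not> ?thesis"
        then have c0: "c i = 0" if "i \<le> Suc k" for i using that cb by (cases "i = Suc k") auto
        have "b i = 0" if "i \<le> Suc k" for i
          using that c0 b0 bS by (cases i) auto
        then show False using Suc.prems x0(2) by (auto simp: b_def)
      qed
      from Suc.IH[OF this] have IH: "card W \<le> q ^ k"
        "card W = q ^ k \<Longrightarrow> Nm (c 0) = (- 1) ^ (n * k) * Nm (c k)"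
        by (auto simp: W_def)
      have "Nm (a 0) = (- 1) ^ (n * Suc k) * Nm (a (Suc k))" if eq: "card Z = q ^ Suc k"
      proof -
        have "q ^ k \<le> card W" using ZW eq q_gt_1 by simp
        then have "Nm (c 0) = (- 1) ^ (n * k) * Nm (c k)" using IH by simp
        then have "Nm (b 0) = (- 1) ^ (n * Suc k) * Nm (b (Suc k))"
          by (simp add: b0 bk Nm_minus power_add)
        moreover have "Nm x0 \<noteq> 0" using x0 Nm_eq_0_iff by simp
        ultimately show ?thesis by (simp add: b_def Nm_mult Nm_fr)
      qed
      moreover have "card Z \<le> q ^ Suc k" using ZW IH(1)
        by (metis mult.commute mult_le_mono1 order_trans power_Suc)
      ultimately show ?thesis unfolding Z_def by blast
    qed
  qed
  then show "card {x. (\<Sum>i\<le>k. a i * fr i x) = 0} \<le> q ^ k"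
    and "card {x. (\<Sum>i\<le>k. a i * fr i x) = 0} = q ^ k \<Longrightarrow> Nm (a 0) = (- 1) ^ (n * k) * Nm (a k)"
    by auto
qed

end

section \<open>Tuples whose combinations have few zeros\<close>

text \<open>
  If the maps are linear over the subfield of order \<open>q\<close>, the zeros form a subspace, so this bounds
  its dimension by \<open>r - 1\<close>, where \<open>r\<close> is the length of the tuple.
\<close>
definition few_zeros :: "nat \<Rightarrow> ('a::{field,finite} \<Rightarrow> 'a) list \<Rightarrow> bool" where
  "few_zeros q fs \<longleftrightarrow>
     (\<forall>a. (\<exists>i<length fs. a i \<noteq> 0) \<longrightarrow>
        card {x. (\<Sum>i<length fs. a i * (fs ! i) x) = 0} < q ^ length fs)"

(* Keeps fr 1 from being rewritten to fr (Suc 0), so that the powers of the generator have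
   numerals as normal forms. *)
declare One_nat_def [simp del] One_nat_def [symmetric, simp]

lemma transposed_system_solvable:
  fixes f :: "nat \<Rightarrow> nat \<Rightarrow> 'a::field"
  assumes "\<exists>i<r. a i \<noteq> 0" and a: "\<And>j. j < r \<Longrightarrow> (\<Sum>i<r. a i * f i j) = 0"
  obtains c where "\<exists>j<r. c j \<noteq> 0" "\<And>i. i < r \<Longrightarrow> (\<Sum>j<r. f i j * c j) = 0"
proof -
  define A where "A = mat r r (\<lambda>(i, j). f i j)"
  have A: "A \<in> carrier_mat r r" "transpose_mat A \<in> carrier_mat r r" by (auto simp: A_def)
  have "transpose_mat A *\<^sub>v vec r a = 0\<^sub>v r"
    using a by (auto simp: A_def scalar_prod_def mult.commute atLeast0LessThan)
  moreover have "vec r a \<noteq> 0\<^sub>v r" using assms(1) by (metis index_vec index_zero_vec(1))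
  ultimately have "det (transpose_mat A) = 0"
    using det_0_iff_vec_prod_zero_field[OF A(2)] vec_carrier by blast
  then have "det A = 0" using det_transpose[OF A(1)] by simp
  then obtain v where v: "v \<in> carrier_vec r" "v \<noteq> 0\<^sub>v r" "A *\<^sub>v v = 0\<^sub>v r"
    using det_0_iff_vec_prod_zero_field[OF A(1)] by auto
  have "(\<Sum>j<r. f i j * v $ j) = 0" if "i < r" for i
    using arg_cong[OF v(3), of "\<lambda>w. w $ i"] that v(1)
    by (simp add: A_def scalar_prod_def atLeast0LessThan)
  moreover have "\<exists>j<r. v $ j \<noteq> 0" using v(1,2) by (metis carrier_vecD eq_vecI index_zero_vec)
  ultimately show thesis using that[of "\<lambda>j. v $ j"] by blast
qed

context field_generator
begin

text \<open>
  A relation between the columns of the Moore matrix gives one between its rows, that is, a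
  polynomial of degree below \<open>r\<close> in the generator which vanishes on a space of dimension \<open>r\<close>.
\<close>
lemma Moore_columns_independent:
  assumes "indep xs" "length xs = r" "\<exists>j<r. c j \<noteq> 0"
  shows "\<exists>k<r. (\<Sum>j<r. c j * fr k (xs ! j)) \<noteq> 0"
proof (rule ccontr)
  assume "\<not> ?thesis"
  then have "\<And>k. k < r \<Longrightarrow> (\<Sum>j<r. c j * fr k (xs ! j)) = 0" by auto
  then obtain d where d: "\<exists>k<r. d k \<noteq> 0" "\<And>j. j < r \<Longrightarrow> (\<Sum>k<r. fr k (xs ! j) * d k) = 0"
    by (rule transposed_system_solvable[of r c "\<lambda>j k. fr k (xs ! j)", OF assms(3)]) blast+
  then obtain m where m: "r = Suc m" by (cases r) auto
  let ?Z = "{x. (\<Sum>k\<le>m. d k * fr k x) = 0}"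
  have "subspace_fixed ?Z"
    by (intro subspace_zeros fixed_linear_sum fixed_linear_scale fixed_linear_fr)
  moreover have "set xs \<subseteq> ?Z"
    using d(2) assms(2) by (auto simp: in_set_conv_nth m lessThan_Suc_atMost mult.commute)
  ultimately have "card (lspan xs) \<le> card ?Z"
    by (intro card_mono lspan_subset) auto
  also have "\<dots> \<le> q ^ m"
    using d(1) by (intro skew_poly_zeros(1)) (auto simp: m less_Suc_eq_le)
  finally show False using card_lspan[OF assms(1)] assms(2) q_gt_1 by (simp add: m)
qed

lemma trace_in_fixed: "(\<Sum>k<n. fr k z) \<in> fixed"
proof -
  have "fr 1 (\<Sum>k<n. fr k z) + z = (\<Sum>k<n. fr (Suc k) z) + fr 0 z" by (simp add: plus_1_eq_Suc)
  also have "\<dots> = (\<Sum>k<Suc n. fr k z)"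
    by (simp only: sum.lessThan_Suc_shift add.commute)
  also have "\<dots> = (\<Sum>k<n. fr k z) + z" using fr_add_n[of 0 z] by simp
  finally show ?thesis by (simp add: fixed_iff)
qed

lemma trace_orthogonal_card:
  "q ^ n \<le> card {y. \<forall>x\<in>set xs. (\<Sum>k<n. fr k (x * y)) = 0} * q ^ length xs"
proof (induction xs)
  case Nil
  then show ?case by (simp add: card_UNIV)
next
  case (Cons x xs)
  let ?S = "{y. \<forall>x\<in>set xs. (\<Sum>k<n. fr k (x * y)) = 0}"
  let ?\<phi> = "\<lambda>y. \<Sum>k<n. fr k (x * y)"
  have "card ?S \<le> card (?\<phi> ` ?S) * card {y \<in> ?S. ?\<phi> y = 0}"
    by (rule card_le_image_times_kernel) (auto simp: sum_subtractf right_diff_distrib)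
  also have "card (?\<phi> ` ?S) \<le> q"
  proof -
    have "?\<phi> ` ?S \<subseteq> fixed" using trace_in_fixed by blast
    from card_mono[OF finite this] show ?thesis by (simp only: card_fixed)
  qed
  also have "{y \<in> ?S. ?\<phi> y = 0} = {y. \<forall>x\<in>set (x # xs). (\<Sum>k<n. fr k (x * y)) = 0}"
    by auto
  finally have "card ?S * q ^ length xs
      \<le> (q * card {y. \<forall>x\<in>set (x # xs). (\<Sum>k<n. fr k (x * y)) = 0}) * q ^ length xs"
    by (intro mult_le_mono1) simp
  from order.trans[OF Cons this] show ?case by (simp only: length_Cons power_Suc ac_simps)
qed

text \<open>
  The \<open>i\<close>-th map has coefficient vector \<open>M i\<close>. Suppose that some nonzero combination vanishes at \<open>r\<close>
  independent points \<open>x\<^sub>j\<close>. Then the square matrix of the values at these points is singular, so its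
  columns satisfy a relation with coefficients \<open>c\<^sub>j\<close>. The relation says that the sum \<open>v\<close> of the vectors
  \<open>c\<^sub>j (x\<^sub>j, \<sigma> x\<^sub>j, \<sigma>\<^sup>2 x\<^sub>j, ...)\<close> is orthogonal to all \<open>M i\<close>. The map with coefficient vector \<open>v\<close>
  sends \<open>y\<close> to the sum of \<open>c\<^sub>j Tr (x\<^sub>j y)\<close>, so it vanishes on the space of codimension at most \<open>r\<close>
  that is trace-orthogonal to the \<open>x\<^sub>j\<close>.
\<close>
lemma few_zeros_by_duality:
  assumes len: "length fs = r" and rn: "r \<le> n"
    and coeffs: "\<And>i x. i < r \<Longrightarrow> (fs ! i) x = (\<Sum>k<n. M i k * fr k x)"
    and dual: "\<And>v. \<exists>k<n. v k \<noteq> 0 \<Longrightarrow> (\<And>i. i < r \<Longrightarrow> (\<Sum>k<n. M i k * v k) = 0) \<Longrightarrow>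
       card {y. (\<Sum>k<n. v k * fr k y) = 0} < q ^ (n - r)"
  shows "few_zeros q fs"
  unfolding few_zeros_def len
proof (intro allI impI, rule ccontr)
  fix a :: "nat \<Rightarrow> 'a" assume a: "\<exists>i<r. a i \<noteq> 0"
  let ?Z = "{x. (\<Sum>i<r. a i * (fs ! i) x) = 0}"
  assume "\<not> card ?Z < q ^ r"
  moreover have "fixed_linear (fs ! i)" if "i < r" for i
  proof -
    have "fs ! i = (\<lambda>x. \<Sum>k<n. M i k * fr k x)" using coeffs that by blast
    then show ?thesis by (simp add: fixed_linear_sum fixed_linear_scale fixed_linear_fr)
  qed
  then have "subspace_fixed ?Z"
    by (intro subspace_zeros fixed_linear_sum fixed_linear_scale) auto
  ultimately obtain xs where xs: "indep xs" "set xs \<subseteq> ?Z" "length xs = r"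
    using large_subspace_indep[of ?Z r] by auto
  have "(\<Sum>i<r. a i * (fs ! i) (xs ! j)) = 0" if "j < r" for j
    using xs that nth_mem by blast
  then obtain c where c: "\<exists>j<r. c j \<noteq> 0" "\<And>i. i < r \<Longrightarrow> (\<Sum>j<r. (fs ! i) (xs ! j) * c j) = 0"
    by (rule transposed_system_solvable[of r a "\<lambda>i j. (fs ! i) (xs ! j)", OF a]) blast+
  define v where "v k = (\<Sum>j<r. c j * fr k (xs ! j))" for k
  obtain k where "k < r" "v k \<noteq> 0"
    using Moore_columns_independent[OF xs(1,3) c(1)] unfolding v_def by blast
  then have "\<exists>k<n. v k \<noteq> 0"
    using rn order_less_le_trans by blast
  moreover have "(\<Sum>k<n. M i k * v k) = 0" if i: "i < r" for i
  proof -
    have "(\<Sum>k<n. M i k * v k) = (\<Sum>k<n. \<Sum>j<r. M i k * fr k (xs ! j) * c j)"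
      by (simp add: v_def sum_distrib_left ac_simps)
    also have "\<dots> = (\<Sum>j<r. \<Sum>k<n. M i k * fr k (xs ! j) * c j)" by (rule sum.swap)
    also have "\<dots> = 0" using c(2)[OF i] i by (simp add: coeffs sum_distrib_right)
    finally show ?thesis .
  qed
  ultimately have small: "card {y. (\<Sum>k<n. v k * fr k y) = 0} < q ^ (n - r)" by (rule dual)
  have "(\<Sum>k<n. v k * fr k y) = (\<Sum>j<r. c j * (\<Sum>k<n. fr k (xs ! j * y)))" for y
  proof -
    have "(\<Sum>k<n. v k * fr k y) = (\<Sum>k<n. \<Sum>j<r. c j * fr k (xs ! j * y))"
      by (simp add: v_def sum_distrib_right sum_distrib_left ac_simps)
    also have "\<dots> = (\<Sum>j<r. \<Sum>k<n. c j * fr k (xs ! j * y))" by (rule sum.swap)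
    finally show ?thesis by (simp add: sum_distrib_left)
  qed
  then have "{y. \<forall>x\<in>set xs. (\<Sum>k<n. fr k (x * y)) = 0} \<subseteq> {y. (\<Sum>k<n. v k * fr k y) = 0}"
    using xs(3) by (auto intro!: sum.neutral)
  then have "card {y. \<forall>x\<in>set xs. (\<Sum>k<n. fr k (x * y)) = 0} < q ^ (n - r)"
    using small by (meson card_mono finite le_less_trans)
  then have "card {y. \<forall>x\<in>set xs. (\<Sum>k<n. fr k (x * y)) = 0} * q ^ r < q ^ (n - r) * q ^ r"
    using q_gt_1 by simp
  also have "\<dots> = q ^ n" using rn by (simp flip: power_add)
  finally show False using trace_orthogonal_card[of xs] xs(3) by simp
qed

lemma two_neq_0: "odd q \<Longrightarrow> (2::'a) \<noteq> 0" and three_neq_0: "\<not> 3 dvd q \<Longrightarrow> (3::'a) \<noteq> 0"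
proof -
  obtain k where k: "q = CHAR('a) ^ k" using q_power_char by blast
  have "k > 0" using k q_gt_1 by (cases k) auto
  then have dvd: "CHAR('a) dvd q" using k by simp
  have "p dvd q" if "prime p" "of_nat p = (0::'a)" for p
  proof -
    have "CHAR('a) = p"
      using that prime_CHAR of_nat_eq_0_iff_char_dvd[of p, where 'a='a] primes_dvd_imp_eq by blast
    then show ?thesis using dvd by simp
  qed
  from this[of 2] this[of 3]
  show "odd q \<Longrightarrow> (2::'a) \<noteq> 0" "\<not> 3 dvd q \<Longrightarrow> (3::'a) \<noteq> 0" by auto
qed

lemma skew_coeffs_zero:
  assumes "card S > q ^ 2" and "\<And>x. x \<in> S \<Longrightarrow> a * x + b * fr 1 x + c * fr 2 x = 0"
  shows "a = 0" "b = 0" "c = 0"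
proof -
  define d where "d i = (if i = 0 then a else if i = 1 then b else c)" for i :: nat
  have "{..2::nat} = {0, 1, 2}" by auto
  then have sum: "(\<Sum>i\<le>2. d i * fr i x) = a * x + b * fr 1 x + c * fr 2 x" for x
    by (simp add: d_def add.assoc)
  have "card S \<le> card {x. (\<Sum>i\<le>2. d i * fr i x) = 0}"
    by (rule card_mono) (use assms sum in auto)
  then have "\<not> (\<exists>i\<le>2. d i \<noteq> 0)"
    using skew_poly_zeros(1)[of 2 d] assms(1) by (meson leD le_trans)
  then have "d 0 = 0" "d 1 = 0" "d 2 = 0" by auto
  then show "a = 0" "b = 0" "c = 0" by (auto simp: d_def)
qed

lemma binomial_zeros:
  assumes "a \<noteq> 0 \<or> b \<noteq> 0"
  shows "card {x. a * x + b * fr 1 x = 0} \<le> q"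
proof -
  define d where "d i = (if i = 0 then a else b)" for i :: nat
  have "{..1::nat} = {0, 1}" by auto
  then have "(\<Sum>i\<le>1. d i * fr i x) = a * x + b * fr 1 x" for x
    by (simp add: d_def)
  moreover have "\<exists>i\<le>1. d i \<noteq> 0" using assms unfolding d_def by (metis le_numeral_extra(4) zero_le zero_neq_one)
  ultimately show ?thesis using skew_poly_zeros(1)[of 1 d] by simp
qed

text \<open>
  On the zeros of a monic trinomial without quadratic term, all higher powers of the generator
  reduce to the powers 0, 1 and 2.
\<close>
lemma trinomial_recurrence:
  assumes "fr 3 x = B * fr 1 x + A * x"
  shows "fr (3 + k) x = fr k B * fr (1 + k) x + fr k A * fr k x"
  using arg_cong[OF assms, of "fr k"] by (simp add: add.commute)

lemma trinomial_zeros_if_monic: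
  assumes nz: "a \<noteq> 0 \<or> b \<noteq> 0 \<or> c \<noteq> 0"
    and monic: "\<And>A B S. card S \<ge> q ^ 3 \<Longrightarrow> (\<And>x. x \<in> S \<Longrightarrow> fr 3 x = B * fr 1 x + A * x) \<Longrightarrow> False"
  shows "card {x. a * x + b * fr 1 x + c * fr 3 x = 0} < q ^ 3"
proof (cases "c = 0")
  case True
  have "q < q ^ 3" using q_gt_1 power_strict_increasing[of 1 3 q] by simp
  then show ?thesis using binomial_zeros[of a b] nz True by auto
next
  case False
  have "fr 3 x = (- b / c) * fr 1 x + (- a / c) * x" if "a * x + b * fr 1 x + c * fr 3 x = 0" for x
    using that False by (simp add: field_simps) (simp add: eq_neg_iff_add_eq_0 ac_simps)
  then show ?thesis
    using monic[of "{x. a * x + b * fr 1 x + c * fr 3 x = 0}" "- b / c" "- a / c"] by fastforce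
qed

text \<open>
  Expressing \<open>x = fr 7 x\<close> through \<open>x\<close>, \<open>fr 1 x\<close> and \<open>fr 2 x\<close> on a set with \<open>q ^ 3\<close> elements forces
  equality of coefficients. That of \<open>x\<close> gives \<open>fr 4 B * fr 2 B * A = 1\<close>, and two conjugates of
  this equation turn the coefficient of \<open>fr 2 x\<close>, which vanishes, into \<open>2 / fr 6 B\<close>.
\<close>
lemma trinomial_zeros_7:
  assumes n7: "n = 7" and "odd q" and nz: "a \<noteq> 0 \<or> b \<noteq> 0 \<or> c \<noteq> 0"
  shows "card {x. a * x + b * fr 1 x + c * fr 3 x = 0} < q ^ 3"
  using nz
proof (rule trinomial_zeros_if_monic)
  fix A B S assume S: "card S \<ge> q ^ 3" "\<And>x. x \<in> S \<Longrightarrow> fr 3 x = B * fr 1 x + A * x"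
  have red: "fr 7 x = x" "fr 8 x = fr 1 x" for x
    using fr_mod_n[of 7 x] fr_mod_n[of 8 x] n7 by simp_all
  have big: "card S > q ^ 2" using S(1) power_strict_increasing[OF _ q_gt_1, of 2 3] by linarith
  have "(fr 4 B * fr 2 B * A - 1) * x + (fr 4 A * fr 1 A + fr 4 B * fr 2 B * B) * fr 1 x
      + (fr 4 A * fr 1 B + fr 4 B * fr 2 A) * fr 2 x = 0" if "x \<in> S" for x
  proof -
    note it = trinomial_recurrence[OF S(2)[OF that]]
    have e: "fr 7 x = fr 4 B * fr 5 x + fr 4 A * fr 4 x" "fr 5 x = fr 2 B * fr 3 x + fr 2 A * fr 2 x"
      "fr 4 x = fr 1 B * fr 2 x + fr 1 A * fr 1 x"
      using it[of 4] it[of 2] it[of 1] by simp_all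
    have "fr 4 B * (fr 2 B * (B * fr 1 x + A * x) + fr 2 A * fr 2 x)
        + fr 4 A * (fr 1 B * fr 2 x + fr 1 A * fr 1 x) - x = 0"
      using e(1) unfolding e(2,3) S(2)[OF that] red by simp
    then show ?thesis by (simp only: algebra_simps mult_1_left add_0_left)
  qed
  note co = skew_coeffs_zero[OF big this]
  have "fr 4 B * fr 2 B * A = 1" using co(1) by simp
  from arg_cong[OF this, of "fr 2"] arg_cong[OF this, of "fr 4"]
  have "fr 6 B * fr 4 B * fr 2 A = 1" "fr 1 B * fr 6 B * fr 4 A = 1" by (simp_all add: red)
  then have "fr 6 B * (fr 4 A * fr 1 B + fr 4 B * fr 2 A) = 1 + 1" by (simp add: algebra_simps)
  then show False using co(3) two_neq_0[OF \<open>odd q\<close>] by simp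
qed

text \<open>
  As for \<open>n = 7\<close>, the coefficients in \<open>x = fr 8 x\<close> give three equations. They are best expressed by
  \<open>t = B * fr 3 A * fr 6 A\<close> and its conjugate \<open>u\<close>: one obtains \<open>t + u = 1\<close> and \<open>u\<^sup>2 = - t\<close>. So \<open>u\<close> is a
  root of \<open>X\<^sup>2 - X + 1\<close>, a sixth root of unity. If 3 divides \<open>q - 1\<close> it lies in the subfield of order
  \<open>q\<close>, whence \<open>t = u\<close>, which is only possible in characteristic 3.
\<close>
lemma trinomial_zeros_8:
  assumes n8: "n = 8" and q3: "[q = 1] (mod 3)" and nz: "a \<noteq> 0 \<or> b \<noteq> 0 \<or> c \<noteq> 0"
  shows "card {x. a * x + b * fr 1 x + c * fr 3 x = 0} < q ^ 3"
  using nz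
proof (rule trinomial_zeros_if_monic)
  fix A B S assume S: "card S \<ge> q ^ 3" "\<And>x. x \<in> S \<Longrightarrow> fr 3 x = B * fr 1 x + A * x"
  have red: "fr 8 x = x" "fr 9 x = fr 1 x" for x
    using fr_mod_n[of 8 x] fr_mod_n[of 9 x] n8 by simp_all
  have big: "card S > q ^ 2" using S(1) power_strict_increasing[OF _ q_gt_1, of 2 3] by linarith
  have "((fr 5 A * fr 2 B + fr 5 B * fr 3 A) * A - 1) * x
      + ((fr 5 A * fr 2 B + fr 5 B * fr 3 A) * B + fr 5 B * fr 3 B * fr 1 A) * fr 1 x
      + (fr 5 A * fr 2 A + fr 5 B * fr 3 B * fr 1 B) * fr 2 x = 0" if "x \<in> S" for x
  proof -
    note it = trinomial_recurrence[OF S(2)[OF that]]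
    have e: "fr 8 x = fr 5 B * fr 6 x + fr 5 A * fr 5 x" "fr 6 x = fr 3 B * fr 4 x + fr 3 A * fr 3 x"
      "fr 5 x = fr 2 B * fr 3 x + fr 2 A * fr 2 x" "fr 4 x = fr 1 B * fr 2 x + fr 1 A * fr 1 x"
      using it[of 5] it[of 3] it[of 2] it[of 1] by simp_all
    have "fr 5 B * (fr 3 B * (fr 1 B * fr 2 x + fr 1 A * fr 1 x) + fr 3 A * (B * fr 1 x + A * x))
        + fr 5 A * (fr 2 B * (B * fr 1 x + A * x) + fr 2 A * fr 2 x) - x = 0"
      using e(1) unfolding e(2-4) S(2)[OF that] red by simp
    then show ?thesis by (simp only: algebra_simps mult_1_left add_0_left)
  qed
  note co = skew_coeffs_zero[OF big this]
  \<comment> \<open>\<open>e1\<close>, \<open>e2\<close>, \<open>e3\<close> are the coefficients of \<open>fr 2 x\<close>, \<open>fr 1 x\<close> and \<open>x\<close>; then \<open>f1\<close> and \<open>f2\<close>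
    express \<open>B * fr 1 B\<close> and \<open>fr 2 B / B\<close> through \<open>A\<close> alone\<close>
  have e1: "fr 5 B * fr 3 B * fr 1 B = - (fr 5 A * fr 2 A)" using co(3) by (simp add: eq_neg_iff_add_eq_0 add.commute)
  have e3: "(fr 5 A * fr 2 B + fr 5 B * fr 3 A) * A = 1" using co(1) by simp
  have A0: "A \<noteq> 0" using e3 by auto
  have B0: "B \<noteq> 0" using e3 by auto
  have e2: "B = - (fr 5 B * fr 3 B * fr 1 A * A)"
  proof -
    have "((fr 5 A * fr 2 B + fr 5 B * fr 3 A) * B + fr 5 B * fr 3 B * fr 1 A) * A = 0"
      using co(2) by simp
    then have "((fr 5 A * fr 2 B + fr 5 B * fr 3 A) * A) * B + fr 5 B * fr 3 B * fr 1 A * A = 0"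
      by (simp only: algebra_simps)
    then show ?thesis unfolding e3 by (simp add: eq_neg_iff_add_eq_0)
  qed
  have f1: "B * fr 1 B = A * fr 1 A * fr 2 A * fr 5 A"
  proof -
    have "B * fr 1 B = - (fr 5 B * fr 3 B * fr 1 B) * fr 1 A * A"
      by (subst e2) (simp add: ac_simps)
    then show ?thesis unfolding e1 by (simp add: ac_simps)
  qed
  have f2: "fr 2 B * A * fr 5 A = B * fr 3 A * fr 6 A"
  proof -
    have "fr 1 B * fr 2 B = fr 1 A * fr 2 A * fr 3 A * fr 6 A"
      using arg_cong[OF f1, of "fr 1"] by simp
    then have "(B * fr 1 B) * (fr 1 A * fr 2 A * fr 3 A * fr 6 A)
       = (fr 1 B * fr 2 B) * (A * fr 1 A * fr 2 A * fr 5 A)" using f1 by (simp add: ac_simps)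
    then have "(fr 1 B * fr 1 A * fr 2 A) * (fr 2 B * A * fr 5 A) = (fr 1 B * fr 1 A * fr 2 A) * (B * fr 3 A * fr 6 A)"
      by (simp only: ac_simps)
    then show ?thesis using A0 B0 by simp
  qed
  have f3: "fr 3 B * fr 1 A * fr 6 A = fr 1 B * fr 4 A * fr 7 A"
    using arg_cong[OF f2, of "fr 1"] by simp
  have f4: "fr 5 B * fr 3 A * A = fr 3 B * fr 6 A * fr 1 A"
    using arg_cong[OF f2, of "fr 3"] by (simp add: red)
  define t where "t = B * fr 3 A * fr 6 A"
  define u where "u = fr 1 B * fr 4 A * fr 7 A"
  have u: "fr 1 t = u" by (simp add: t_def u_def)
  have u0: "u \<noteq> 0" using A0 B0 by (simp add: u_def)
  have g3: "fr 3 B * fr 1 A * fr 6 A = u" using f3 u_def by simp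
  have g4: "fr 5 B * fr 3 A * A = u" using f4 g3 by (simp add: ac_simps)
  have tu: "t + u = 1"
  proof -
    have "(fr 2 B * A * fr 5 A) + fr 5 B * fr 3 A * A = 1" using e3 by (simp add: algebra_simps)
    then show ?thesis using f2 g4 t_def by simp
  qed
  \<comment> \<open>all three factors equal \<open>u\<close>\<close>
  have "(fr 5 B * fr 3 A * A) * (fr 3 B * fr 1 A * fr 6 A) * (fr 1 B * fr 4 A * fr 7 A)
     = - (t * u)"
  proof -
    have "(fr 5 B * fr 3 A * A) * (fr 3 B * fr 1 A * fr 6 A) * (fr 1 B * fr 4 A * fr 7 A)
       = (fr 5 B * fr 3 B * fr 1 B) * (fr 3 A * A * fr 1 A * fr 6 A * fr 4 A * fr 7 A)"
      by (simp only: ac_simps)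
    also have "\<dots> = - (A * fr 1 A * fr 2 A * fr 5 A) * (fr 3 A * fr 6 A * fr 4 A * fr 7 A)"
      unfolding e1 by (simp add: ac_simps)
    also have "\<dots> = - (t * u)" unfolding f1 [symmetric] t_def u_def by (simp add: ac_simps)
    finally show ?thesis .
  qed
  then have "u * (u * u + t) = 0" unfolding g3 g4 u_def [symmetric] by (simp add: algebra_simps)
  then have ut: "u * u = - t" using u0 by (simp add: eq_neg_iff_add_eq_0)
  have "u * u - u + 1 = 1 - (t + u)" unfolding ut by simp
  then have uu: "u * u - u + 1 = 0" unfolding tu by simp
  have u3: "u ^ 3 = - 1"
  proof -
    have "u ^ 3 + 1 = (u + 1) * (u * u - u + 1)" by (simp add: algebra_simps power3_eq_cube)
    then show ?thesis using uu by (simp add: eq_neg_iff_add_eq_0)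
  qed
  have "q mod 3 = 1" using q3 by (simp add: cong_def)
  then obtain j where j: "q = 3 * j + 1" by (metis mult_div_mod_eq)
  have uq: "u ^ q = (- 1) ^ j * u" by (simp add: j power_add power_mult u3)
  have "u ^ q * u ^ q - u ^ q + 1 = 0"
  proof -
    have add: "(x + y) ^ q = x ^ q + y ^ q" and neg: "(- x) ^ q = - (x ^ q)" for x y :: 'a
      using q_pow_add[of x y 1] q_pow_neg[of x 1] by simp_all
    have "(u * u - u + 1) ^ q = u ^ q * u ^ q - u ^ q + 1"
      unfolding diff_conv_add_uminus add neg power_mult_distrib by simp
    then show ?thesis using uu q_gt_1 by (simp add: power_0_left)
  qed
  then have uu': "u ^ q * u ^ q - u ^ q + 1 = 0" .
  have "u ^ q = u"
  proof (cases "even j")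
    case True
    then show ?thesis using uq by simp
  next
    case False
    then have m: "u ^ q = - u" using uq by simp
    then have "u * u + u + 1 = 0" using uu' by simp
    moreover have "(u * u + u + 1) - (u * u - u + 1) = u + u" by simp
    ultimately have "u = - u" using uu by (simp add: eq_neg_iff_add_eq_0)
    then show ?thesis using m by simp
  qed
  then have "u \<in> fixed" by (simp add: fixed_def)
  moreover have "t = fr 7 u" using arg_cong[OF u, of "fr 7"] by (simp add: red)
  ultimately have "t = u" using fr_fixed by simp
  then have "u * (u + 1) = 0" "u + u = 1" using ut tu by (auto simp: algebra_simps)
  then have "u = - 1" using u0 by (simp add: eq_neg_iff_add_eq_0)
  then have "(- 1 + - 1 :: 'a) = 1" using \<open>u + u = 1\<close> by metis
  moreover have "(3::'a) = 1 - (- 1 + - 1)" by simp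
  ultimately have "(3::'a) = 0" by (metis diff_self)
  moreover have "\<not> 3 dvd q" using \<open>q mod 3 = 1\<close> by presburger
  ultimately show False using three_neq_0 by simp
qed


section \<open>Scattered maps in dimensions six and eight\<close>

text \<open>
  If the quotient \<open>f x / x\<close> determines \<open>x\<close> up to the subfield, the zeros of each combination of the
  identity and \<open>f\<close> lie on one line over the subfield.
\<close>
lemma scattered_zeros:
  assumes sc: "\<And>x y. x \<noteq> 0 \<Longrightarrow> x * f y = y * f x \<Longrightarrow> y / x \<in> fixed"
    and nz: "u \<noteq> 0 \<or> v \<noteq> 0"
  shows "card {z. u * z + v * f z = 0} < q ^ 2"
proof -
  let ?S = "{z. u * z + v * f z = 0}"
  have "card ?S \<le> q"
  proof (cases "?S \<subseteq> {0}")
    case True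
    then have "card ?S \<le> card {0::'a}" by (intro card_mono) auto
    then show ?thesis using q_gt_1 by simp
  next
    case False
    then obtain x where x: "x \<noteq> 0" "u * x + v * f x = 0" by auto
    have v: "v \<noteq> 0" using x nz by auto
    have "?S \<subseteq> (\<lambda>c. c * x) ` fixed"
    proof
      fix y assume "y \<in> ?S"
      then have y: "u * y + v * f y = 0" by simp
      have "v * (x * f y - y * f x) = x * (u * y + v * f y) - y * (u * x + v * f x)"
        by (simp add: algebra_simps)
      then have "x * f y = y * f x" using v x(2) y by simp
      then have "y / x \<in> fixed" using sc x(1) by blast
      then show "y \<in> (\<lambda>c. c * x) ` fixed" using x(1) by (intro image_eqI[of _ _ "y / x"]) auto
    qed
    then have "card ?S \<le> card fixed" by (metis card_image_le card_mono finite order_trans finite_imageI)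
    then show ?thesis by (simp only: card_fixed)
  qed
  also have "q < q ^ 2" using power_strict_increasing[OF _ q_gt_1, of 1 2] by simp
  finally show ?thesis .
qed

text \<open>
  Let \<open>l = y / x\<close>. The equation determines \<open>(fr 5 x / fr 1 x)\<close> in terms of \<open>l\<close>; the product of this
  quotient and its fourth conjugate is 1, which leaves an equation in \<open>l\<close> alone. With
  \<open>D = l - fr 4 l\<close> and \<open>E = (l + fr 4 l) - fr 1 (l + fr 4 l)\<close> it reads \<open>E\<^sup>2 = D\<^sup>2 + (fr 1 D)\<^sup>2\<close>. The four
  conjugates of \<open>E\<close> sum to zero, and their squares satisfy \<open>E\<^sub>0\<^sup>2 + E\<^sub>2\<^sup>2 = E\<^sub>1\<^sup>2 + E\<^sub>3\<^sup>2\<close>, so the pairs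
  \<open>{E\<^sub>0, E\<^sub>2}\<close> and \<open>{- E\<^sub>1, - E\<^sub>3}\<close> coincide. Then \<open>D\<^sup>2\<close> is invariant under \<open>fr 2\<close>, hence \<open>fr 4 D = D\<close>;
  but \<open>fr 4 D = - D\<close> by definition, so \<open>D\<close> and \<open>E\<close> vanish.
\<close>
lemma scattered_binomial_8:
  assumes n8: "n = 8" and "odd q" and \<delta>: "\<delta> ^ 2 = - 1" and x0: "x \<noteq> 0"
    and eq: "x * (\<delta> * fr 1 y + fr 5 y) = y * (\<delta> * fr 1 x + fr 5 x)"
  shows "y / x \<in> fixed"
proof -
  have red: "fr 8 z = z" "fr 9 z = fr 1 z" "fr 10 z = fr 2 z" for z
    using fr_mod_n[of 8 z] fr_mod_n[of 9 z] fr_mod_n[of 10 z] n8 by simp_all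
  have two: "(2::'a) \<noteq> 0" using two_neq_0 \<open>odd q\<close> by simp
  have "(fr 2 \<delta> - \<delta>) * (fr 2 \<delta> + \<delta>) = fr 2 (\<delta> ^ 2) - \<delta> ^ 2"
    by (simp add: algebra_simps power2_eq_square)
  then have "(fr 2 \<delta> - \<delta>) * (fr 2 \<delta> + \<delta>) = 0" unfolding \<delta> by simp
  then have "fr 2 \<delta> = \<delta> \<or> fr 2 \<delta> = - \<delta>" by (simp add: eq_neg_iff_add_eq_0)
  moreover have "fr 4 \<delta> = fr 2 (fr 2 \<delta>)" by simp
  ultimately have d4: "fr 4 \<delta> = \<delta>" by (auto simp del: fr_fr)
  define l where "l = y / x"
  have y: "y = l * x" using x0 by (simp add: l_def)
  have "x * ((fr 5 l - l) * fr 5 x) = x * (\<delta> * (l - fr 1 l) * fr 1 x)"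
    using eq unfolding y by (simp add: algebra_simps)
  then have E1: "\<delta> * (l - fr 1 l) * fr 1 x = (fr 5 l - l) * fr 5 x" using x0 by simp
  have E2: "\<delta> * (fr 4 l - fr 5 l) * fr 5 x = (fr 1 l - fr 4 l) * fr 1 x"
    using arg_cong[OF E1, of "fr 4"] by (simp add: red d4)
  have "(fr 1 x * fr 5 x) * (\<delta> ^ 2 * ((l - fr 1 l) * (fr 4 l - fr 5 l)))
      = (\<delta> * (l - fr 1 l) * fr 1 x) * (\<delta> * (fr 4 l - fr 5 l) * fr 5 x)"
    by (simp only: power2_eq_square ac_simps)
  also have "\<dots> = (fr 1 x * fr 5 x) * ((fr 5 l - l) * (fr 1 l - fr 4 l))"
    unfolding E1 E2 by (simp only: ac_simps)
  finally have *: "(fr 1 x * fr 5 x) * (\<delta> ^ 2 * ((l - fr 1 l) * (fr 4 l - fr 5 l)))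
      = (fr 1 x * fr 5 x) * ((fr 5 l - l) * (fr 1 l - fr 4 l))" .
  have K: "(l - fr 1 l) * (fr 4 l - fr 5 l) + (fr 5 l - l) * (fr 1 l - fr 4 l) = 0"
  proof -
    have "fr 1 x * fr 5 x \<noteq> 0" using x0 by simp
    from * have "\<delta> ^ 2 * ((l - fr 1 l) * (fr 4 l - fr 5 l)) = (fr 5 l - l) * (fr 1 l - fr 4 l)"
      unfolding mult_left_cancel[OF \<open>fr 1 x * fr 5 x \<noteq> 0\<close>] .
    from this [symmetric] show ?thesis unfolding \<delta> by simp
  qed
  define D where "D k = fr k l - fr (k + 4) l" for k
  define E where "E k = fr k l + fr (k + 4) l - fr (k + 1) l - fr (k + 5) l" for k
  have frE: "fr j (E k) = E (j + k)" for j k by (simp add: E_def ac_simps)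
  have frD: "fr j (D k) = D (j + k)" for j k by (simp add: D_def ac_simps)
  have "E 0 * E 0 - (D 0 * D 0 + D 1 * D 1)
      = 2 * ((l - fr 1 l) * (fr 4 l - fr 5 l) + (fr 5 l - l) * (fr 1 l - fr 4 l))"
    by (simp add: E_def D_def algebra_simps)
  then have q0: "E 0 * E 0 = D 0 * D 0 + D 1 * D 1" unfolding K by simp
  have qk: "E k * E k = D k * D k + D (k + 1) * D (k + 1)" for k
    using arg_cong[OF q0, of "fr k"] by (simp add: frE frD)
  have D4: "D (k + 4) = - D k" for k
    using fr_add_n[of k l] n8 by (simp add: D_def add.assoc)
  have sumE: "E 0 + E 2 = - (E 1 + E 3)"
    by (simp add: E_def red)
  have sqE: "E 0 * E 0 + E 2 * E 2 = E 1 * E 1 + E 3 * E 3"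
    using qk[of 0] qk[of 1] qk[of 2] qk[of 3] D4[of 0] by simp
  have "2 * (E 0 * E 2) = (E 0 + E 2) * (E 0 + E 2) - (E 0 * E 0 + E 2 * E 2)"
    by (simp add: algebra_simps)
  also have "\<dots> = (E 1 + E 3) * (E 1 + E 3) - (E 1 * E 1 + E 3 * E 3)"
    unfolding sumE sqE by (simp only: minus_mult_minus)
  also have "\<dots> = 2 * (E 1 * E 3)" by (simp add: algebra_simps)
  finally have prodE: "E 0 * E 2 = E 1 * E 3" using two by simp
  have "(E 1 + E 0) * (E 1 + E 2) = E 1 * E 1 + E 1 * (E 0 + E 2) + E 0 * E 2"
    by (simp add: algebra_simps)
  also have "\<dots> = 0" unfolding sumE prodE by (simp add: algebra_simps)
  finally have "E 1 + E 0 = 0 \<or> E 1 + E 2 = 0" by simp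
  then have E10: "E 1 + E 0 = 0"
  proof
    assume "E 1 + E 2 = 0"
    then have "fr 1 (E 1 + E 0) = 0" by (simp add: frE add.commute)
    then show ?thesis by (simp only: fr_eq_0_iff)
  qed
  then have "E 1 * E 1 = E 0 * E 0" by (simp add: add_eq_0_iff2)
  then have "(D 2 - D 0) * (D 2 + D 0) = 0"
    using qk[of 0] qk[of 1] by (simp add: algebra_simps)
  then have "D 2 = D 0 \<or> D 2 = - D 0" by (simp add: eq_neg_iff_add_eq_0)
  then have "D 4 = D 0" using frD[of 2 2] frD[of 2 0] by auto
  then have "2 * D 0 = 0" using D4[of 0] by (simp add: eq_neg_iff_add_eq_0)
  then have D0: "D 0 = 0" using two by simp
  then have "D 1 = 0" using frD[of 1 0] by simp
  then have "E 0 = 0" using q0 D0 by simp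
  moreover have "fr 4 l = l" using D0 by (simp add: D_def)
  moreover from this have "fr 5 l = fr 1 l" using fr_fr[of 1 4 l] by simp
  ultimately have "2 * (l - fr 1 l) = 0" by (simp add: E_def algebra_simps)
  then have "fr 1 l = l" using two by simp
  then show ?thesis by (simp add: fixed_iff l_def)
qed

text \<open>
  Let \<open>P k\<close>, \<open>Q k\<close> and \<open>R k\<close> be the minors of the two rows \<open>(fr i x)\<close> and \<open>(fr i y)\<close> at the columns
  \<open>k\<close> and \<open>k + 1\<close>, \<open>k + 2\<close>, \<open>k + 3\<close>. The equation is linear in them: \<open>P 0 + R 0 = \<delta> * P 5\<close>, and with
  its conjugates it expresses each \<open>P k\<close> through \<open>R 0\<close>, \<open>R 1\<close>, \<open>R 2\<close>. Three Pluecker relations form a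
  homogeneous linear system for \<open>Q 0\<close>, \<open>Q 2\<close>, \<open>Q 4\<close>, and its determinant turns out to be a nonzero
  multiple of \<open>R 0 * R 1 * R 2\<close>, a product of three conjugates. So either \<open>Q 0 = 0\<close>, which puts
  \<open>y / x\<close> into the fixed field of \<open>fr 2\<close>, or all \<open>R k\<close> and then all \<open>P k\<close> vanish. The computation
  differs according to whether \<open>\<delta>\<close> is fixed by \<open>fr 1\<close> or sent to the other root \<open>- 1 - \<delta>\<close>.
\<close>
lemma scattered_trinomial_6:
  assumes n6: "n = 6" and "odd q" and \<delta>: "\<delta> ^ 2 + \<delta> = 1" and x0: "x \<noteq> 0"
    and eq: "x * (fr 1 y + fr 3 y + \<delta> * fr 5 y) = y * (fr 1 x + fr 3 x + \<delta> * fr 5 x)"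
  shows "y / x \<in> fixed"
proof -
  have red: "fr 6 z = z" "fr 7 z = fr 1 z" "fr 8 z = fr 2 z" "fr 9 z = fr 3 z" "fr 10 z = fr 4 z"
    "fr 11 z = fr 5 z" for z
    using fr_mod_n[of 11 z] fr_mod_n[of 10 z] fr_mod_n[of 6 z] fr_mod_n[of 7 z] fr_mod_n[of 8 z] fr_mod_n[of 9 z] n6 by simp_all
  have two: "(2::'a) \<noteq> 0" using two_neq_0 \<open>odd q\<close> by simp
  have dd: "\<delta> * \<delta> = 1 - \<delta>" using \<delta> by (simp add: power2_eq_square eq_diff_eq)
  have dd': "\<delta> * (\<delta> * z) = z - \<delta> * z" for z
    using arg_cong[OF dd, of "\<lambda>w. w * z"] by (simp add: algebra_simps)
  have d1: "\<delta> \<noteq> 0" "\<delta> \<noteq> 1" using dd by auto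
  have d2: "2 + \<delta> \<noteq> 0"
  proof
    assume "2 + \<delta> = 0"
    then have "\<delta> = - 2" by (simp add: eq_neg_iff_add_eq_0 add.commute)
    then have "(1::'a) + 1 = 1 + 0" using \<delta> by simp
    then show False by (simp only: add_left_cancel) simp
  qed
  \<comment> \<open>\<open>fr 1\<close> permutes the two roots \<open>\<delta>\<close> and \<open>- 1 - \<delta>\<close> of \<open>X\<^sup>2 + X - 1\<close>\<close>
  define e where "e = fr 1 \<delta>"
  have "(e - \<delta>) * (e + \<delta> + 1) = fr 1 (\<delta> ^ 2 + \<delta>) - (\<delta> ^ 2 + \<delta>)"
    by (simp add: e_def algebra_simps power2_eq_square)
  then have "(e - \<delta>) * (e + \<delta> + 1) = 0" unfolding \<delta> by simp
  then consider "e - \<delta> = 0" | "e + (\<delta> + 1) = 0" by (auto simp: add.assoc)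
  then have e: "e = \<delta> \<or> e = - 1 - \<delta>"
  proof cases
    case 2
    then have "e = - (\<delta> + 1)" by (simp only: eq_neg_iff_add_eq_0)
    then show ?thesis by simp
  qed simp
  moreover have "fr 2 \<delta> = fr 1 e" by (simp add: e_def)
  ultimately have fr2d: "fr 2 \<delta> = \<delta>" by (auto simp: e_def [symmetric])
  have frd: "fr 3 \<delta> = e" "fr 4 \<delta> = \<delta>" "fr 5 \<delta> = e"
  proof -
    show "fr 3 \<delta> = e" using arg_cong[OF fr2d, of "fr 1"] by (simp add: e_def)
    then show "fr 5 \<delta> = e" using arg_cong[OF fr2d, of "fr 3"] by simp
    have "fr 4 \<delta> = fr 2 (fr 2 \<delta>)" by simp
    then show "fr 4 \<delta> = \<delta>" by (simp only: fr2d)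
  qed
  define l where "l = y / x"
  have y: "y = l * x" using x0 by (simp add: l_def)
  define P where "P k = fr k x * fr (k + 1) y - fr k y * fr (k + 1) x" for k
  define Q where "Q k = fr k x * fr (k + 2) y - fr k y * fr (k + 2) x" for k
  define R where "R k = fr k x * fr (k + 3) y - fr k y * fr (k + 3) x" for k
  have frP: "fr j (P k) = P (j + k)" for j k by (simp add: P_def ac_simps)
  have frR: "fr j (R k) = R (j + k)" for j k by (simp add: R_def ac_simps)
  have R3: "R 3 = - R 0" "R 4 = - R 1" "R 5 = - R 2" by (simp_all add: R_def red)
  have P6: "P 6 = P 0" "P 7 = P 1" "P 8 = P 2" "P 9 = P 3" "P 10 = P 4" by (simp_all add: P_def red)
  have lin: "P 0 = \<delta> * P 5 - R 0"
    using eq by (simp add: P_def R_def red algebra_simps)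
  have lin1: "P 1 = e * P 0 - R 1"
    using arg_cong[OF lin, of "fr 1"] by (simp add: frP frR P6 e_def)
  have lin2: "P 2 = \<delta> * P 1 - R 2"
    using arg_cong[OF lin, of "fr 2"] by (simp add: frP frR P6 fr2d)
  have lin3: "P 3 = e * P 2 + R 0"
    using arg_cong[OF lin, of "fr 3"] by (simp add: frP frR P6 frd R3)
  have lin4: "P 4 = \<delta> * P 3 + R 1"
    using arg_cong[OF lin, of "fr 4"] by (simp add: frP frR P6 frd R3)
  have lin5: "P 5 = e * P 4 + R 2"
    using arg_cong[OF lin, of "fr 5"] by (simp add: frP frR P6 frd R3)
  have goal: "y / x \<in> fixed" if "P 0 = 0"
  proof -
    have "x * x * 0 = x * fr 1 x * (fr 1 l - l)" using that by (auto simp: P_def y algebra_simps)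
    then show ?thesis using x0 by (simp add: fixed_iff l_def)
  qed
  show ?thesis
  proof (cases "Q 0 = 0")
    case True
    then have "x * fr 2 x * (fr 2 l - l) = 0" by (simp add: Q_def y algebra_simps)
    then have l2: "fr 2 l = l" using x0 by simp
    have "fr 3 l = fr 1 (fr 2 l)" "fr 5 l = fr 3 (fr 2 l)" by simp_all
    then have l35: "fr 3 l = fr 1 l" "fr 5 l = fr 1 l" by (simp_all only: l2)
    \<comment> \<open>\<open>fr 1 l \<noteq> l\<close> would make \<open>?F\<close> zero; with its conjugates this is a circulant system of
      determinant \<open>(1 - \<delta>)\<^sup>2 * (2 + \<delta>)\<close>\<close>
    let ?F = "fr 1 x + fr 3 x + \<delta> * fr 5 x"
    have "x * (fr 1 l - l) * ?F = 0" using eq by (simp add: y l35 algebra_simps)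
    moreover have "?F \<noteq> 0"
    proof
      assume F: "?F = 0"
      have F2: "fr 3 x + fr 5 x + \<delta> * fr 1 x = 0" using arg_cong[OF F, of "fr 2"] by (simp add: red fr2d)
      have F4: "fr 5 x + fr 1 x + \<delta> * fr 3 x = 0" using arg_cong[OF F, of "fr 4"] by (simp add: red frd)
      have "(1 - \<delta>) * (fr 1 x - fr 5 x) = ?F - (fr 3 x + fr 5 x + \<delta> * fr 1 x)"
        by (simp add: algebra_simps)
      then have 1: "fr 5 x = fr 1 x" using F F2 d1 by simp
      have "(1 - \<delta>) * (fr 3 x - fr 1 x) = (fr 3 x + fr 5 x + \<delta> * fr 1 x) - (fr 5 x + fr 1 x + \<delta> * fr 3 x)"
        by (simp add: algebra_simps)
      then have 2: "fr 3 x = fr 1 x" using F4 F2 d1 by simp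
      have "(2 + \<delta>) * fr 1 x = 0" using F unfolding 1 2 by (simp add: algebra_simps)
      then show False using d2 x0 by simp
    qed
    ultimately have "fr 1 l = l" using x0 by simp
    then show ?thesis by (simp add: fixed_iff l_def)
  next
    case False
    \<comment> \<open>the Pluecker relation of the columns 0, 1, 2, 4 and two of its conjugates\<close>
    have r1: "P 0 * Q 2 - R 1 * Q 0 - P 1 * Q 4 = 0"
      by (simp add: P_def Q_def R_def red algebra_simps)
    have r2: "P 2 * Q 4 + R 0 * Q 2 - P 3 * Q 0 = 0"
      by (simp add: P_def Q_def R_def red algebra_simps)
    have r3: "P 4 * Q 0 + R 2 * Q 4 - P 5 * Q 2 = 0"
      by (simp add: P_def Q_def R_def red algebra_simps)
    let ?det = "P 0 * (P 3 * R 2 + P 2 * P 4) - R 1 * (R 0 * R 2 + P 2 * P 5) - P 1 * (P 3 * P 5 - R 0 * P 4)"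
    \<comment> \<open>Cramer's rule for the first unknown\<close>
    have "?det * Q 0 = (R 0 * R 2 + P 2 * P 5) * (P 0 * Q 2 - R 1 * Q 0 - P 1 * Q 4)
       - (P 0 * R 2 - P 1 * P 5) * (P 2 * Q 4 + R 0 * Q 2 - P 3 * Q 0)
       + (P 0 * P 2 + P 1 * R 0) * (P 4 * Q 0 + R 2 * Q 4 - P 5 * Q 2)"
      by (simp add: algebra_simps)
    then have det: "?det = 0" unfolding r1 r2 r3 using False by simp
    have R_zero: "R 0 = 0 \<and> R 1 = 0 \<and> R 2 = 0" if prod: "R 0 * R 1 * R 2 = 0"
    proof -
      have "R 1 = fr 1 (R 0)" "R 2 = fr 2 (R 0)" by (simp_all add: frR)
      then show ?thesis using prod by auto
    qed
    from e show ?thesis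
    proof
      \<comment> \<open>here \<open>u = P 0 + P 3\<close> vanishes, so \<open>P 0\<close>, \<open>P 1\<close>, \<open>P 2\<close> serve as coordinates\<close>
      assume ed: "e = \<delta>"
      define u where "u = P 0 + P 3"
      have "fr 2 u = P 2 + P 5" by (simp add: u_def frP)
      then have "u = \<delta> * fr 2 u"
        unfolding u_def by (simp only: lin3 ed) (subst lin, simp add: algebra_simps)
      moreover from arg_cong[OF this, of "fr 2"] have "fr 2 u = \<delta> * fr 4 u" by (simp add: fr2d)
      moreover have "fr 4 u = \<delta> * u"
        using arg_cong[OF calculation(1), of "fr 4"] by (simp add: red frd)
      ultimately have "u = \<delta> * (\<delta> * (\<delta> * u))" by metis
      then have "2 * ((1 - \<delta>) * u) = 0" by (simp add: dd' algebra_simps)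
      then have u0: "u = 0" using two d1 by simp
      then have P3: "P 3 = - P 0" unfolding u_def by (simp add: eq_neg_iff_add_eq_0 add.commute)
      have P4: "P 4 = - P 1" and P5: "P 5 = - P 2"
        using arg_cong[OF P3, of "fr 1"] arg_cong[OF P3, of "fr 2"] by (simp_all add: frP)
      have R0: "R 0 = - \<delta> * P 2 - P 0" and R1: "R 1 = \<delta> * P 0 - P 1" and R2: "R 2 = \<delta> * P 1 - P 2"
      proof -
        show "R 0 = - \<delta> * P 2 - P 0" using lin unfolding P5 by simp
        show "R 1 = \<delta> * P 0 - P 1" "R 2 = \<delta> * P 1 - P 2"
          by (subst lin1, simp add: ed) (subst lin2, simp)
      qed
      have "?det = \<delta> * (R 0 * R 1 * R 2)"
        unfolding R0 R1 R2 P3 P4 P5 by (simp add: algebra_simps dd dd')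
      then have "R 0 * R 1 * R 2 = 0" using det d1 by simp
      from R_zero[OF this] have "R 0 = 0 \<and> R 1 = 0 \<and> R 2 = 0" .
      then have "P 1 = \<delta> * P 0" "P 2 = \<delta> * P 1" "P 0 = - \<delta> * P 2"
        using R0 R1 R2 by simp_all
      then have "P 0 = - (\<delta> * (\<delta> * (\<delta> * P 0)))" by simp
      then have "2 * (\<delta> * P 0) = 0" by (simp add: dd' algebra_simps)
      then show ?thesis using goal two d1 by simp
    next
      assume ed: "e = - 1 - \<delta>"
      \<comment> \<open>here \<open>R 0\<close>, \<open>R 1\<close>, \<open>R 2\<close> serve as coordinates; halving them clears the denominators\<close>
      define r0 r1 r2 where "r0 = R 0 / 2" and "r1 = R 1 / 2" and "r2 = R 2 / 2"
      have Rr: "R 0 = 2 * r0" "R 1 = 2 * r1" "R 2 = 2 * r2"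
        using two by (simp_all add: r0_def r1_def r2_def)
      have "2 * P 0 = 2 * (- ((1 + \<delta>) * (r0 + r1) + (1 - \<delta>) * r2))"
        using lin unfolding lin5 lin4 lin3 lin2 lin1 ed Rr
        by (simp add: algebra_simps dd dd')
      then have p0: "P 0 = - ((1 + \<delta>) * (r0 + r1) + (1 - \<delta>) * r2)"
        using two by (simp only: mult_cancel_left) simp
      have "?det = 16 * (r0 * r1 * r2)"
        unfolding lin5 lin4 lin3 lin2 lin1 ed Rr p0 by (simp add: algebra_simps dd dd')
      then have "16 * (r0 * r1 * r2) = 0" using det by simp
      moreover have "(16::'a) = 2 ^ 4" by simp
      ultimately have "r0 * r1 * r2 = 0" using two by (metis mult_eq_0_iff power_not_zero)
      then have "R 0 * R 1 * R 2 = 0" unfolding Rr by auto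
      from R_zero[OF this] have "r0 = 0" "r1 = 0" "r2 = 0" using Rr two by auto
      then show ?thesis using goal p0 by simp
    qed
  qed
qed


text \<open>
  Write \<open>h1\<close>, \<open>h2\<close> for \<open>fr 1 h\<close>, \<open>fr 2 h\<close>. After the substitution \<open>w = h * x\<close> the map becomes the difference of two maps, the first of which factors
  through \<open>w \<mapsto> w - h * fr 5 h * fr 3 w\<close> and the second through \<open>w \<mapsto> w - (h / h1) * fr 3 w\<close>. Both
  kernels are lines over the fixed field of \<open>fr 3\<close>, and the field is their direct sum. So each \<open>w\<close>
  splits into components \<open>a = A w\<close> and \<open>b = B w\<close>, on which \<open>fr 3\<close> acts by the multipliers
  \<open>- h2 / h\<close> and \<open>h1 / h\<close>, and the map takes the form \<open>F w = p * fr 1 b - ((h + h1) / h1) * fr 2 a\<close>.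

  The equation and its image under \<open>fr 3\<close> separate the mixed terms \<open>c\<close>, \<open>d\<close> from the pure term \<open>X\<close>.
  The relation between \<open>c\<close> and \<open>d\<close> ties \<open>c\<close> to \<open>fr 2 c\<close>; applied three times around it
  gives \<open>c = - c\<close>, so \<open>c = 0\<close> for odd \<open>q\<close>. Then \<open>a = t * fr 1 b\<close> with the same \<open>t\<close> for both arguments,
  and \<open>X = 0\<close> leaves two possibilities. Either the components of both arguments are proportional
  over the subfield, or the values \<open>t * fr 2 t\<close> and its conjugates are prescribed. In the second case
  \<open>T = t * fr 2 t * fr 4 t\<close> is \<open>h * h2 / h1\<close> up to sign; but \<open>fr 1\<close> maps this element to \<open>- h1 / (h * h2)\<close>,
  whereas the multipliers give \<open>fr 1 T = (h1 / (h * h2))\<^sup>2 * T\<close>, the opposite sign.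
\<close>
lemma scattered_quadrinomial_6:
  assumes n6: "n = 6" and "odd q" and h: "h * fr 3 h = - 1" and x0: "x \<noteq> 0"
    and eq: "x * (fr 1 h / h * fr 1 y - fr 2 h / h * fr 2 y + fr 4 y + fr 5 y)
           = y * (fr 1 h / h * fr 1 x - fr 2 h / h * fr 2 x + fr 4 x + fr 5 x)"
  shows "y / x \<in> fixed"
proof -
  have red: "fr 6 z = z" "fr 7 z = fr 1 z" "fr 8 z = fr 2 z" for z
    using fr_mod_n[of 6 z] fr_mod_n[of 7 z] fr_mod_n[of 8 z] n6 by simp_all
  have two: "(2::'a) \<noteq> 0" using two_neq_0 \<open>odd q\<close> by simp
  define h1 h2 where "h1 = fr 1 h" and "h2 = fr 2 h"
  have h0: "h \<noteq> 0" using h by auto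
  then have h12: "h1 \<noteq> 0" "h2 \<noteq> 0" by (simp_all add: h1_def h2_def)
  note nz = h0 h12
  have h3: "fr 3 h = - 1 / h" using h h0 by (simp add: field_simps)
  have h4: "fr 4 h = - 1 / h1" and h5: "fr 5 h = - 1 / h2"
    using arg_cong[OF h3, of "fr 1"] arg_cong[OF h3, of "fr 2"] by (simp_all add: h1_def h2_def)
  have frh: "fr 1 h1 = h2" "fr 2 h1 = - 1 / h" "fr 3 h1 = - 1 / h1" "fr 4 h1 = - 1 / h2"
    "fr 1 h2 = - 1 / h" "fr 2 h2 = - 1 / h1" "fr 3 h2 = - 1 / h2" "fr 4 h2 = h"
    "fr 1 h = h1" "fr 2 h = h2"
    using h3 h4 h5 by (simp_all add: h1_def h2_def red)
  \<comment> \<open>\<open>h + h1\<close>, \<open>h1 + h2\<close> and \<open>p\<close> are the possible denominators; up to units they are conjugates of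
    each other\<close>
  have hs: "h + h1 \<noteq> 0"
  proof
    assume "h + h1 = 0"
    then have m: "h1 = - h" by (simp add: eq_neg_iff_add_eq_0 add.commute)
    from arg_cong[OF this, of "fr 1"] have "h2 = - h1" by (simp add: frh)
    then have "h2 = h" using m by simp
    from arg_cong[OF this, of "fr 1"] have "- 1 / h = h1" by (simp add: frh)
    then have "- 1 / h = - h" using m by simp
    then have "(h - 1) * (h + 1) = 0" using h0 by (simp add: field_simps)
    then have "h = 1 \<or> h = - 1" by (simp add: eq_neg_iff_add_eq_0)
    then have "h1 = h" by (auto simp: h1_def)
    then have "2 * h = 0" using m by (simp add: eq_neg_iff_add_eq_0)
    then show False using two h0 by simp
  qed
  have hs1: "h1 + h2 \<noteq> 0"
  proof -
    have "h1 + h2 = fr 1 (h + h1)" by (simp add: h1_def h2_def)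
    then show ?thesis using hs by (simp only: fr_eq_0_iff) simp
  qed
  define p where "p = 1 - h * h2"
  have p0: "p \<noteq> 0"
  proof
    assume "p = 0"
    then have "h2 = 1 / h" using h0 by (simp add: p_def field_simps)
    then have "fr 5 h = - h" unfolding h5 using h0 by simp
    from arg_cong[OF this, of "fr 1"] have "h = - h1" by (simp add: red h1_def)
    then show False using hs by simp
  qed
  define k s where "k = h + h1" and "s = h1 + h2"
  have frp: "fr 2 p = s / h1" "fr 4 p = k / h1" "fr 3 p = - p / (h * h2)"
    "fr 2 k = - p / h" "fr 3 k = - k / (h * h1)" "fr 4 k = - s / (h1 * h2)" "fr 3 s = - s / (h1 * h2)"
    using nz by (simp_all add: p_def k_def s_def frh h3 h4 field_simps)
  note nz = nz p0 hs [folded k_def] hs1 [folded s_def]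

  \<comment> \<open>\<open>A\<close> and \<open>B\<close> project to the two lines on which \<open>fr 3\<close> acts as in \<open>A3\<close> and \<open>B3\<close>\<close>
  define A where "A w = (h1 * w - h * fr 3 w) / s" for w
  define B where "B w = (h2 * w + h * fr 3 w) / s" for w
  have split: "w = A w + B w" for w
  proof -
    have "A w + B w = (s * w) / s"
      unfolding A_def B_def add_divide_distrib [symmetric] by (simp add: s_def algebra_simps)
    then show ?thesis using nz by simp
  qed
  have A3: "fr 3 (A w) = - (h2 / h) * A w" for w
  proof -
    have "fr 3 (A w) = (fr 3 h1 * fr 3 w - fr 3 h * w) / fr 3 s" by (simp add: A_def red)
    also have "\<dots> = - (h2 / h) * A w"
      unfolding frp frh h3 A_def using nz by (simp add: field_simps)
    finally show ?thesis .
  qed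
  have B3: "fr 3 (B w) = (h1 / h) * B w" for w
  proof -
    have "fr 3 (B w) = (fr 3 h2 * fr 3 w + fr 3 h * w) / fr 3 s" by (simp add: B_def red)
    also have "\<dots> = (h1 / h) * B w"
      unfolding frp frh h3 B_def using nz by (simp add: field_simps)
    finally show ?thesis .
  qed
  have A4: "fr 4 (A w) = fr 1 (A w) / (h * h1)" for w
    using arg_cong[OF A3[of w], of "fr 1"] by (simp add: frh)
  have B4: "fr 4 (B w) = (h2 / h1) * fr 1 (B w)" for w
    using arg_cong[OF B3[of w], of "fr 1"] by (simp add: frh)
  have A5: "fr 5 (A w) = fr 2 (A w) / (h1 * h2)" for w
    using arg_cong[OF A3[of w], of "fr 2"] by (simp add: frh)
  have B5: "fr 5 (B w) = - fr 2 (B w) / (h * h2)" for w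
    using arg_cong[OF B3[of w], of "fr 2"] by (simp add: frh)
  define F where "F w = p * fr 1 (B w) - k / h1 * fr 2 (A w)" for w
  have F: "h * (h1 / h * fr 1 z - h2 / h * fr 2 z + fr 4 z + fr 5 z) = F (h * z)" for z
  proof -
    let ?w = "h * z"
    have z: "fr 4 z = - h1 * fr 4 ?w" "fr 5 z = - h2 * fr 5 ?w"
      using nz by (simp_all add: h4 h5)
    have "h * (h1 / h * fr 1 z - h2 / h * fr 2 z + fr 4 z + fr 5 z)
        = fr 1 ?w - fr 2 ?w - h * h1 * fr 4 ?w - h * h2 * fr 5 ?w"
      unfolding z using nz by (simp add: frh algebra_simps)
    also have "\<dots> = fr 1 (A ?w + B ?w) - fr 2 (A ?w + B ?w) - h * h1 * fr 4 (A ?w + B ?w)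
        - h * h2 * fr 5 (A ?w + B ?w)"
      using split[of ?w] by metis
    also have "\<dots> = F ?w"
      unfolding fr_add A4 B4 A5 B5 F_def using nz by (simp add: p_def k_def field_simps)
    finally show ?thesis .
  qed
  define w w' where "w = h * x" and "w' = h * y"
  have w0: "w \<noteq> 0" using x0 h0 by (simp add: w_def)
  have wF: "w * F w' = w' * F w"
  proof -
    have "w * F w' = h * h * (x * (h1 / h * fr 1 y - h2 / h * fr 2 y + fr 4 y + fr 5 y))"
      unfolding w_def w'_def F [symmetric] by (simp only: ac_simps)
    also have "\<dots> = h * h * (y * (h1 / h * fr 1 x - h2 / h * fr 2 x + fr 4 x + fr 5 x))"
      using eq unfolding h1_def h2_def by simp
    also have "\<dots> = w' * F w"
      unfolding w_def w'_def F [symmetric] by (simp only: ac_simps)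
    finally show ?thesis .
  qed
  have goal: "y / x \<in> fixed" if "w' = l * w" "fr 1 l = l" for l
  proof -
    have "y / x = l" using that(1) x0 h0 by (simp add: w_def w'_def field_simps)
    then show ?thesis using that(2) by (simp add: fixed_iff)
  qed
  define a a' b b' where "a = A w" and "a' = A w'" and "b = B w" and "b' = B w'"
  have w_ab: "w = a + b" "w' = a' + b'"
    unfolding a_def a'_def b_def b'_def by (rule split)+
  define c where "c = a * fr 1 b' - a' * fr 1 b"
  define d where "d = b * fr 2 a' - b' * fr 2 a"
  define X where "X = p * (b * fr 1 b' - b' * fr 1 b) - k / h1 * (a * fr 2 a' - a' * fr 2 a)"
  have sum0: "X + p * c - k / h1 * d = 0"
  proof -
    have "X + p * c - k / h1 * d = (a + b) * F w' - (a' + b') * F w"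
      unfolding X_def c_def d_def F_def a_def [symmetric] a'_def [symmetric] b_def [symmetric] b'_def [symmetric]
      by (simp add: algebra_simps add_divide_distrib)
    also have "\<dots> = w * F w' - w' * F w" by (simp only: w_ab [symmetric])
    finally show ?thesis using wF by simp
  qed
  have fr3hh: "fr 3 (k / h1) = k / h"
    using nz by (simp add: frh frp field_simps)
  have c3: "fr 3 c = - (h2 / h) * (h2 / h1) * c"
    using nz by (simp add: c_def a_def a'_def b_def b'_def A3 B4 field_simps)
  have d3: "fr 3 d = (h1 / h) / (h1 * h2) * d"
    using nz by (simp add: d_def a_def a'_def b_def b'_def B3 A5 field_simps)
  have X3: "fr 3 X = - X / (h * h)"
  proof -
    have "fr 3 X = fr 3 p * (fr 3 b * fr 4 b' - fr 3 b' * fr 4 b)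
        - fr 3 (k / h1) * (fr 3 a * fr 5 a' - fr 3 a' * fr 5 a)"
      unfolding X_def by (simp only: fr_diff fr_mult fr_fr) simp
    also have "\<dots> = - X / (h * h)"
      unfolding fr3hh frp X_def a_def a'_def b_def b'_def A3 B3 A5 B4 using nz by (simp add: field_simps)
    finally show ?thesis .
  qed
  have sum3: "- X + h2 / h1 * (p * c) - h1 / h2 * (k / h1 * d) = 0"
  proof -
    have "0 = h * h * (fr 3 X + fr 3 p * fr 3 c - fr 3 (k / h1) * fr 3 d)"
      using arg_cong[OF sum0, of "fr 3"] by (simp only: fr_diff fr_mult fr_add) simp
    also have "\<dots> = - X + h2 / h1 * (p * c) - h1 / h2 * (k / h1 * d)"
      unfolding X3 fr3hh frp c3 d3 using nz by (simp add: field_simps)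
    finally show ?thesis by simp
  qed
  have cd: "h2 * p * c = k * d"
  proof -
    have "s * (h2 * p * c - k * d) = h1 * h2 * ((X + p * c - k / h1 * d)
        + (- X + h2 / h1 * (p * c) - h1 / h2 * (k / h1 * d)))"
      using nz by (simp add: s_def field_simps)
    then show ?thesis unfolding sum0 sum3 using nz by simp
  qed
  have c2: "fr 2 c = - (h1 / h) * d"
    using nz by (simp add: c_def d_def a_def a'_def b_def b'_def B3 field_simps)
  \<comment> \<open>\<open>e0\<close> and its conjugates \<open>e2\<close>, \<open>e4\<close> combine to \<open>c = - c\<close>\<close>
  have e0: "h1 * h2 * p * c = - h * k * fr 2 c"
    unfolding c2 using cd nz by (simp add: field_simps)
  have e2: "s * fr 2 c = h1 * h1 * h2 * p * fr 4 c"
  proof -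
    have "fr 2 h1 * fr 2 h2 * fr 2 p * fr 2 c = - fr 2 h * fr 2 k * fr 4 c"
      using arg_cong[OF e0, of "fr 2"] by simp
    then show ?thesis
      unfolding frh frp using nz by (simp add: field_simps)
  qed
  have e4: "h1 * h * k * fr 4 c = s * c"
  proof -
    have "fr 4 h1 * fr 4 h2 * fr 4 p * fr 4 c = - fr 4 h * fr 4 k * c"
      using arg_cong[OF e0, of "fr 4"] by (simp add: red)
    then show ?thesis
      unfolding frh frp h4 using nz by (simp add: field_simps)
  qed
  have "2 * (h1 * h2 * p * s * c) = 0"
  proof -
    have "s * (h1 * h2 * p * c) = - h * k * (s * fr 2 c)"
      unfolding e0 by (simp only: ac_simps)
    also have "\<dots> = - (h1 * h2 * p * (h1 * h * k * fr 4 c))" unfolding e2 by simp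
    also have "\<dots> = - (h1 * h2 * p * s * c)" unfolding e4 by (simp add: ac_simps)
    finally show ?thesis by (simp add: eq_neg_iff_add_eq_0 ac_simps)
  qed
  then have c0: "c = 0" using two nz by simp
  then have d0: "d = 0" using cd nz by simp
  have X0: "X = 0" using sum0 c0 d0 by simp
  show ?thesis
  proof (cases "b = 0")
    case True
    then have "a \<noteq> 0" using w0 w_ab by simp
    then have b'0: "b' = 0" using c0 True by (simp add: c_def)
    define l where "l = a' / a"
    have a': "a' = l * a" using \<open>a \<noteq> 0\<close> by (simp add: l_def)
    have "a * fr 2 a * (fr 2 l - l) = 0"
      using X0 True b'0 nz by (auto simp add: X_def a' algebra_simps)
    then have l2: "fr 2 l = l" using \<open>a \<noteq> 0\<close> by simp
    have "fr 3 l = l" using \<open>a \<noteq> 0\<close> nz by (simp add: l_def a_def a'_def A3)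
    moreover have "fr 3 l = fr 1 (fr 2 l)" by simp
    ultimately have "fr 1 l = l" unfolding l2 by simp
    then show ?thesis using goal[of l] w_ab True b'0 a' by simp
  next
    case False
    define t where "t = a / fr 1 b"
    have a: "a = t * fr 1 b" using False by (simp add: t_def)
    have a': "a' = t * fr 1 b'" using False c0 by (simp add: t_def c_def field_simps)
    have b3: "fr 3 b = (h1 / h) * b" "fr 3 b' = (h1 / h) * b'" by (simp_all add: b_def b'_def B3)
    have "h * X = (h * p + k * (t * fr 2 t)) * (b * fr 1 b' - b' * fr 1 b)"
      unfolding X_def a a' using nz by (simp add: b3 field_simps)
    then have "h * p + k * (t * fr 2 t) = 0 \<or> b * fr 1 b' - b' * fr 1 b = 0"
      using X0 by simp
    then show ?thesis
    proof
      assume bb: "b * fr 1 b' - b' * fr 1 b = 0"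
      define l where "l = b' / b"
      have "fr 1 l = l" using bb False by (simp add: l_def field_simps)
      moreover have "b' = l * b" using False by (simp add: l_def)
      moreover from calculation have "a' = l * a" unfolding a a' by simp
      ultimately show ?thesis using goal[of l] w_ab by (simp add: algebra_simps)
    next
      assume g0: "h * p + k * (t * fr 2 t) = 0"
      have g2: "h1 * p * (fr 2 t * fr 4 t) = h * h2 * s"
      proof -
        have "fr 2 h * fr 2 p + fr 2 k * (fr 2 t * fr 4 t) = 0"
          using arg_cong[OF g0, of "fr 2"] by simp
        then show ?thesis
          unfolding frh frp using nz by (simp add: field_simps)
      qed
      have g4: "h1 * s * (t * fr 4 t) = - h2 * k"
      proof -
        have "fr 4 h * fr 4 p + fr 4 k * (fr 4 t * t) = 0"
          using arg_cong[OF g0, of "fr 4"] by (simp add: red)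
        then show ?thesis
          unfolding frh frp h4 using nz by (simp add: field_simps)
      qed
      define T where "T = t * fr 2 t * fr 4 t"
      have g0': "k * (t * fr 2 t) = - (h * p)" using g0 by (simp add: eq_neg_iff_add_eq_0 add.commute)
      have "(k * s * p) * ((h1 * T) * (h1 * T))
          = (k * (t * fr 2 t)) * (h1 * p * (fr 2 t * fr 4 t)) * (h1 * s * (t * fr 4 t))"
        by (simp only: T_def ac_simps)
      also have "\<dots> = (k * s * p) * ((h * h2) * (h * h2))"
        unfolding g0' g2 g4 by (simp add: ac_simps)
      finally have "(h1 * T) * (h1 * T) = (h * h2) * (h * h2)" using nz by simp
      then have T: "h1 * T = h * h2 \<or> h1 * T = - (h * h2)"
        by (simp only: square_eq_iff)
      have t3: "fr 3 t = - (h1 / h) * t"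
        using nz by (simp add: t_def a_def b_def A3 B4)
      have t5: "fr 5 t = fr 2 t / (h * h2)"
        using arg_cong[OF t3, of "fr 2"] by (simp add: frh)
      have t1: "fr 1 t = - (h1 / h2) * fr 4 t"
        using arg_cong[OF t3, of "fr 4"] nz by (simp add: frh h4 red)
      have "fr 1 T = fr 1 t * fr 3 t * fr 5 t" by (simp add: T_def)
      then have T1: "fr 1 T * (h * h * h2 * h2) = h1 * h1 * T"
        unfolding t1 t3 t5 T_def using nz by (simp add: field_simps)
      have "2 * h1 = 0"
        using T
      proof
        assume *: "h1 * T = h * h2"
        from arg_cong[OF this, of "fr 1"] have "h2 * fr 1 T = - h1 / h"
          by (simp add: frh)
        then have "h * (h2 * fr 1 T) = - h1" using nz by simp
        moreover have "fr 1 T * (h * h * h2 * h2) = (h * (h2 * fr 1 T)) * (h * h2)" by (simp only: ac_simps)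
        ultimately have "fr 1 T * (h * h * h2 * h2) = - h1 * (h * h2)" by simp
        then have "- h1 * (h * h2) = h1 * (h * h2)" unfolding T1 * [symmetric] by (simp add: ac_simps)
        then have "(h * h2) * (2 * h1) = 0" by (simp add: algebra_simps)
        then show ?thesis using nz by simp
      next
        assume *: "h1 * T = - (h * h2)"
        from arg_cong[OF this, of "fr 1"] have "h2 * fr 1 T = h1 / h"
          by (simp add: frh)
        then have "h * (h2 * fr 1 T) = h1" using nz by simp
        moreover have "fr 1 T * (h * h * h2 * h2) = (h * (h2 * fr 1 T)) * (h * h2)" by (simp only: ac_simps)
        ultimately have "fr 1 T * (h * h * h2 * h2) = h1 * (h * h2)" by simp
        moreover have "h1 * h1 * T = h1 * (h1 * T)" by (simp add: ac_simps)
        ultimately have "h1 * (h * h2) = - (h1 * (h * h2))" using T1 * by simp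
        then have "(h * h2) * (2 * h1) = 0" by (simp add: algebra_simps)
        then show ?thesis using nz by simp
      qed
      then show ?thesis using two nz by simp
    qed
  qed
qed


section \<open>The special tuples have few zeros\<close>

lemma few_zeros_Gabidulin: "few_zeros q (map fr [0..<r])"
  unfolding few_zeros_def
proof (intro allI impI)
  fix a :: "nat \<Rightarrow> 'a"
  assume a: "\<exists>i<length (map fr [0..<r]). a i \<noteq> 0"
  then obtain m where m: "r = Suc m" by (cases r) auto
  have "(\<Sum>i<length (map fr [0..<r]). a i * (map fr [0..<r] ! i) x) = (\<Sum>i\<le>m. a i * fr i x)" for x
    unfolding m by (auto intro!: sum.cong simp: lessThan_Suc_atMost simp del: upt_Suc)
  moreover have "\<exists>i\<le>m. a i \<noteq> 0"
    using a unfolding m length_map length_upt diff_zero less_Suc_eq_le .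
  moreover have "q ^ m < q ^ length (map fr [0..<r])" using q_gt_1 by (simp add: m)
  ultimately show "card {x. (\<Sum>i<length (map fr [0..<r]). a i * (map fr [0..<r] ! i) x) = 0}
      < q ^ length (map fr [0..<r])"
    using skew_poly_zeros(1)[of m a] by simp
qed

text \<open>
  In a combination the coefficients of \<open>x\<close> and \<open>fr r x\<close> are proportional with factor \<open>\<delta>\<close>. With \<open>q ^ r\<close>
  zeros the equality case of \<open>skew_poly_zeros\<close> would determine the norm of \<open>\<delta>\<close>.
\<close>
lemma few_zeros_twisted_Gabidulin:
  assumes r: "r > 0" and N: "Nm \<delta> \<noteq> (- 1) ^ (n * r)"
  shows "few_zeros q (map fr [1..<r] @ [\<lambda>x. x + \<delta> * fr r x])"
  unfolding few_zeros_def
proof (intro allI impI)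
  let ?fs = "map fr [1..<r] @ [\<lambda>x. x + \<delta> * fr r x]"
  obtain m where m: "r = Suc m" using r by (cases r) auto
  have len: "length ?fs = r" by (simp add: m)
  fix a :: "nat \<Rightarrow> 'a"
  assume "\<exists>i<length ?fs. a i \<noteq> 0"
  then have a: "\<exists>i<r. a i \<noteq> 0" using len by simp
  define b where "b i = (if i = 0 then a m else if i = r then a m * \<delta> else a (i - 1))" for i
  have "(\<Sum>i<length ?fs. a i * (?fs ! i) x) = (\<Sum>i\<le>r. b i * fr i x)" for x
  proof -
    have "(\<Sum>i<length ?fs. a i * (?fs ! i) x) = (\<Sum>i<m. a i * fr (Suc i) x) + a m * (x + \<delta> * fr r x)"
      unfolding len unfolding m by (auto intro!: sum.cong simp: nth_append plus_1_eq_Suc simp del: upt_Suc)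
    also have "(\<Sum>i<m. a i * fr (Suc i) x) = (\<Sum>i<m. b (Suc i) * fr (Suc i) x)"
      by (auto intro!: sum.cong simp: b_def m)
    also have "\<dots> + a m * (x + \<delta> * fr r x) = (\<Sum>i<Suc m. b i * fr i x) + b r * fr r x"
      unfolding sum.lessThan_Suc_shift by (simp add: b_def m algebra_simps)
    also have "\<dots> = (\<Sum>i\<le>r. b i * fr i x)"
      unfolding m by (simp add: lessThan_Suc_atMost)
    finally show ?thesis .
  qed
  then have Z: "{x. (\<Sum>i<length ?fs. a i * (?fs ! i) x) = 0} = {x. (\<Sum>i\<le>r. b i * fr i x) = 0}" by simp
  have b: "\<exists>i\<le>r. b i \<noteq> 0"
  proof -
    obtain i where i: "i < r" "a i \<noteq> 0" using a by blast
    show ?thesis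
    proof (cases "i = m")
      case True
      then have "b 0 \<noteq> 0" using i by (simp add: b_def)
      then show ?thesis by blast
    next
      case False
      then have "b (Suc i) \<noteq> 0" "Suc i \<le> r" using i by (auto simp: b_def m)
      then show ?thesis by blast
    qed
  qed
  have "card {x. (\<Sum>i\<le>r. b i * fr i x) = 0} \<noteq> q ^ r"
  proof
    assume full: "card {x. (\<Sum>i\<le>r. b i * fr i x) = 0} = q ^ r"
    have "Nm (b 0) = (- 1) ^ (n * r) * Nm (b r)" using skew_poly_zeros(2)[OF b full] .
    then have "Nm (a m) = Nm (a m) * ((- 1) ^ (n * r) * Nm \<delta>)" using r by (simp add: b_def Nm_mult ac_simps)
    moreover have "(- 1) ^ (n * r) * Nm \<delta> \<noteq> 1"
    proof
      assume "(- 1) ^ (n * r) * Nm \<delta> = 1"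
      then have "(- 1) ^ (n * r) * ((- 1) ^ (n * r) * Nm \<delta>) = (- 1) ^ (n * r)" by simp
      moreover have "(- 1) ^ (n * r) * (- 1) ^ (n * r) = (1::'a)" by (simp flip: power_mult_distrib)
      ultimately show False using N by (simp flip: mult.assoc)
    qed
    ultimately have "Nm (a m) = 0" by simp
    then have am: "a m = 0" by (simp add: Nm_eq_0_iff)
    then have br: "b r = 0" using r by (simp add: b_def)
    then have "\<exists>i\<le>m. b i \<noteq> 0" using b m by (metis le_Suc_eq)
    moreover have "{x. (\<Sum>i\<le>r. b i * fr i x) = 0} = {x. (\<Sum>i\<le>m. b i * fr i x) = 0}"
      using br by (simp add: m)
    ultimately have "card {x. (\<Sum>i\<le>r. b i * fr i x) = 0} \<le> q ^ m"
      using skew_poly_zeros(1)[of m b] by simp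
    moreover have "q ^ m < q ^ r" using q_gt_1 by (simp add: m)
    ultimately show False using full by simp
  qed
  then show "card {x. (\<Sum>i<length ?fs. a i * (?fs ! i) x) = 0} < q ^ length ?fs"
    unfolding len Z [unfolded len] using skew_poly_zeros(1)[OF b] by simp
qed

lemma card_fr_preimage: "card {y. P (fr i y)} = card {z. P z}"
proof (rule bij_betw_same_card)
  have "bij (fr i)" using inj_fr[of i] finite_UNIV_inj_surj[OF finite inj_fr] by (auto intro: bijI)
  then show "bij_betw (fr i) {y. P (fr i y)} {z. P z}"
    by (auto simp: bij_betw_def inj_on_def surj_def bij_def image_iff)
qed

(* Explicit expansions, used to compare coefficient vectors of fixed length. *)
lemma sum_lessThan_6: "(\<Sum>k<(6::nat). f k) = f 0 + f 1 + f 2 + f 3 + f 4 + (f 5 :: 'a)"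
proof -
  have "{..<6::nat} = {0, 1, 2, 3, 4, 5}" by auto
  then show ?thesis by (simp add: add.assoc)
qed

lemma sum_lessThan_7: "(\<Sum>k<(7::nat). f k) = f 0 + f 1 + f 2 + f 3 + f 4 + f 5 + (f 6 :: 'a)"
proof -
  have "{..<7::nat} = {0, 1, 2, 3, 4, 5, 6}" by auto
  then show ?thesis by (simp add: add.assoc)
qed

lemma sum_lessThan_8: "(\<Sum>k<(8::nat). f k) = f 0 + f 1 + f 2 + f 3 + f 4 + f 5 + f 6 + (f 7 :: 'a)"
proof -
  have "{..<8::nat} = {0, 1, 2, 3, 4, 5, 6, 7}" by auto
  then show ?thesis by (simp add: add.assoc)
qed

lemma sum_lessThan_3: "(\<Sum>k<(3::nat). f k) = f 0 + f 1 + (f 2 :: 'a)"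
proof -
  have "{..<3::nat} = {0, 1, 2}" by auto
  then show ?thesis by (simp add: add.assoc)
qed

lemma ex_less_3: "(\<exists>k<3. P k) \<longleftrightarrow> P 0 \<or> P 1 \<or> P (2::nat)"
proof -
  have "k < 3 \<longleftrightarrow> k = 0 \<or> k = 1 \<or> k = 2" for k :: nat by auto
  then show ?thesis by auto
qed

lemma less_4_cases: "(i::nat) < 4 \<Longrightarrow> i = 0 \<or> i = 1 \<or> i = 2 \<or> i = 3" by auto
lemma less_5_cases: "(i::nat) < 5 \<Longrightarrow> i = 0 \<or> i = 1 \<or> i = 2 \<or> i = 3 \<or> i = 4" by auto
lemma less_6_cases: "(i::nat) < 6 \<Longrightarrow> i = 0 \<or> i = 1 \<or> i = 2 \<or> i = 3 \<or> i = 4 \<or> i = 5" by auto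
lemma less_7_cases: "(i::nat) < 7 \<Longrightarrow> i = 0 \<or> i = 1 \<or> i = 2 \<or> i = 3 \<or> i = 4 \<or> i = 5 \<or> i = 6" by auto
lemma less_8_cases: "(i::nat) < 8 \<Longrightarrow> i = 0 \<or> i = 1 \<or> i = 2 \<or> i = 3 \<or> i = 4 \<or> i = 5 \<or> i = 6 \<or> i = 7" by auto

lemma few_zeros_exponents_013:
  assumes "n = 7 \<and> odd q \<or> n = 8 \<and> [q = 1] (mod 3)"
  shows "few_zeros q [\<lambda>x. x, fr 1, fr 3]"
  unfolding few_zeros_def
proof (intro allI impI)
  fix a :: "nat \<Rightarrow> 'a"
  let ?fs = "[\<lambda>x. x, fr 1, fr 3]"
  have len: "length ?fs = 3" by simp
  assume "\<exists>i<length ?fs. a i \<noteq> 0"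
  then have "a 0 \<noteq> 0 \<or> a 1 \<noteq> 0 \<or> a 2 \<noteq> 0" unfolding len ex_less_3 .
  then have "card {x. a 0 * x + a 1 * fr 1 x + a 2 * fr 3 x = 0} < q ^ 3"
    using assms trinomial_zeros_7 trinomial_zeros_8 by blast
  then show "card {x. (\<Sum>i<length ?fs. a i * (?fs ! i) x) = 0} < q ^ length ?fs"
    unfolding len sum_lessThan_3 by simp
qed

text \<open>
  The dual has the exponents 1, 5, 6, which are 3, 0, 1 modulo 7 after substituting \<open>z = fr 5 y\<close>.
\<close>
lemma few_zeros_exponents_0234:
  assumes n7: "n = 7" and "odd q"
  shows "few_zeros q [\<lambda>x. x, fr 2, fr 3, fr 4]"
proof (rule few_zeros_by_duality)
  let ?M = "\<lambda>i k. [[1, 0, 0, 0, 0, 0, 0], [0, 0, 1, 0, 0, 0, 0],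
      [0, 0, 0, 1, 0, 0, 0], [0, 0, 0, 0, 1, 0, 0]] ! i ! k :: 'a"
  show "length [\<lambda>x. x, fr 2, fr 3, fr 4] = 4" "4 \<le> n" using n7 by simp_all
  show "([\<lambda>x. x, fr 2, fr 3, fr 4] ! i) x = (\<Sum>k<n. ?M i k * fr k x)" if "i < 4" for i x
    unfolding n7 sum_lessThan_7 using less_4_cases[OF that] by auto
  fix v :: "nat \<Rightarrow> 'a"
  assume nz: "\<exists>k<n. v k \<noteq> 0" and orth: "\<And>i. i < 4 \<Longrightarrow> (\<Sum>k<n. ?M i k * v k) = 0"
  have v: "v 0 = 0" "v 2 = 0" "v 3 = 0" "v 4 = 0"
    using orth[of 0] orth[of 1] orth[of 2] orth[of 3] unfolding n7 sum_lessThan_7 by simp_all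
  have red: "fr 6 y = fr 1 (fr 5 y)" "fr 1 y = fr 3 (fr 5 y)" for y
    using fr_mod_n[of 8 y] n7 by simp_all
  have "{y. (\<Sum>k<n. v k * fr k y) = 0}
      = {y. v 5 * fr 5 y + v 6 * fr 1 (fr 5 y) + v 1 * fr 3 (fr 5 y) = 0}"
    unfolding n7 sum_lessThan_7 by (simp add: v red [symmetric] ac_simps del: fr_fr)
  then have "card {y. (\<Sum>k<n. v k * fr k y) = 0}
      = card {z. v 5 * z + v 6 * fr 1 z + v 1 * fr 3 z = 0}"
    by (simp only: card_fr_preimage[of "\<lambda>z. v 5 * z + v 6 * fr 1 z + v 1 * fr 3 z = 0" 5])
  moreover have "v 5 \<noteq> 0 \<or> v 6 \<noteq> 0 \<or> v 1 \<noteq> 0"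
    using nz v less_7_cases unfolding n7 by metis
  ultimately show "card {y. (\<Sum>k<n. v k * fr k y) = 0} < q ^ (n - 4)"
    using trinomial_zeros_7[OF n7 \<open>odd q\<close>] n7 by simp
qed

text \<open>
  The dual has the exponents 1, 6, 7, which are 3, 0, 1 modulo 8 after substituting \<open>z = fr 6 y\<close>.
\<close>
lemma few_zeros_exponents_02345:
  assumes n8: "n = 8" and q3: "[q = 1] (mod 3)"
  shows "few_zeros q [\<lambda>x. x, fr 2, fr 3, fr 4, fr 5]"
proof (rule few_zeros_by_duality)
  let ?M = "\<lambda>i k. [[1, 0, 0, 0, 0, 0, 0, 0], [0, 0, 1, 0, 0, 0, 0, 0],
      [0, 0, 0, 1, 0, 0, 0, 0], [0, 0, 0, 0, 1, 0, 0, 0], [0, 0, 0, 0, 0, 1, 0, 0]] ! i ! k :: 'a"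
  show "length [\<lambda>x. x, fr 2, fr 3, fr 4, fr 5] = 5" "5 \<le> n" using n8 by simp_all
  show "([\<lambda>x. x, fr 2, fr 3, fr 4, fr 5] ! i) x = (\<Sum>k<n. ?M i k * fr k x)" if "i < 5" for i x
    unfolding n8 sum_lessThan_8 using less_5_cases[OF that] by auto
  fix v :: "nat \<Rightarrow> 'a"
  assume nz: "\<exists>k<n. v k \<noteq> 0" and orth: "\<And>i. i < 5 \<Longrightarrow> (\<Sum>k<n. ?M i k * v k) = 0"
  have v: "v 0 = 0" "v 2 = 0" "v 3 = 0" "v 4 = 0" "v 5 = 0"
    using orth[of 0] orth[of 1] orth[of 2] orth[of 3] orth[of 4] unfolding n8 sum_lessThan_8 by simp_all
  have red: "fr 7 y = fr 1 (fr 6 y)" "fr 1 y = fr 3 (fr 6 y)" for y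
    using fr_mod_n[of 9 y] n8 by simp_all
  have "{y. (\<Sum>k<n. v k * fr k y) = 0}
      = {y. v 6 * fr 6 y + v 7 * fr 1 (fr 6 y) + v 1 * fr 3 (fr 6 y) = 0}"
    unfolding n8 sum_lessThan_8 by (simp add: v red [symmetric] ac_simps del: fr_fr)
  then have "card {y. (\<Sum>k<n. v k * fr k y) = 0}
      = card {z. v 6 * z + v 7 * fr 1 z + v 1 * fr 3 z = 0}"
    by (simp only: card_fr_preimage[of "\<lambda>z. v 6 * z + v 7 * fr 1 z + v 1 * fr 3 z = 0" 6])
  moreover have "v 6 \<noteq> 0 \<or> v 7 \<noteq> 0 \<or> v 1 \<noteq> 0"
    using nz v less_8_cases unfolding n8 by metis
  ultimately show "card {y. (\<Sum>k<n. v k * fr k y) = 0} < q ^ (n - 5)"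
    using trinomial_zeros_8[OF n8 q3] n8 by simp
qed

text \<open>
  The dual is spanned by \<open>fr 7\<close> and \<open>y \<mapsto> \<delta> * y + fr 4 y\<close>; in terms of \<open>z = fr 7 y\<close> these are the
  identity and the map of \<open>scattered_binomial_8\<close>.
\<close>
lemma few_zeros_dual_binomial_8:
  assumes n8: "n = 8" and "odd q" and \<delta>: "\<delta> ^ 2 = - 1"
  shows "few_zeros q [fr 1, fr 2, fr 3, fr 5, fr 6, \<lambda>x. x - \<delta> * fr 4 x]"
proof (rule few_zeros_by_duality)
  let ?fs = "[fr 1, fr 2, fr 3, fr 5, fr 6, \<lambda>x. x - \<delta> * fr 4 x]"
  let ?M = "\<lambda>i k. [[0, 1, 0, 0, 0, 0, 0, 0], [0, 0, 1, 0, 0, 0, 0, 0],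
      [0, 0, 0, 1, 0, 0, 0, 0], [0, 0, 0, 0, 0, 1, 0, 0], [0, 0, 0, 0, 0, 0, 1, 0],
      [1, 0, 0, 0, - \<delta>, 0, 0, 0]] ! i ! k"
  show "length ?fs = 6" "6 \<le> n" using n8 by simp_all
  show "(?fs ! i) x = (\<Sum>k<n. ?M i k * fr k x)" if "i < 6" for i x
    unfolding n8 sum_lessThan_8 using less_6_cases[OF that] by auto
  fix v :: "nat \<Rightarrow> 'a"
  assume nz: "\<exists>k<n. v k \<noteq> 0" and orth: "\<And>i. i < 6 \<Longrightarrow> (\<Sum>k<n. ?M i k * v k) = 0"
  have v: "v 1 = 0" "v 2 = 0" "v 3 = 0" "v 5 = 0" "v 6 = 0" "v 0 = \<delta> * v 4"
    using orth[of 0] orth[of 1] orth[of 2] orth[of 3] orth[of 4] orth[of 5]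
    unfolding n8 sum_lessThan_8 by simp_all
  have red: "fr 0 y = fr 1 (fr 7 y)" "fr 4 y = fr 5 (fr 7 y)" for y
    using fr_mod_n[of 8 y] fr_mod_n[of 12 y] n8 by simp_all
  have "(\<Sum>k<n. v k * fr k y) = v 7 * fr 7 y + v 4 * (\<delta> * fr 1 (fr 7 y) + fr 5 (fr 7 y))" for y
    unfolding n8 sum_lessThan_8 red [symmetric] by (simp add: v algebra_simps)
  then have "card {y. (\<Sum>k<n. v k * fr k y) = 0}
      = card {z. v 7 * z + v 4 * (\<delta> * fr 1 z + fr 5 z) = 0}"
    by (simp only: card_fr_preimage[of "\<lambda>z. v 7 * z + v 4 * (\<delta> * fr 1 z + fr 5 z) = 0" 7])
  moreover have "v 7 \<noteq> 0 \<or> v 4 \<noteq> 0"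
    using nz v less_8_cases mult_zero_right unfolding n8 by metis
  ultimately show "card {y. (\<Sum>k<n. v k * fr k y) = 0} < q ^ (n - 6)"
    using scattered_zeros[of "\<lambda>z. \<delta> * fr 1 z + fr 5 z" "v 7" "v 4",
        OF scattered_binomial_8[OF n8 \<open>odd q\<close> \<delta>]] n8 by simp
qed

text \<open>
  The dual is spanned by \<open>fr 5\<close> and \<open>y \<mapsto> y + fr 2 y + \<delta> * fr 4 y\<close>; in terms of \<open>z = fr 5 y\<close> these are
  the identity and the map of \<open>scattered_trinomial_6\<close>.
\<close>
lemma few_zeros_dual_trinomial_6:
  assumes n6: "n = 6" and "odd q" and \<delta>: "\<delta> ^ 2 + \<delta> = 1"
  shows "few_zeros q [fr 1, fr 3, \<lambda>x. x - fr 2 x, \<lambda>x. fr 4 x - \<delta> * x]"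
proof (rule few_zeros_by_duality)
  let ?fs = "[fr 1, fr 3, \<lambda>x. x - fr 2 x, \<lambda>x. fr 4 x - \<delta> * x]"
  let ?M = "\<lambda>i k. [[0, 1, 0, 0, 0, 0], [0, 0, 0, 1, 0, 0],
      [1, 0, - 1, 0, 0, 0], [- \<delta>, 0, 0, 0, 1, 0]] ! i ! k"
  show "length ?fs = 4" "4 \<le> n" using n6 by simp_all
  show "(?fs ! i) x = (\<Sum>k<n. ?M i k * fr k x)" if "i < 4" for i x
    unfolding n6 sum_lessThan_6 using less_4_cases[OF that] by auto
  fix v :: "nat \<Rightarrow> 'a"
  assume nz: "\<exists>k<n. v k \<noteq> 0" and orth: "\<And>i. i < 4 \<Longrightarrow> (\<Sum>k<n. ?M i k * v k) = 0"
  have v: "v 1 = 0" "v 3 = 0" "v 2 = v 0" "v 4 = \<delta> * v 0"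
    using orth[of 0] orth[of 1] orth[of 2] orth[of 3] unfolding n6 sum_lessThan_6 by simp_all
  have red: "fr 0 y = fr 1 (fr 5 y)" "fr 2 y = fr 3 (fr 5 y)" "fr 4 y = fr 5 (fr 5 y)" for y
    using fr_mod_n[of 6 y] fr_mod_n[of 8 y] fr_mod_n[of 10 y] n6 by simp_all
  have "(\<Sum>k<n. v k * fr k y)
      = v 5 * fr 5 y + v 0 * (fr 1 (fr 5 y) + fr 3 (fr 5 y) + \<delta> * fr 5 (fr 5 y))" for y
    unfolding n6 sum_lessThan_6 red [symmetric] by (simp add: v algebra_simps)
  then have "card {y. (\<Sum>k<n. v k * fr k y) = 0}
      = card {z. v 5 * z + v 0 * (fr 1 z + fr 3 z + \<delta> * fr 5 z) = 0}"
    by (simp only: card_fr_preimage[of "\<lambda>z. v 5 * z + v 0 * (fr 1 z + fr 3 z + \<delta> * fr 5 z) = 0" 5])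
  moreover have "v 5 \<noteq> 0 \<or> v 0 \<noteq> 0"
    using nz v less_6_cases mult_zero_right unfolding n6 by metis
  ultimately show "card {y. (\<Sum>k<n. v k * fr k y) = 0} < q ^ (n - 4)"
    using scattered_zeros[of "\<lambda>z. fr 1 z + fr 3 z + \<delta> * fr 5 z" "v 5" "v 0",
        OF scattered_trinomial_6[OF n6 \<open>odd q\<close> \<delta>]] n6 by simp
qed

text \<open>
  The dual is spanned by the identity and the map of \<open>scattered_quadrinomial_6\<close>.
\<close>
lemma few_zeros_dual_quadrinomial_6:
  assumes n6: "n = 6" and "odd q" and h: "h * fr 3 h = - 1"
  shows "few_zeros q [\<lambda>x. fr 2 h / h * fr 1 x + fr 1 h / h * fr 2 x, fr 3,
     \<lambda>x. fr 1 x - fr 1 h / h * fr 4 x, \<lambda>x. fr 1 x - fr 1 h / h * fr 5 x]"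
    (is "few_zeros q ?fs")
proof (rule few_zeros_by_duality)
  have h0: "h \<noteq> 0" using h by auto
  let ?M = "\<lambda>i k. [[0, fr 2 h / h, fr 1 h / h, 0, 0, 0], [0, 0, 0, 1, 0, 0],
      [0, 1, 0, 0, - (fr 1 h / h), 0], [0, 1, 0, 0, 0, - (fr 1 h / h)]] ! i ! k"
  show "length ?fs = 4" "4 \<le> n" using n6 by simp_all
  show "(?fs ! i) x = (\<Sum>k<n. ?M i k * fr k x)" if "i < 4" for i x
    unfolding n6 sum_lessThan_6 using less_4_cases[OF that] by auto
  fix v :: "nat \<Rightarrow> 'a"
  assume nz: "\<exists>k<n. v k \<noteq> 0" and orth: "\<And>i. i < 4 \<Longrightarrow> (\<Sum>k<n. ?M i k * v k) = 0"
  have v1: "v 3 = 0" "v 1 = fr 1 h / h * v 4" "v 1 = fr 1 h / h * v 5" "fr 2 h / h * v 1 + fr 1 h / h * v 2 = 0"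
    using orth[of 0] orth[of 1] orth[of 2] orth[of 3] unfolding n6 sum_lessThan_6 by auto
  have "fr 1 h / h \<noteq> 0" using h0 by simp
  then have v5: "v 5 = v 4" using v1(2,3) mult_left_cancel by metis
  have "fr 1 h / h * (fr 2 h / h * v 4 + v 2) = 0"
    using v1(4) unfolding v1(2) by (simp add: algebra_simps)
  then have v2: "v 2 = - (fr 2 h / h * v 4)" using h0 by (simp add: eq_neg_iff_add_eq_0 add.commute)
  have "(\<Sum>k<n. v k * fr k y)
      = v 0 * y + v 4 * (fr 1 h / h * fr 1 y - fr 2 h / h * fr 2 y + fr 4 y + fr 5 y)" for y
    unfolding n6 sum_lessThan_6 by (simp add: v1(1,2) v5 v2 algebra_simps)
  then have "card {y. (\<Sum>k<n. v k * fr k y) = 0}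
      = card {y. v 0 * y + v 4 * (fr 1 h / h * fr 1 y - fr 2 h / h * fr 2 y + fr 4 y + fr 5 y) = 0}"
    by simp
  moreover have "v 0 \<noteq> 0 \<or> v 4 \<noteq> 0"
  proof (rule ccontr)
    assume "\<not> ?thesis"
    then have "v 0 = 0" "v 1 = 0" "v 2 = 0" "v 3 = 0" "v 4 = 0" "v 5 = 0"
      using v1(1,2) v5 v2 by simp_all
    then show False using nz less_6_cases unfolding n6 by metis
  qed
  ultimately show "card {y. (\<Sum>k<n. v k * fr k y) = 0} < q ^ (n - 4)"
    using scattered_zeros[of "\<lambda>y. fr 1 h / h * fr 1 y - fr 2 h / h * fr 2 y + fr 4 y + fr 5 y" "v 0" "v 4",
        OF scattered_quadrinomial_6[OF n6 \<open>odd q\<close> h]] n6 by simp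
qed

end

section \<open>Weights of the codewords\<close>

(* Restores the default orientation. *)
declare One_nat_def [symmetric, simp del] One_nat_def [simp]

lemma card_vec_prefix_zero:
  assumes "d \<le> r"
  shows "card {v \<in> carrier_vec r. \<forall>j<d. v $ j = (0::'a::{zero,finite})} = CARD('a) ^ (r - d)"
proof -
  let ?L = "{xs :: 'a list. set xs \<subseteq> UNIV \<and> length xs = r - d}"
  let ?f = "\<lambda>xs. vec_of_list (replicate d 0 @ xs) :: 'a vec"
  have "?f ` ?L = {v \<in> carrier_vec r. \<forall>j<d. v $ j = 0}"
  proof (intro equalityI subsetI)
    fix v assume "v \<in> ?f ` ?L"
    then obtain xs where xs: "length xs = r - d" "v = ?f xs" by blast
    have "dim_vec v = r" unfolding xs(2) dim_vec_of_list using xs(1) assms by simp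
    moreover have "v $ j = 0" if "j < d" for j
      unfolding xs(2) vec_of_list_index using that by (simp add: nth_append)
    ultimately show "v \<in> {v \<in> carrier_vec r. \<forall>j<d. v $ j = 0}" by (auto intro: carrier_vecI)
  next
    fix v :: "'a vec" assume v: "v \<in> {v \<in> carrier_vec r. \<forall>j<d. v $ j = 0}"
    then have "list_of_vec v = replicate d 0 @ drop d (list_of_vec v)"
      using assms by (intro nth_equalityI) (auto simp: nth_append list_of_vec_index length_list_of_vec)
    from arg_cong[OF this, of vec_of_list] have "v = ?f (drop d (list_of_vec v))"
      by (simp only: vec_list)
    then show "v \<in> ?f ` ?L" using v by (intro image_eqI[of _ _ "drop d (list_of_vec v)"]) auto
  qed
  moreover have "inj_on ?f ?L"
    by (rule inj_onI) (metis list_vec same_append_eq)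
  ultimately have "card {v \<in> carrier_vec r. \<forall>j<d. v $ j = (0::'a)} = card ?L"
    using card_image[of ?f ?L] by simp
  then show ?thesis using card_lists_length_eq[of "UNIV :: 'a set" "r - d"] by simp
qed

lemma finite_carrier_vec: "finite (carrier_vec r :: 'a::{zero,finite} vec set)"
proof -
  have "card (carrier_vec r :: 'a vec set) = CARD('a) ^ r"
    using card_vec_prefix_zero[of 0 r, where 'a='a] by simp
  then show ?thesis using card_ge_0_finite[of "carrier_vec r :: 'a vec set"] by (simp add: finite_UNIV_card_ge_0)
qed

lemma proj_point_eq:
  fixes v :: "'a::{field,finite} vec"
  assumes v: "v \<in> carrier_vec r"
  shows "proj_point r v = range (\<lambda>c. c \<cdot>\<^sub>v v)"
proof -
  interpret vec_space "TYPE('a)" r .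
  have "span {v} = range (\<lambda>c. c \<cdot>\<^sub>v v)"
  proof (intro equalityI subsetI)
    fix w assume "w \<in> span {v}"
    then obtain a where "w = lincomb a {v}"
      using finite_in_span[of "{v}" w] v by auto
    then show "w \<in> range (\<lambda>c. c \<cdot>\<^sub>v v)" using v by (auto simp: lincomb_def)
  next
    fix w assume "w \<in> range (\<lambda>c. c \<cdot>\<^sub>v v)"
    then obtain c where w: "w = c \<cdot>\<^sub>v v" by auto
    have "v \<in> span {v}" using v by (intro in_own_span[THEN subsetD]) auto
    then show "w \<in> span {v}" using w v smult_in_span[of "{v}" v c] by simp
  qed
  then show ?thesis by (simp add: proj_point_def)
qed

locale few_zeros_tuple = field_generator q n s ty
  for q n s and ty :: "'a::{field,finite} itself" +
  fixes fs :: "('a \<Rightarrow> 'a) list" and r :: nat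
  assumes len: "length fs = r" and r_le_n: "r \<le> n"
    and lin: "\<And>f. f \<in> set fs \<Longrightarrow> fixed_linear f"
    and few: "few_zeros q fs"
begin

definition comb :: "'a vec \<Rightarrow> 'a \<Rightarrow> 'a" where
  "comb a x = a \<bullet> tuple_vec fs x"

lemma tuple_carrier: "tuple_vec fs x \<in> carrier_vec r"
  by (rule carrier_vecI) (simp add: tuple_vec_def len)

lemma tuple_index: "i < r \<Longrightarrow> tuple_vec fs x $ i = (fs ! i) x"
  using len by (simp add: tuple_vec_def vec_of_list_index)

lemma comb_eq: "comb a x = (\<Sum>i<r. a $ i * (fs ! i) x)"
  using tuple_carrier[of x] by (simp add: comb_def scalar_prod_def tuple_index atLeast0LessThan)

lemma fixed_linear_comb: "fixed_linear (comb a)"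
  unfolding comb_eq by (intro fixed_linear_sum fixed_linear_scale lin) (simp add: len)

lemma comb_diff:
  "a \<in> carrier_vec r \<Longrightarrow> b \<in> carrier_vec r \<Longrightarrow> comb (a - b) x = comb a x - comb b x"
  by (simp add: comb_eq left_diff_distrib sum_subtractf)

lemma card_zeros_less:
  assumes "a \<in> carrier_vec r" "a \<noteq> 0\<^sub>v r"
  shows "card {x. comb a x = 0} < q ^ r"
proof -
  have "\<exists>i<r. a $ i \<noteq> 0" using assms by (metis carrier_vecD eq_vecI index_zero_vec)
  then show ?thesis using few by (simp add: few_zeros_def len comb_eq)
qed

lemma card_zeros_power:
  assumes "a \<in> carrier_vec r" "a \<noteq> 0\<^sub>v r"
  shows "\<exists>d<r. card {x. comb a x = 0} = q ^ d"
proof -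
  obtain d where d: "card {x. comb a x = 0} = q ^ d"
    using card_subspace[OF subspace_zeros[OF fixed_linear_comb]] by metis
  then have "d < r" using card_zeros_less[OF assms] q_gt_1 power_less_imp_less_exp by metis
  then show ?thesis using d by blast
qed

text \<open>
  Extend \<open>ys\<close> to \<open>r\<close> independent points. No nonzero combination vanishes at all of them, so the
  evaluation \<open>E\<close> at these points is a bijection of the coefficient vectors, and prescribing \<open>d\<close> zeros
  fixes \<open>d\<close> entries of the image. The list of points is reversed to bring \<open>ys\<close> to the front.
\<close>
lemma card_vanishing:
  assumes ys: "indep ys" "length ys = d" and "d \<le> r"
  shows "card {a \<in> carrier_vec r. \<forall>y\<in>set ys. comb a y = 0} = (q ^ n) ^ (r - d)"
proof -
  have "subspace_fixed (UNIV :: 'a set)" by (simp add: subspace_fixed_def)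
  then obtain zs where zs: "indep (zs @ ys)" "lspan (zs @ ys) = UNIV"
    using indep_extend[OF _ ys(1)] by auto
  have "q ^ length (zs @ ys) = q ^ n" using card_lspan[OF zs(1)] unfolding zs(2) card_UNIV by (rule sym)
  then have lz: "length (zs @ ys) = n" by (simp only: power_inject_exp[OF q_gt_1])
  define xs where "xs = drop (n - r) zs @ ys"
  have lx: "length xs = r" using lz ys(2) r_le_n \<open>d \<le> r\<close> by (auto simp: xs_def)
  have ix: "indep xs"
  proof (rule indep_suffix)
    have "take (n - r) zs @ xs = zs @ ys" by (simp add: xs_def flip: append_assoc)
    then show "indep (take (n - r) zs @ xs)" using zs(1) by simp
  qed
  define E where "E a = vec r (\<lambda>j. comb a (rev xs ! j))" for a
  have inj: "inj_on E (carrier_vec r)"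
  proof (rule inj_onI, rule ccontr)
    fix a b assume ab: "a \<in> carrier_vec r" "b \<in> carrier_vec r" "E a = E b" "a \<noteq> b"
    have "comb (a - b) y = 0" if "y \<in> set xs" for y
    proof -
      have "y \<in> set (rev xs)" using that by simp
      then obtain j where j: "j < r" "y = rev xs ! j"
        unfolding in_set_conv_nth length_rev lx by blast
      then have "comb a y = comb b y" using arg_cong[OF ab(3), of "\<lambda>v. v $ j"] by (simp add: E_def)
      then show ?thesis using ab by (simp add: comb_diff)
    qed
    then have sub: "lspan xs \<subseteq> {x. comb (a - b) x = 0}"
      by (intro lspan_subset subspace_zeros fixed_linear_comb) auto
    have "q ^ r \<le> card {x. comb (a - b) x = 0}"
      using card_mono[OF _ sub] card_lspan[OF ix] lx by simp
    moreover have "a - b \<noteq> 0\<^sub>v r"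
    proof (rule notI)
      assume z: "a - b = 0\<^sub>v r"
      have "a = b"
      proof (rule eq_vecI)
        show "dim_vec a = dim_vec b" using ab(1,2) by auto
        fix i assume i: "i < dim_vec b"
        then have "(a - b) $ i = a $ i - b $ i" by simp
        moreover have "(a - b) $ i = 0" unfolding z using i ab(2) by simp
        ultimately show "a $ i = b $ i" by simp
      qed
      then show False using ab(4) by simp
    qed
    moreover have "a - b \<in> carrier_vec r" using ab(1,2) by simp
    ultimately show False using card_zeros_less[of "a - b"] by simp
  qed
  have "E ` carrier_vec r = carrier_vec r"
    by (rule endo_inj_surj[OF finite_carrier_vec _ inj]) (auto simp: E_def)
  then have bij: "bij_betw E (carrier_vec r) (carrier_vec r)" using inj by (simp add: bij_betw_def)
  have "(\<forall>y\<in>set ys. comb a y = 0) \<longleftrightarrow> (\<forall>j<d. E a $ j = 0)" for a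
  proof -
    have "(\<forall>y\<in>set ys. comb a y = 0) \<longleftrightarrow> (\<forall>j<d. comb a (rev ys ! j) = 0)"
      using all_set_conv_all_nth[of "rev ys" "\<lambda>y. comb a y = 0"] ys(2) by simp
    moreover have "E a $ j = comb a (rev ys ! j)" if "j < d" for j
      using that ys(2) \<open>d \<le> r\<close> by (simp add: E_def xs_def nth_append)
    ultimately show ?thesis by simp
  qed
  then have eq: "{a \<in> carrier_vec r. \<forall>y\<in>set ys. comb a y = 0} = {a \<in> carrier_vec r. \<forall>j<d. E a $ j = 0}"
    by simp
  have "bij_betw E {a \<in> carrier_vec r. \<forall>j<d. E a $ j = 0} {v \<in> carrier_vec r. \<forall>j<d. v $ j = 0}"
  proof (rule bij_betw_subset[OF bij])
    show "E ` {a \<in> carrier_vec r. \<forall>j<d. E a $ j = 0} = {v \<in> carrier_vec r. \<forall>j<d. v $ j = 0}"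
      using bij by (auto simp: bij_betw_def)
  qed blast
  then have "card {a \<in> carrier_vec r. \<forall>j<d. E a $ j = 0} = CARD('a) ^ (r - d)"
    using card_vec_prefix_zero[OF \<open>d \<le> r\<close>, where 'a='a] by (simp add: bij_betw_same_card)
  then show ?thesis unfolding eq by (simp add: card_UNIV)
qed


text \<open>
  Let \<open>S\<close> be a space of dimension \<open>d\<close>, put \<open>m = r - d - 1\<close> and \<open>Q = q ^ n\<close>. By \<open>card_vanishing\<close>
  there are \<open>Q ^ (m + 1) - 1\<close> nonzero combinations that vanish on \<open>S\<close>, but for each of the at
  most \<open>Q - 1\<close> points outside \<open>S\<close> only \<open>Q ^ m - 1\<close> of them vanish there as well. So one of them has
  zero set \<open>S\<close>.
\<close>
lemma ex_card_zeros:
  assumes d: "d < r"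
  shows "\<exists>a\<in>carrier_vec r. a \<noteq> 0\<^sub>v r \<and> card {x. comb a x = 0} = q ^ d"
proof -
  have "subspace_fixed (UNIV :: 'a set)" by (simp add: subspace_fixed_def)
  moreover have "q ^ d \<le> card (UNIV :: 'a set)"
    unfolding card_UNIV using d r_le_n q_gt_1 by (intro power_increasing) auto
  ultimately obtain ys where ys: "indep ys" "length ys = d"
    using large_subspace_indep[of UNIV d] by auto
  define C where "C zs = {a \<in> carrier_vec r. \<forall>y\<in>set zs. comb a y = 0}" for zs
  define S where "S = lspan ys"
  define m where "m = r - Suc d"
  have rd: "r - d = Suc m" using d by (simp add: m_def)
  define Q where "Q = q ^ n"
  have Q: "Q > 1" using one_less_power[OF q_gt_1 n_pos] by (simp add: Q_def)
  have fin: "finite (C zs)" for zs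
    by (rule finite_subset[OF _ finite_carrier_vec[of r]]) (auto simp: C_def)
  have zero: "0\<^sub>v r \<in> C zs" for zs using tuple_carrier by (simp add: C_def comb_def)
  have cC: "card (C ys) = Q ^ Suc m"
    using card_vanishing[OF ys] d rd by (simp add: C_def Q_def)
  have cCy: "card (C (y # ys)) = Q ^ m" if "y \<notin> S" for y
    using card_vanishing[of "y # ys" "Suc d"] ys that d by (simp add: C_def Q_def S_def m_def)
  have "\<exists>a\<in>C ys - {0\<^sub>v r}. {x. comb a x = 0} \<subseteq> S"
  proof (rule ccontr)
    assume *: "\<not> ?thesis"
    have "C ys - {0\<^sub>v r} \<subseteq> (\<Union>y\<in>UNIV - S. C (y # ys) - {0\<^sub>v r})"
    proof
      fix a assume a: "a \<in> C ys - {0\<^sub>v r}"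
      then obtain y where "comb a y = 0" "y \<notin> S" using * by blast
      then show "a \<in> (\<Union>y\<in>UNIV - S. C (y # ys) - {0\<^sub>v r})" using a by (auto simp: C_def)
    qed
    then have "card (C ys - {0\<^sub>v r}) \<le> card (\<Union>y\<in>UNIV - S. C (y # ys) - {0\<^sub>v r})"
      using fin by (intro card_mono) auto
    also have "\<dots> \<le> (\<Sum>y\<in>UNIV - S. card (C (y # ys) - {0\<^sub>v r}))"
      by (rule card_UN_le) simp
    also have "\<dots> = card (UNIV - S) * (Q ^ m - 1)"
      using cCy fin zero by (simp add: card_Diff_singleton)
    also have "\<dots> \<le> (Q - 1) * (Q ^ m - 1)"
    proof (rule mult_right_mono)
      have "0 \<in> S" using subspace_fixedD(1)[OF subspace_lspan] by (simp add: S_def)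
      then have "card (UNIV - S) \<le> card (UNIV - {0::'a})" by (intro card_mono) auto
      then show "card (UNIV - S) \<le> Q - 1" by (simp add: card_Diff_singleton card_UNIV Q_def)
    qed simp
    also have "\<dots> < Q ^ Suc m - 1"
    proof -
      have "(Q - 1) * (Q ^ m - 1) + (Q - 1) + (Q ^ m - 1) = Q ^ Suc m - 1"
      proof -
        have "Q > 0" "Q ^ m > 0" using Q by auto
        then obtain k l where "Q = Suc k" "Q ^ m = Suc l"
          unfolding gr0_conv_Suc by blast
        then show ?thesis by (simp add: algebra_simps)
      qed
      then show ?thesis using Q by linarith
    qed
    also have "\<dots> = card (C ys - {0\<^sub>v r})" using cC fin zero by (simp add: card_Diff_singleton)
    finally show False by simp
  qed
  then obtain a where a: "a \<in> C ys" "a \<noteq> 0\<^sub>v r" "{x. comb a x = 0} \<subseteq> S" by blast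
  have "S \<subseteq> {x. comb a x = 0}"
    unfolding S_def using a(1) by (intro lspan_subset subspace_zeros fixed_linear_comb) (auto simp: C_def)
  then have "{x. comb a x = 0} = S" using a(3) by blast
  then have "card {x. comb a x = 0} = q ^ d" using card_lspan[OF ys(1)] ys(2) by (simp add: S_def)
  then show ?thesis using a by (auto simp: C_def)
qed

context
  fixes N :: nat and G :: "'a mat"
  assumes N: "N = (q ^ n - 1) div (q - 1)"
    and G: "G \<in> carrier_mat r N"
    and bij: "bij_betw (\<lambda>j. proj_point r (col G j)) {..<N}
           ((\<lambda>x. proj_point r (tuple_vec fs x)) ` (UNIV - {0}))"
begin

lemma N_mult: "(q - 1) * N = q ^ n - 1"
proof -
  have "int (q ^ n - 1) = int (q - 1) * (\<Sum>i<n. int q ^ i)"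
    using power_diff_1_eq[of "int q" n] q_gt_1 by (simp add: of_nat_diff)
  then have "int (q - 1) dvd int (q ^ n - 1)" by simp
  then have "q - 1 dvd q ^ n - 1" by (simp only: of_nat_dvd_iff)
  then show ?thesis by (simp add: N)
qed

text \<open>
  Each fibre of \<open>x \<mapsto> \<langle>f x\<rangle>\<close> contains the nonzero multiples of an element by the subfield of order \<open>q\<close>.
  There are \<open>N\<close> fibres and \<open>(q - 1) * N\<close> nonzero elements, so no fibre can be larger.
\<close>
lemma card_fibre:
  assumes "x \<noteq> 0"
  shows "card {y. y \<noteq> 0 \<and> proj_point r (tuple_vec fs y) = proj_point r (tuple_vec fs x)} = q - 1"
proof -
  define Pt where "Pt y = proj_point r (tuple_vec fs y)" for y
  define F where "F p = {y \<in> UNIV - {0}. Pt y = p}" for p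
  let ?X = "UNIV - {0::'a}"
  have lower: "q - 1 \<le> card (F p)" if p: "p \<in> Pt ` ?X" for p
  proof -
    obtain y where y: "y \<noteq> 0" "Pt y = p" using p by auto
    have "Pt (c * y) = Pt y" if c: "c \<in> fixed" "c \<noteq> 0" for c
    proof -
      have scale: "tuple_vec fs (c * y) = c \<cdot>\<^sub>v tuple_vec fs y"
      proof (rule eq_vecI)
        show "dim_vec (tuple_vec fs (c * y)) = dim_vec (c \<cdot>\<^sub>v tuple_vec fs y)"
          using tuple_carrier by (metis carrier_vecD smult_carrier_vec)
        fix i assume "i < dim_vec (c \<cdot>\<^sub>v tuple_vec fs y)"
        then have i: "i < r" using tuple_carrier[of y] by simp
        then have "fixed_linear (fs ! i)" using lin len by simp
        then show "tuple_vec fs (c * y) $ i = (c \<cdot>\<^sub>v tuple_vec fs y) $ i"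
          using i tuple_carrier[of y] c by (simp add: tuple_index fixed_linear_def)
      qed
      have "range (\<lambda>e. e \<cdot>\<^sub>v (c \<cdot>\<^sub>v tuple_vec fs y)) = range (\<lambda>e. e \<cdot>\<^sub>v tuple_vec fs y)"
      proof (intro equalityI subsetI)
        fix w assume "w \<in> range (\<lambda>e. e \<cdot>\<^sub>v tuple_vec fs y)"
        then obtain e where "w = e \<cdot>\<^sub>v tuple_vec fs y" by auto
        then have "w = (e / c) \<cdot>\<^sub>v (c \<cdot>\<^sub>v tuple_vec fs y)" using c by (simp add: smult_smult_assoc)
        then show "w \<in> range (\<lambda>e. e \<cdot>\<^sub>v (c \<cdot>\<^sub>v tuple_vec fs y))" by blast
      qed (auto simp: smult_smult_assoc)
      then show ?thesis
        unfolding Pt_def scale using tuple_carrier[of y] by (simp add: proj_point_eq)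
    qed
    then have "(\<lambda>c. c * y) ` (fixed - {0}) \<subseteq> F p" using y by (auto simp: F_def)
    then have "card ((\<lambda>c. c * y) ` (fixed - {0})) \<le> card (F p)" by (intro card_mono) auto
    moreover have "card ((\<lambda>c. c * y) ` (fixed - {0})) = q - 1"
      using y(1) card_fixed fixed_closed(1)
      by (subst card_image) (auto simp: inj_on_def card_Diff_singleton)
    ultimately show ?thesis by simp
  qed
  have cN: "card (Pt ` ?X) = N"
    using bij_betw_same_card[OF bij] by (simp add: Pt_def)
  have total: "(\<Sum>p\<in>Pt ` ?X. card (F p)) = (\<Sum>p\<in>Pt ` ?X. q - 1)"
  proof -
    have "card ?X = (\<Sum>p\<in>Pt ` ?X. card (F p))"
      using sum.image_gen[of ?X "\<lambda>_. 1::nat" Pt] by (simp add: F_def)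
    moreover have "card ?X = q ^ n - 1" by (simp add: card_Diff_singleton card_UNIV)
    ultimately show ?thesis using N_mult cN by (simp add: mult.commute)
  qed
  have "card (F (Pt x)) = q - 1"
  proof (rule ccontr)
    assume "card (F (Pt x)) \<noteq> q - 1"
    moreover have px: "Pt x \<in> Pt ` ?X" using assms by simp
    ultimately have "q - 1 < card (F (Pt x))" using lower[OF px] by simp
    then have "(\<Sum>p\<in>Pt ` ?X. q - 1) < (\<Sum>p\<in>Pt ` ?X. card (F p))"
      using lower px by (intro sum_strict_mono_ex1) auto
    then show False using total by simp
  qed
  then show ?thesis by (simp add: F_def Pt_def)
qed

text \<open>
  Whether a combination vanishes at \<open>x\<close> depends only on the point defined by \<open>x\<close>. The columns list
  the points, so each nonzero entry of the codeword accounts for a fibre of \<open>q - 1\<close> elements.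
\<close>
lemma weight_zeros:
  assumes a: "a \<in> carrier_vec r"
  shows "(q - 1) * hamming_weight (transpose_mat G *\<^sub>v a) + card {x. comb a x = 0} = q ^ n"
proof -
  define Pt where "Pt y = proj_point r (tuple_vec fs y)" for y
  define good where "good p \<longleftrightarrow> (\<exists>v\<in>p. a \<bullet> v \<noteq> 0)" for p
  have good: "good (proj_point r v) \<longleftrightarrow> a \<bullet> v \<noteq> 0" if "v \<in> carrier_vec r" for v
  proof -
    have "a \<bullet> (c \<cdot>\<^sub>v v) = c * (a \<bullet> v)" for c using a that by simp
    then show ?thesis
      using that by (auto simp: good_def proj_point_eq intro: exI[of _ 1])
  qed
  let ?X = "UNIV - {0::'a}"
  let ?P = "{p \<in> Pt ` ?X. good p}"
  have colv: "col G j \<in> carrier_vec r" if "j < N" for j using G that by auto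
  have wt: "hamming_weight (transpose_mat G *\<^sub>v a) = card {j \<in> {..<N}. a \<bullet> col G j \<noteq> 0}"
  proof -
    have "(transpose_mat G *\<^sub>v a) $ j = a \<bullet> col G j" if "j < N" for j
      using that G comm_scalar_prod[OF a colv[OF that]] by simp
    then have "{i. i < dim_vec (transpose_mat G *\<^sub>v a) \<and> (transpose_mat G *\<^sub>v a) $ i \<noteq> 0}
        = {j \<in> {..<N}. a \<bullet> col G j \<noteq> 0}" using G by auto
    then show ?thesis by (simp add: hamming_weight_def)
  qed
  also have "\<dots> = card ?P"
  proof (rule bij_betw_same_card)
    show "bij_betw (\<lambda>j. proj_point r (col G j)) {j \<in> {..<N}. a \<bullet> col G j \<noteq> 0} ?P"
      unfolding bij_betw_def
    proof
      show "inj_on (\<lambda>j. proj_point r (col G j)) {j \<in> {..<N}. a \<bullet> col G j \<noteq> 0}"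
        using bij by (auto simp: bij_betw_def inj_on_def)
      have im: "(\<lambda>j. proj_point r (col G j)) ` {..<N} = Pt ` ?X"
        using bij by (simp add: bij_betw_def Pt_def)
      have "(\<lambda>j. proj_point r (col G j)) ` {j \<in> {..<N}. a \<bullet> col G j \<noteq> 0}
          = {p \<in> (\<lambda>j. proj_point r (col G j)) ` {..<N}. good p}"
        using good colv by auto
      then show "(\<lambda>j. proj_point r (col G j)) ` {j \<in> {..<N}. a \<bullet> col G j \<noteq> 0} = ?P"
        unfolding im .
    qed
  qed
  finally have wP: "hamming_weight (transpose_mat G *\<^sub>v a) = card ?P" .
  have "{x. comb a x \<noteq> 0} = {x \<in> ?X. good (Pt x)}"
    using good[OF tuple_carrier] fixed_linear_zero[OF fixed_linear_comb[of a]] by (auto simp: comb_def Pt_def)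
  then have "card {x. comb a x \<noteq> 0} = (\<Sum>p\<in>Pt ` {x \<in> ?X. good (Pt x)}. card {y \<in> {x \<in> ?X. good (Pt x)}. Pt y = p})"
    using sum.image_gen[of "{x \<in> ?X. good (Pt x)}" "\<lambda>_. 1::nat" Pt] by simp
  also have "\<dots> = (\<Sum>p\<in>?P. q - 1)"
  proof (rule sum.cong)
    show "Pt ` {x \<in> ?X. good (Pt x)} = ?P" by auto
    fix p assume p: "p \<in> ?P"
    then obtain x where x: "x \<noteq> 0" "p = Pt x" by auto
    have "{y \<in> {x \<in> ?X. good (Pt x)}. Pt y = p} = {y. y \<noteq> 0 \<and> Pt y = Pt x}" using p x by auto
    then show "card {y \<in> {x \<in> ?X. good (Pt x)}. Pt y = p} = q - 1"
      using card_fibre[OF x(1)] by (simp add: Pt_def)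
  qed
  finally have "card {x. comb a x \<noteq> 0} = (q - 1) * card ?P" by simp
  moreover have "card {x. comb a x \<noteq> 0} + card {x. comb a x = 0} = q ^ n"
  proof -
    have "card ({x. comb a x \<noteq> 0} \<union> {x. comb a x = 0}) = card {x. comb a x \<noteq> 0} + card {x. comb a x = 0}"
      by (rule card_Un_disjoint) auto
    moreover have "{x. comb a x \<noteq> 0} \<union> {x. comb a x = 0} = UNIV" by auto
    ultimately show ?thesis using card_UNIV by simp
  qed
  ultimately show ?thesis using wP by simp
qed

lemma encode_nonzero:
  assumes "a \<in> carrier_vec r" "a \<noteq> 0\<^sub>v r"
  shows "transpose_mat G *\<^sub>v a \<noteq> 0\<^sub>v N"
proof
  assume "transpose_mat G *\<^sub>v a = 0\<^sub>v N"
  then have "hamming_weight (transpose_mat G *\<^sub>v a) = 0" by (simp add: hamming_weight_def)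
  then have "card {x. comb a x = 0} = q ^ n" using weight_zeros[OF assms(1)] by simp
  moreover have "q ^ r \<le> q ^ n" using r_le_n q_gt_1 by (simp add: power_increasing)
  ultimately show False using card_zeros_less[OF assms] by simp
qed

lemma card_weights:
  "card (hamming_weight ` (\<lambda>a. transpose_mat G *\<^sub>v a) ` (carrier_vec r - {0\<^sub>v r})) = r"
proof -
  let ?W = "hamming_weight ` (\<lambda>a. transpose_mat G *\<^sub>v a) ` (carrier_vec r - {0\<^sub>v r})"
  have w: "q ^ n - (q - 1) * hamming_weight (transpose_mat G *\<^sub>v a) = card {x. comb a x = 0}"
    if "a \<in> carrier_vec r" for a
    using weight_zeros[OF that] by simp
  have "(\<lambda>w. q ^ n - (q - 1) * w) ` ?W = (\<lambda>d. q ^ d) ` {..<r}"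
  proof (intro equalityI subsetI)
    fix k assume "k \<in> (\<lambda>w. q ^ n - (q - 1) * w) ` ?W"
    then obtain a where "a \<in> carrier_vec r" "a \<noteq> 0\<^sub>v r" "k = card {x. comb a x = 0}"
      using w by auto
    then show "k \<in> (\<lambda>d. q ^ d) ` {..<r}" using card_zeros_power[of a] by auto
  next
    fix k assume "k \<in> (\<lambda>d. q ^ d) ` {..<r}"
    then obtain d where d: "d < r" "k = q ^ d" by auto
    then obtain a where a: "a \<in> carrier_vec r" "a \<noteq> 0\<^sub>v r" "k = card {x. comb a x = 0}"
      using ex_card_zeros[OF d(1)] by auto
    then have "k = q ^ n - (q - 1) * hamming_weight (transpose_mat G *\<^sub>v a)" using w by simp
    then show "k \<in> (\<lambda>w. q ^ n - (q - 1) * w) ` ?W" using a by blast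
  qed
  moreover have "inj_on (\<lambda>w. q ^ n - (q - 1) * w) ?W"
  proof (rule inj_onI)
    fix v w assume "v \<in> ?W" "w \<in> ?W" and eq: "q ^ n - (q - 1) * v = q ^ n - (q - 1) * w"
    then obtain a b where "a \<in> carrier_vec r" "v = hamming_weight (transpose_mat G *\<^sub>v a)"
      "b \<in> carrier_vec r" "w = hamming_weight (transpose_mat G *\<^sub>v b)" by auto
    then have "(q - 1) * v \<le> q ^ n" "(q - 1) * w \<le> q ^ n"
      using weight_zeros by (metis le_add1)+
    then have "(q - 1) * v = (q - 1) * w" using eq by linarith
    then show "v = w" using q_gt_1 by simp
  qed
  moreover have "card ((\<lambda>d. q ^ d) ` {..<r}) = r"
    using q_gt_1 by (subst card_image) (auto simp: inj_on_def)
  ultimately show ?thesis by (metis card_image)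
qed

text \<open>
  The code is the row space. Encoding is injective since a combination with \<open>q ^ n\<close> zeros would
  contradict \<open>few_zeros\<close>, so the rows are distinct and independent.
\<close>
lemma rows_generate_weight_code: "\<exists>C. linear_code N r C \<and> generator_matrix N r C G \<and> weight_code N r C"
proof -
  interpret vs: vec_space "TYPE('a)" N .
  let ?H = "transpose_mat G"
  have H: "?H \<in> carrier_mat N r" using G by simp
  define C where "C = vs.row_space G"
  have rowsN: "set (rows G) \<subseteq> carrier_vec N" using G rows_carrier by blast
  have C_span: "C = vs.span (set (rows G))" by (simp add: C_def vs.row_space_def)
  have C_eq: "C = (\<lambda>a. ?H *\<^sub>v a) ` carrier_vec r"
    using vs.row_space_eq[OF G] G H by (auto simp: C_def image_iff)
  have ker: "a = 0\<^sub>v r" if "a \<in> carrier_vec r" "?H *\<^sub>v a = 0\<^sub>v N" for a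
    using encode_nonzero that by blast
  have dist: "distinct (rows G)"
  proof (rule ccontr)
    assume "\<not> distinct (rows G)"
    then obtain i j where ij: "i < r" "j < r" "i \<noteq> j" "row G i = row G j"
      using G by (auto simp: distinct_conv_nth)
    let ?a = "unit_vec r i - unit_vec r j :: 'a vec"
    have "?H *\<^sub>v ?a = 0\<^sub>v N"
    proof (rule eq_vecI)
      fix k assume k: "k < dim_vec (0\<^sub>v N :: 'a vec)"
      have "(?H *\<^sub>v ?a) $ k = col G k \<bullet> ?a" using k G by simp
      also have "\<dots> = col G k \<bullet> unit_vec r i - col G k \<bullet> unit_vec r j"
        using k G by (intro scalar_prod_minus_distrib[of _ r]) auto
      also have "\<dots> = G $$ (i, k) - G $$ (j, k)" using k G ij(1,2) by simp
      also have "G $$ (i, k) = G $$ (j, k)"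
        using arg_cong[OF ij(4), of "\<lambda>v. v $ k"] k G ij(1,2) by simp
      finally show "(?H *\<^sub>v ?a) $ k = 0\<^sub>v N $ k" using k by simp
    qed (use G in simp)
    then have "?a = 0\<^sub>v r" using ker[of ?a] by simp
    from arg_cong[OF this, of "\<lambda>v. v $ i"] have "?a $ i = 0" using ij by simp
    then show False using ij by simp
  qed
  have li: "\<not> vs.lin_dep (set (rows G))"
  proof
    assume "vs.lin_dep (set (rows G))"
    then have "vs.lin_dep (set (cols ?H))" using G by simp
    then obtain v where "v \<in> carrier_vec r" "v \<noteq> 0\<^sub>v r" "?H *\<^sub>v v = 0\<^sub>v N"
      using vs.lin_depE[OF H] dist G by auto
    then show False using ker by blast
  qed
  have sub: "VectorSpace.subspace class_ring C (vspace N)"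
    unfolding C_span using rowsN vs.span_is_subspace by simp
  have vsC: "vectorspace class_ring ((vspace N)\<lparr>carrier := C\<rparr>)"
    using vs.vector_space_row_space[OF G] by (simp add: C_def)
  have rowsC: "set (rows G) \<subseteq> C" unfolding C_span using rowsN by (rule vs.in_own_span)
  have subm: "LinearCombinations.submodule class_ring C (vspace N)"
    using sub by (simp add: VectorSpace.subspace_def)
  have basis: "vectorspace.basis class_ring ((vspace N)\<lparr>carrier := C\<rparr>) (set (rows G))"
    unfolding vectorspace.basis_def[OF vsC]
    using vs.span_li_not_depend[OF rowsC subm] li rowsC C_span by simp
  have "vectorspace.dim class_ring ((vspace N)\<lparr>carrier := C\<rparr>) = card (set (rows G))"
    by (rule vectorspace.dim_basis[OF vsC _ basis]) simp
  then have dim: "vectorspace.dim class_ring ((vspace N)\<lparr>carrier := C\<rparr>) = r"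
    using distinct_card[OF dist] G by simp
  have "C - {0\<^sub>v N} = (\<lambda>a. ?H *\<^sub>v a) ` (carrier_vec r - {0\<^sub>v r})"
  proof -
    have "?H *\<^sub>v 0\<^sub>v r = 0\<^sub>v N"
      using G by (intro eq_vecI) (auto simp: scalar_prod_def)
    then show ?thesis unfolding C_eq using encode_nonzero by auto
  qed
  then have "weight_code N r C" unfolding weight_code_def using card_weights by simp
  moreover have "linear_code N r C" using sub dim by (simp add: linear_code_def)
  moreover have "generator_matrix N r C G" using G dist basis by (simp add: generator_matrix_def)
  ultimately show ?thesis by blast
qed

end

end

section \<open>Scatteredness with respect to hyperplanes\<close>

lemma card_vectorspace:
  assumes vs: "vectorspace K V" and finV: "finite (carrier V)"
  shows "card (carrier V) = card (carrier K) ^ vectorspace.dim K V"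
proof -
  interpret vectorspace K V by fact
  have "gen_set (carrier V)"
    using in_own_span[of "carrier V"] span_is_subset2[of "carrier V"] by blast
  then have "fin_dim" unfolding fin_dim_def using finV by blast
  then obtain B where B: "finite B" "basis B" using finite_basis_exists by blast
  have BV: "B \<subseteq> carrier V" using B(2) by (simp add: basis_def)
  have ex1: "\<exists>!a. a \<in> B \<rightarrow>\<^sub>E carrier K \<and> lincomb a B = v" if "v \<in> carrier V" for v
    using basis_criterion[OF B(1) BV] B(2) that by blast
  have "bij_betw (\<lambda>a. lincomb a B) (B \<rightarrow>\<^sub>E carrier K) (carrier V)"
    unfolding bij_betw_def
  proof
    have cl: "lincomb a B \<in> carrier V" if "a \<in> B \<rightarrow>\<^sub>E carrier K" for a
      using BV that by (intro lincomb_closed) (auto simp: PiE_def)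
    show "inj_on (\<lambda>a. lincomb a B) (B \<rightarrow>\<^sub>E carrier K)"
      using ex1 cl by (intro inj_onI) metis
    show "(\<lambda>a. lincomb a B) ` (B \<rightarrow>\<^sub>E carrier K) = carrier V"
      using ex1 cl by (auto simp: image_iff) metis
  qed
  then have "card (carrier V) = card (B \<rightarrow>\<^sub>E carrier K)"
    by (simp add: bij_betw_same_card)
  also have "\<dots> = card (carrier K) ^ card B" using B(1) by (simp add: card_PiE)
  finally show ?thesis using dim_basis[OF B] by simp
qed

lemma card_orthogonal:
  fixes a :: "'a::{field,finite} vec"
  assumes a: "a \<in> carrier_vec r" "a \<noteq> 0\<^sub>v r"
  shows "CARD('a) * card {w \<in> carrier_vec r. a \<bullet> w = 0} = CARD('a) ^ r"
proof -
  obtain i where i: "i < r" "a $ i \<noteq> 0" using a by (metis carrier_vecD eq_vecI index_zero_vec)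
  let ?W = "{w \<in> carrier_vec r. a \<bullet> w = 0}"
  define e where "e = (1 / a $ i) \<cdot>\<^sub>v unit_vec r i"
  have e: "e \<in> carrier_vec r" by (simp add: e_def)
  have ae: "a \<bullet> (c \<cdot>\<^sub>v e) = c" for c
    using a(1) i by (simp add: e_def)
  have split: "a \<bullet> (w + c \<cdot>\<^sub>v e) = a \<bullet> w + c" if "w \<in> carrier_vec r" for w c
    using scalar_prod_add_distrib[OF a(1) that, of "c \<cdot>\<^sub>v e"] e ae by simp
  have cancel: "(w + c \<cdot>\<^sub>v e) + (- c) \<cdot>\<^sub>v e = w" "(w + (- c) \<cdot>\<^sub>v e) + c \<cdot>\<^sub>v e = w"
    if "w \<in> carrier_vec r" for w c
    using that e by (auto intro!: eq_vecI)
  have "bij_betw (\<lambda>(c, w). w + c \<cdot>\<^sub>v e) (UNIV \<times> ?W) (carrier_vec r)"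
    by (rule bij_betw_byWitness[where f' = "\<lambda>w. (a \<bullet> w, w + (- (a \<bullet> w)) \<cdot>\<^sub>v e)"])
      (use e in \<open>auto simp: split cancel\<close>)
  then have "card ((UNIV :: 'a set) \<times> ?W) = card (carrier_vec r :: 'a vec set)"
    by (rule bij_betw_same_card)
  then show ?thesis
    using card_vec_prefix_zero[of 0 r, where 'a='a] by (simp add: card_cartesian_product)
qed

lemma hyperplane_orthogonal:
  fixes a :: "'a::{field,finite} vec"
  assumes a: "a \<in> carrier_vec r" "a \<noteq> 0\<^sub>v r"
  shows "hyperplane r {w \<in> carrier_vec r. a \<bullet> w = 0}"
proof -
  interpret vec_space "TYPE('a)" r .
  let ?W = "{w \<in> carrier_vec r. a \<bullet> w = 0}"
  have sub: "VectorSpace.subspace class_ring ?W V"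
    unfolding VectorSpace.subspace_def submodule_def
    using a(1) vec_module[of r, where 'a='a] vec_vs[of r, where 'a='a]
    by (auto simp: module_vec_simps scalar_prod_add_distrib)
  then have vsW: "vectorspace class_ring (V\<lparr>carrier := ?W\<rparr>)"
    by (rule subspace_is_vs)
  have "card ?W = CARD('a) ^ vectorspace.dim class_ring (V\<lparr>carrier := ?W\<rparr>)"
    using card_vectorspace[OF vsW] finite_subset[OF _ finite_carrier_vec[of r], of ?W] by auto
  then have "CARD('a) ^ Suc (vectorspace.dim class_ring (V\<lparr>carrier := ?W\<rparr>)) = CARD('a) ^ r"
    using card_orthogonal[OF a] by simp
  moreover have "CARD('a) > 1"
    using card_mono[of UNIV "{0, 1::'a}"] by simp
  ultimately have "Suc (vectorspace.dim class_ring (V\<lparr>carrier := ?W\<rparr>)) = r"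
    by (simp only: power_inject_exp)
  then show ?thesis using sub by (auto simp: hyperplane_def)
qed

context field_generator
begin

text \<open>
  The tuple identifies the zeros of a combination with the intersection of the linear set's
  underlying subspace and a hyperplane, whose dimension over the small field is bounded by
  assumption.
\<close>
lemma few_zeros_scattered:
  assumes len: "length fs = r" and inj: "inj (tuple_vec fs)"
    and sc: "scattered_wrt_hyperplanes q n r (range (tuple_vec fs :: 'a \<Rightarrow> 'a vec))"
  shows "few_zeros q fs"
  unfolding few_zeros_def len
proof (intro allI impI)
  fix a :: "nat \<Rightarrow> 'a"
  assume a0: "\<exists>i<r. a i \<noteq> 0"
  let ?U = "range (tuple_vec fs :: 'a \<Rightarrow> 'a vec)"
  let ?W = "{w \<in> carrier_vec r. vec r a \<bullet> w = 0}"
  have a: "vec r a \<in> carrier_vec r" "vec r a \<noteq> 0\<^sub>v r"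
    using a0 by (auto, metis index_vec index_zero_vec(1))
  have tv: "tuple_vec fs x \<in> carrier_vec r" for x
    by (rule carrier_vecI) (simp add: tuple_vec_def len)
  have comb: "vec r a \<bullet> tuple_vec fs x = (\<Sum>i<r. a i * (fs ! i) x)" for x
    using tv[of x] len by (simp add: scalar_prod_def tuple_vec_def vec_of_list_index atLeast0LessThan)
  have subU: "VectorSpace.subspace (Fq q) ?U (vspace r)"
    using sc by (simp add: scattered_wrt_hyperplanes_def)
  have hyp: "hyperplane r ?W" by (rule hyperplane_orthogonal[OF a])
  have bound: "vectorspace.dim (Fq q) ((vspace r)\<lparr>carrier := ?W \<inter> ?U\<rparr>) \<le> r - 1"
    using sc hyp unfolding scattered_wrt_hyperplanes_def by blast
  have vsV: "vectorspace (Fq q) (vspace r :: ('a, 'a vec) module)"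
    and subm: "submodule (Fq q) ?U (vspace r)"
    using subU by (simp_all add: VectorSpace.subspace_def)
  have "submodule (Fq q) (?W \<inter> ?U) (vspace r)"
    using subm a(1) unfolding submodule_def
    by (auto simp: module_vec_simps scalar_prod_add_distrib[of _ r])
  then have "VectorSpace.subspace (Fq q) (?W \<inter> ?U) (vspace r)"
    using vsV by (simp add: VectorSpace.subspace_def)
  then have vsWU: "vectorspace (Fq q) ((vspace r)\<lparr>carrier := ?W \<inter> ?U\<rparr>)"
    by (rule vectorspace.subspace_is_vs[OF vsV])
  have Fq: "carrier (Fq q) = (fixed :: 'a set)" by (simp add: Fq_def fixed_def)
  have "card (?W \<inter> ?U) = q ^ vectorspace.dim (Fq q) ((vspace r)\<lparr>carrier := ?W \<inter> ?U\<rparr>)"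
    using card_vectorspace[OF vsWU] by (simp add: Fq card_fixed)
  also have "\<dots> \<le> q ^ (r - 1)" using bound q_gt_1 by (intro power_increasing) auto
  also have "\<dots> < q ^ r" using a0 q_gt_1 by (intro power_strict_increasing) auto
  finally have "card (?W \<inter> ?U) < q ^ r" .
  moreover have "?W \<inter> ?U = tuple_vec fs ` {x. (\<Sum>i<r. a i * (fs ! i) x) = 0}"
    using tv by (auto simp: comb)
  ultimately show "card {x. (\<Sum>i<r. a i * (fs ! i) x) = 0} < q ^ r"
    by (simp add: card_image[OF inj_on_subset[OF inj subset_UNIV]])
qed

lemma fixed_linear_diff: "fixed_linear f \<Longrightarrow> fixed_linear g \<Longrightarrow> fixed_linear (\<lambda>x. f x - g x)"
  by (simp add: fixed_linear_def algebra_simps)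

lemma fixed_linear_id: "fixed_linear (\<lambda>x. x)"
  by (simp add: fixed_linear_def)

lemma fixed_linear_power: "fixed_linear (\<lambda>x. x ^ (q ^ m))"
proof -
  have "c ^ (q ^ m) = c" if "c \<in> fixed" for c
    by (induction m) (use that in \<open>simp_all add: fixed_def power_mult\<close>)
  then show ?thesis by (simp add: fixed_linear_def q_pow_add power_mult_distrib)
qed

lemma special_tuple_fixed_linear:
  assumes "special_tuple q n r fs" "f \<in> set fs"
  shows "fixed_linear f"
proof -
  have p1: "fixed_linear (\<lambda>x. x ^ q)" using fixed_linear_power[of 1] by simp
  note lin = p1 fixed_linear_power fixed_linear_id fixed_linear_diff fixed_linear_add fixed_linear_scale
  show ?thesis
    using assms by cases (auto intro!: lin)
qed

end

lemma special_tuple_few_zeros: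
  fixes fs :: "('a::{field,finite} \<Rightarrow> 'a) list"
  assumes q: "primepow q" and n: "n > 0" and r: "r \<ge> 3" and card: "CARD('a) = q ^ n"
    and special: "special_tuple q n r fs"
  shows "length fs = r" "r \<le> n" "few_zeros q fs"
proof -
  have gen: "field_generator TYPE('a) q n s" if "gcd s n = 1" for s
    using that q n card by (simp add: field_generator_def coprime_iff_gcd_eq_1)
  interpret one: field_generator q n 1 "TYPE('a)" by (rule gen) simp
  have fr1: "one.fr = (\<lambda>i x. x ^ (q ^ i))" unfolding one.fr_def fun_eq_iff by simp
  have "length fs = r \<and> r \<le> n \<and> few_zeros q fs"
    using special
  proof cases
    case (type1 s)
    interpret field_generator q n s "TYPE('a)" by (rule gen[OF type1(4)])
    have "(\<lambda>i x. x ^ (q ^ (s * i))) = fr" by (simp add: fr_def fun_eq_iff)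
    then show ?thesis using few_zeros_Gabidulin[of r] type1 by simp
  next
    case (type2 s \<delta>)
    interpret field_generator q n s "TYPE('a)" by (rule gen[OF type2(4)])
    have "Nm \<delta> \<noteq> (- 1) ^ (n * r)" using type2 by simp
    moreover have "(\<lambda>i x. x ^ (q ^ (s * i))) = fr" by (simp add: fr_def fun_eq_iff)
    moreover have "(\<lambda>x. x + \<delta> * x ^ (q ^ (s * r))) = (\<lambda>x. x + \<delta> * fr r x)"
      by (simp add: fr_def fun_eq_iff)
    ultimately show ?thesis using few_zeros_twisted_Gabidulin[of r \<delta>] type2 r by simp
  next
    case (type3 \<delta>)
    have "inj (tuple_vec fs)"
    proof (rule injI)
      fix x y assume "tuple_vec fs x = tuple_vec fs y"
      from arg_cong[OF this, of "\<lambda>v. v $ 0"] have "x ^ q = y ^ q"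
        by (simp add: type3 tuple_vec_def vec_of_list_index)
      then have "one.fr 1 x = one.fr 1 y" unfolding fr1 by simp
      then show "x = y" using one.inj_fr[of 1] by (auto dest: injD)
    qed
    then show ?thesis using one.few_zeros_scattered[of fs r] type3 by simp
  next
    case (type4 \<delta>)
    show ?thesis using one.few_zeros_dual_trinomial_6[OF type4(1,4,5), unfolded fr1] type4 by simp
  next
    case (type5 h)
    have h0: "h \<noteq> 0" using type5 by auto
    have "q > 1" by (rule one.q_gt_1)
    then have p: "h ^ (q - 1) = h ^ q / h" "h ^ (q\<^sup>2 - 1) = h ^ q\<^sup>2 / h"
      using h0 by (simp_all add: power_diff)
    have "h * one.fr 3 h = - 1" using type5 unfolding fr1 by simp
    from one.few_zeros_dual_quadrinomial_6[OF type5(1,4) this, unfolded fr1] show ?thesis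
      using type5(1-3) unfolding p by simp
  next
    case (type6 s)
    interpret field_generator q n s "TYPE('a)" by (rule gen) (simp add: type6(1,6))
    have fr: "fr i = (\<lambda>x. x ^ (q ^ (s * i)))" for i by (simp add: fr_def fun_eq_iff)
    show ?thesis using few_zeros_exponents_013 type6(1,4) unfolding type6(3) fr
      by (simp add: mult.commute type6(1,2))
  next
    case (type7 s)
    interpret field_generator q n s "TYPE('a)" by (rule gen) (simp add: type7(1,6))
    have fr: "fr i = (\<lambda>x. x ^ (q ^ (s * i)))" for i by (simp add: fr_def fun_eq_iff)
    show ?thesis using few_zeros_exponents_0234[OF type7(1,4)] unfolding type7(3) fr
      by (simp add: mult.commute type7(1,2))
  next
    case (type8 s)
    interpret field_generator q n s "TYPE('a)" by (rule gen) (simp add: type8(1,6))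
    have fr: "fr i = (\<lambda>x. x ^ (q ^ (s * i)))" for i by (simp add: fr_def fun_eq_iff)
    show ?thesis using few_zeros_exponents_013 type8(1,4) unfolding type8(3) fr
      by (simp add: mult.commute type8(1,2))
  next
    case (type9 s)
    interpret field_generator q n s "TYPE('a)" by (rule gen) (simp add: type9(1,6))
    have fr: "fr i = (\<lambda>x. x ^ (q ^ (s * i)))" for i by (simp add: fr_def fun_eq_iff)
    show ?thesis using few_zeros_exponents_02345[OF type9(1,4)] unfolding type9(3) fr
      by (simp add: mult.commute type9(1,2))
  next
    case (type10 \<delta>)
    show ?thesis using one.few_zeros_dual_binomial_8[OF type10(1,4,5), unfolded fr1] type10 by simp
  qed
  then show "length fs = r" "r \<le> n" "few_zeros q fs" by auto
qed

theorem theorem7p1: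
  fixes q r n N :: nat
    and fs :: "('a::{field,finite} \<Rightarrow> 'a) list"
    and G :: "'a mat"
  assumes "primepow q"
    and "n > 0" and "r \<ge> 3"
    and "CARD('a) = q ^ n"
    and "special_tuple q n r fs"
    and "N = (q ^ n - 1) div (q - 1)"
    and "G \<in> carrier_mat r N"
    and "\<And>j. j < N \<Longrightarrow> col G j \<in> tuple_vec fs ` (UNIV - {0})"
    and "bij_betw (\<lambda>j. proj_point r (col G j)) {..<N}
           ((\<lambda>x. proj_point r (tuple_vec fs x)) ` (UNIV - {0}))"
  shows "\<exists>C. linear_code N r C \<and> generator_matrix N r C G \<and> weight_code N r C"
proof -
  interpret field_generator q n 1 "TYPE('a)"
    using assms(1,2,4) by (simp add: field_generator_def)
  interpret few_zeros_tuple q n 1 "TYPE('a)" fs r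
    by unfold_locales
      (use special_tuple_few_zeros[OF assms(1-5)] special_tuple_fixed_linear[OF assms(5)] in auto)
  show ?thesis using rows_generate_weight_code[OF assms(6,7,9)] .
qed

end
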